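(* Let $n\ge1$ and $\lambda\in\mathbb Z$. With highest weights taken with respect to the non-standard Borel subalgebra of $\widehat{gl}_{n|n}$, one has $$\mathrm{ch}\,L(\widehat{gl}_{n|n},\lambda\tilde\delta_1+\tilde\Lambda_0)=q^{-\frac{\lambda}{2}}\sum_{\mu-\nu=\lambda}HS_\mu(\mathbf{zq};\mathbf{yq})\,HS_\nu(\mathbf z^{-1}\mathbf q;\mathbf y^{-1}\mathbf q)\qquad\text{if }\lambda\ge0,$$ $$\mathrm{ch}\,L(\widehat{gl}_{n|n},(\lambda+1)\tilde\delta_n-\tilde\epsilon_n+\tilde\Lambda_0)=q^{\frac{\lambda}{2}}\sum_{\mu-\nu=\lambda}HS_\mu(\mathbf{zq};\mathbf{yq})\,HS_\nu(\mathbf z^{-1}\mathbf q;\mathbf y^{-1}\mathbf q)\qquad\text{if }\lambda<0,$$ where the sums are over $\mu,\nu\in\mathbb Z_+$ with $\mu-\nu=\lambda$ (each regarded as a one-row partition), $y_j=e^{\tilde\epsilon_j}$, $z_j=e^{\tilde\delta_j}$, $q=e^{-\tilde\delta}$, and $\mathbf{yq}=\{y_jq^s\}$, $\mathbf y^{-1}\mathbf q=\{y_j^{-1}q^s\}$, $\mathbf{zq}=\{z_jq^s\}$, $\mathbf z^{-1}\mathbf q=\{z_j^{-1}q^s\}$ with $j=1,\dots,n$ and $s\in\frac12+\mathbb Z_+$.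
   Context: $\mathbb Z_+=\{0,1,2,\dots\}$. $gl_{n|n}$ is the general linear Lie superalgebra of $\mathbb C^{n|n}$, with even basis $e_1,\dots,e_n$ and odd basis $f_1,\dots,f_n$; its elements are block matrices $\begin{pmatrix}E&a\\ b&e\end{pmatrix}$, with elementary matrices $E_{ij},a_{ij},b_{ij},e_{ij}$ in the respective blocks, and $\mathrm{Str}=\mathrm{Tr}(E)-\mathrm{Tr}(e)$. Its Cartan subalgebra is $\mathfrak h=\sum_i\mathbb CE_{ii}+\sum_j\mathbb Ce_{jj}$. The non-standard Borel subalgebra of $gl_{n|n}$ is the one of matrices that are upper triangular with respect to the ordered basis $f_1<e_1<f_2<e_2<\dots<f_n<e_n$. $\widehat{gl}_{n|n}=gl_{n|n}\otimes\mathbb C[t,t^{-1}]+\mathbb CC+\mathbb Cd$ with $A(k)=A\otimes t^k$, $[A(k),B(l)]=[A,B](k+l)+\delta_{k+l,0}\,k\,\mathrm{Str}(AB)C$, $[d,A(k)]=kA(k)$, $C$ central. Its Cartan subalgebra is $\hat{\mathfrak h}=\mathfrak h+\mathbb CC+\mathbb Cd$. Define elements of $\hat{\mathfrak h}^*$: $\tilde\epsilon_i$ is dual to $E_{ii}$ and $\tilde\delta_j$ is dual to $e_{jj}$ (each zero on all other $E_{kk},e_{kk}$ and on $C,d$); $\tilde\Lambda_0(C)=1$, $\tilde\Lambda_0(\mathfrak h)=\tilde\Lambda_0(d)=0$; $\tilde\delta(d)=1$, $\tilde\delta(\mathfrak h)=\tilde\delta(C)=0$. For a Borel subalgebra $B\supseteq\mathfrak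 h$ of $gl_{n|n}$, the corresponding Borel subalgebra of $\widehat{gl}_{n|n}$ is $B+\mathbb CC+\mathbb Cd+gl_{n|n}\otimes t\mathbb C[t]$; the non-standard Borel subalgebra of $\widehat{gl}_{n|n}$ is the one with $B$ the non-standard Borel subalgebra of $gl_{n|n}$. $L(\widehat{gl}_{n|n},\Lambda)$ denotes the irreducible highest weight module of highest weight $\Lambda\in\hat{\mathfrak h}^*$. Its character is the formal sum of $\dim(L_\eta)e^\eta$ over the weights $\eta$ with respect to $\mathfrak h+\mathbb Cd$ (the action of $C$ is not recorded, i.e. the factor $e^{\tilde\Lambda_0}$ is omitted). For a partition $\lambda$ the hook Schur function is $HS_\lambda(\mathbf x;\mathbf y)=\sum_{\mu\subset\lambda}s_\mu(\mathbf x)s_{\lambda'/\mu'}(\mathbf y)$, where $s$ denotes (skew) Schur functions in the countable variable sets $\mathbf x,\mathbf y$, and $'$ denotes the conjugate partition; for $k\in\mathbb Z_+$, $HS_k$ means $HS_{(k)}$. *)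

theory Defs
  imports "HOL-Analysis.Analysis" "HOL-Library.Poly_Mapping"
begin

section \<open>The Lie superalgebra gl(n|n)\<close>

text \<open>
  The number n is the cardinality of a finite linearly ordered type \<open>'n\<close>, whose elements in increasing
  order play the role of 1, ..., n.  The homogeneous basis of the superspace is indexed by
  \<open>'n + 'n\<close>: the index \<open>Inl i\<close> stands for the even vector e_i and \<open>Inr j\<close> for the odd vector f_j.
  The entry of a matrix A in row x and column y is \<open>A $ x $ y\<close>.
\<close>

type_synonym 'n gl = "complex ^ ('n + 'n) ^ ('n + 'n)"

definition mat_scale :: "complex \<Rightarrow> 'n::finite gl \<Rightarrow> 'n gl" where
  "mat_scale c A = (\<chi> x y. c * A $ x $ y)"

definition mat_unit :: "'n::finite + 'n \<Rightarrow> 'n + 'n \<Rightarrow> 'n gl" where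
  "mat_unit x y = (\<chi> x' y'. if x' = x \<and> y' = y then 1 else 0)"

text \<open>Parities are Booleans: \<open>False\<close> is even, \<open>True\<close> is odd.\<close>

definition gl_part :: "bool \<Rightarrow> 'n::finite gl \<Rightarrow> 'n gl" where
  "gl_part p A = (\<chi> x y. if (isl x \<noteq> isl y) = p then A $ x $ y else 0)"

definition gl_bracket :: "'n::finite gl \<Rightarrow> 'n gl \<Rightarrow> 'n gl" where
  "gl_bracket A B = (\<Sum>p\<in>UNIV. \<Sum>r\<in>UNIV.
     gl_part p A ** gl_part r B
       - mat_scale (if p \<and> r then - 1 else 1) (gl_part r B ** gl_part p A))"

definition Str :: "'n::finite gl \<Rightarrow> complex" where
  "Str A = (\<Sum>i\<in>UNIV. A $ Inl i $ Inl i) - (\<Sum>j\<in>UNIV. A $ Inr j $ Inr j)"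

text \<open>The strict order f_1 < e_1 < f_2 < e_2 < ... < f_n < e_n.\<close>

fun ns_less :: "'n::linorder + 'n \<Rightarrow> 'n + 'n \<Rightarrow> bool" where
  "ns_less (Inl i) (Inl j) \<longleftrightarrow> i < j"
| "ns_less (Inr i) (Inr j) \<longleftrightarrow> i < j"
| "ns_less (Inr i) (Inl j) \<longleftrightarrow> i \<le> j"
| "ns_less (Inl i) (Inr j) \<longleftrightarrow> i < j"

definition ns_borel :: "'n::{finite,linorder} gl set" where
  "ns_borel = {A. \<forall>x y. A $ x $ y \<noteq> 0 \<longrightarrow> x = y \<or> ns_less x y}"


section \<open>The affine Lie superalgebra\<close>

text \<open>
  A triple \<open>(X, c, u)\<close> stands for the sum of the elements \<open>lookup X k\<close> tensored with t^k, plus c C + u d.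
\<close>

type_synonym 'n ghat = "(int \<Rightarrow>\<^sub>0 'n gl) \<times> complex \<times> complex"

definition loop :: "'n::finite gl \<Rightarrow> int \<Rightarrow> 'n ghat" where
  "loop A k = (Poly_Mapping.single k A, 0, 0)"

definition d_elem :: "'n::finite ghat" where
  "d_elem = (0, 0, 1)"

definition ghat_scale :: "complex \<Rightarrow> 'n::finite ghat \<Rightarrow> 'n ghat" where
  "ghat_scale a = (\<lambda>(X, c, u). (Poly_Mapping.map (mat_scale a) X, a * c, a * u))"

definition ghat_bracket :: "'n::finite ghat \<Rightarrow> 'n ghat \<Rightarrow> 'n ghat" where
  "ghat_bracket = (\<lambda>(X, c, u) (Y, c', u').
     ((\<Sum>k\<in>Poly_Mapping.keys X. \<Sum>l\<in>Poly_Mapping.keys Y.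
         Poly_Mapping.single (k + l) (gl_bracket (Poly_Mapping.lookup X k) (Poly_Mapping.lookup Y l)))
       + (\<Sum>l\<in>Poly_Mapping.keys Y.
         Poly_Mapping.single l (mat_scale (u * of_int l) (Poly_Mapping.lookup Y l)))
       - (\<Sum>k\<in>Poly_Mapping.keys X.
         Poly_Mapping.single k (mat_scale (u' * of_int k) (Poly_Mapping.lookup X k))),
      (\<Sum>k\<in>Poly_Mapping.keys X. \<Sum>l\<in>Poly_Mapping.keys Y.
         if k + l = 0
         then of_int k * Str (Poly_Mapping.lookup X k ** Poly_Mapping.lookup Y l) else 0),
      0))"

text \<open>Homogeneous elements of parity \<open>p\<close>; C and d are even.\<close>

definition ghat_part :: "bool \<Rightarrow> 'n::finite ghat set" where
  "ghat_part p = {(X, c, u). (\<forall>k. gl_part p (Poly_Mapping.lookup X k) = Poly_Mapping.lookup X k)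
     \<and> (p \<longrightarrow> c = 0 \<and> u = 0)}"

definition ghat_borel :: "'n::finite gl set \<Rightarrow> 'n ghat set" where
  "ghat_borel B = {(X, c, u). (\<forall>k<0. Poly_Mapping.lookup X k = 0) \<and> Poly_Mapping.lookup X 0 \<in> B}"


section \<open>Weights\<close>

text \<open>
  Elements of the dual of the affine Cartan subalgebra, and of its subspace h + complex d, by their
  values on the E_ii and e_jj, on C (first type only), and on d.
\<close>

type_synonym 'n wt = "(complex ^ ('n + 'n)) \<times> complex \<times> complex"
type_synonym 'n wt_hd = "(complex ^ ('n + 'n)) \<times> complex"

definition eps_wt :: "'n::finite \<Rightarrow> 'n wt" where
  "eps_wt i = (axis (Inl i) 1, 0, 0)"

definition del_wt :: "'n::finite \<Rightarrow> 'n wt" where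
  "del_wt j = (axis (Inr j) 1, 0, 0)"

definition Lambda0 :: "'n::finite wt" where
  "Lambda0 = (0, 1, 0)"

definition delta_imag :: "'n::finite wt" where
  "delta_imag = (0, 0, 1)"

definition restrict_hd :: "'n::finite wt \<Rightarrow> 'n wt_hd" where
  "restrict_hd = (\<lambda>(a, c, b). (a, b))"

text \<open>
  The value of a weight on the component of an element in the affine Cartan subalgebra (along all
  root spaces).  On a Borel subalgebra it is the one-dimensional character extending the weight.
\<close>

definition wt_eval :: "'n::finite wt \<Rightarrow> 'n ghat \<Rightarrow> complex" where
  "wt_eval = (\<lambda>(a, r, b) (X, c, u).
     (\<Sum>x\<in>UNIV. a $ x * Poly_Mapping.lookup X 0 $ x $ x) + r * c + b * u)"


section \<open>Modules and their characters\<close>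

locale ghat_module = vector_space scale
  for scale :: "complex \<Rightarrow> 'v::ab_group_add \<Rightarrow> 'v" +
  fixes V :: "bool \<Rightarrow> 'v set"
    and act :: "'n::{finite,linorder} ghat \<Rightarrow> 'v \<Rightarrow> 'v"
  assumes subspace_V: "subspace (V p)"
    and V_disjoint: "V False \<inter> V True = {0}"
    and V_decomp: "\<exists>v0\<in>V False. \<exists>v1\<in>V True. v = v0 + v1"
    and act_add_left: "act (x + y) v = act x v + act y v"
    and act_scale_left: "act (ghat_scale c x) v = scale c (act x v)"
    and act_add_right: "act x (v + w) = act x v + act x w"
    and act_scale_right: "act x (scale c v) = scale c (act x v)"
    and act_parity: "x \<in> ghat_part p \<Longrightarrow> v \<in> V r \<Longrightarrow> act x v \<in> V (p \<noteq> r)"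
    and act_bracket: "x \<in> ghat_part p \<Longrightarrow> y \<in> ghat_part r \<Longrightarrow>
      act (ghat_bracket x y) v
        = act x (act y v) - scale (if p \<and> r then - 1 else 1) (act y (act x v))"
begin

definition submodule :: "'v set \<Rightarrow> bool" where
  "submodule W \<longleftrightarrow> subspace W
     \<and> (\<forall>w\<in>W. \<exists>w0\<in>W \<inter> V False. \<exists>w1\<in>W \<inter> V True. w = w0 + w1)
     \<and> (\<forall>x. \<forall>w\<in>W. act x w \<in> W)"

definition irreducible_module :: bool where
  "irreducible_module \<longleftrightarrow> (\<exists>v::'v. v \<noteq> 0) \<and> (\<forall>W. submodule W \<longrightarrow> W = {0} \<or> W = UNIV)"

definition highest_weight_vector :: "'n gl set \<Rightarrow> 'n wt \<Rightarrow> 'v \<Rightarrow> bool" where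
  "highest_weight_vector B \<Lambda> v \<longleftrightarrow> v \<noteq> 0 \<and> (\<exists>p. v \<in> V p)
     \<and> (\<forall>x\<in>ghat_borel B. act x v = scale (wt_eval \<Lambda> x) v)"

definition highest_weight_module :: "'n gl set \<Rightarrow> 'n wt \<Rightarrow> bool" where
  "highest_weight_module B \<Lambda> \<longleftrightarrow> (\<exists>v. highest_weight_vector B \<Lambda> v
     \<and> (\<forall>W. submodule W \<and> v \<in> W \<longrightarrow> W = UNIV))"

text \<open>The module is (a copy of) the irreducible module L with the given highest weight.\<close>

definition is_L :: "'n gl set \<Rightarrow> 'n wt \<Rightarrow> bool" where
  "is_L B \<Lambda> \<longleftrightarrow> highest_weight_module B \<Lambda> \<and> irreducible_module"

definition weight_space :: "'n wt_hd \<Rightarrow> 'v set" where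
  "weight_space \<eta> = {v. (\<forall>x. act (loop (mat_unit x x) 0) v = scale (fst \<eta> $ x) v)
     \<and> act d_elem v = scale (snd \<eta>) v}"

text \<open>
  All weight spaces are finite-dimensional, and \<open>ch\<close> gives their dimensions.  (The library's \<open>dim\<close>
  alone would not do, being 0 on infinite-dimensional spaces.)
\<close>

definition has_character :: "('n wt_hd \<Rightarrow> nat) \<Rightarrow> bool" where
  "has_character ch \<longleftrightarrow> (\<forall>\<eta>. \<exists>b. finite b \<and> independent b
     \<and> span b = weight_space \<eta> \<and> card b = ch \<eta>)"

end


section \<open>Formal sums of exponentials\<close>

text \<open>
  A function \<open>f\<close> from an additive group of exponents to the naturals stands for the formal sum of all
  f(a) e^a.  The product and infinite sums are meaningful when, for each exponent, only finitely
  many nonzero terms contribute.  This is so for all uses below with the variables introduced at the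
  end of this theory, since each of these has strictly positive degree in q, and only finitely many
  of them have degree below any given bound.
\<close>

definition fexp :: "'e \<Rightarrow> 'e \<Rightarrow> nat" where
  "fexp a = (\<lambda>b. if b = a then 1 else 0)"

definition fmul :: "('e::ab_group_add \<Rightarrow> nat) \<Rightarrow> ('e \<Rightarrow> nat) \<Rightarrow> 'e \<Rightarrow> nat" where
  "fmul f g = (\<lambda>e. \<Sum>(a, b) | a + b = e \<and> f a \<noteq> 0 \<and> g b \<noteq> 0. f a * g b)"

definition fsum :: "('i \<Rightarrow> 'e \<Rightarrow> nat) \<Rightarrow> 'i set \<Rightarrow> 'e \<Rightarrow> nat" where
  "fsum f I = (\<lambda>e. \<Sum>i | i \<in> I \<and> f i e \<noteq> 0. f i e)"


section \<open>Hook Schur functions\<close>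

text \<open>Parts are indexed from 0; containment of partitions is the pointwise order of functions.\<close>

definition partition :: "(nat \<Rightarrow> nat) \<Rightarrow> bool" where
  "partition \<kappa> \<longleftrightarrow> antimono \<kappa> \<and> finite {i. \<kappa> i \<noteq> 0}"

definition conj_part :: "(nat \<Rightarrow> nat) \<Rightarrow> nat \<Rightarrow> nat" where
  "conj_part \<kappa> = (\<lambda>j. card {i. j < \<kappa> i})"

definition row_part :: "nat \<Rightarrow> nat \<Rightarrow> nat" where
  "row_part k = (\<lambda>i. if i = 0 then k else 0)"

definition skew_diagram :: "(nat \<Rightarrow> nat) \<Rightarrow> (nat \<Rightarrow> nat) \<Rightarrow> (nat \<times> nat) set" where
  "skew_diagram \<kappa> \<mu> = {(i, j). \<mu> i \<le> j \<and> j < \<kappa> i}"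

definition ssyt :: "(nat \<Rightarrow> nat) \<Rightarrow> (nat \<Rightarrow> nat) \<Rightarrow> (nat \<times> nat \<Rightarrow> nat) set" where
  "ssyt \<kappa> \<mu> = {T \<in> skew_diagram \<kappa> \<mu> \<rightarrow>\<^sub>E UNIV.
     (\<forall>i j j'. (i, j) \<in> skew_diagram \<kappa> \<mu> \<and> (i, j') \<in> skew_diagram \<kappa> \<mu> \<and> j < j' \<longrightarrow> T (i, j) \<le> T (i, j'))
     \<and> (\<forall>i i' j. (i, j) \<in> skew_diagram \<kappa> \<mu> \<and> (i', j) \<in> skew_diagram \<kappa> \<mu> \<and> i < i' \<longrightarrow> T (i, j) < T (i', j))}"

text \<open>
  The skew Schur function in the variables x_0, x_1, ..., where x_i = e^(w i): the sum over
  semistandard tableaux T of the monomials x^T (the product of x_T(c) over all cells c).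
\<close>

definition skew_schur ::
  "(nat \<Rightarrow> nat) \<Rightarrow> (nat \<Rightarrow> nat) \<Rightarrow> (nat \<Rightarrow> 'e::ab_group_add) \<Rightarrow> 'e \<Rightarrow> nat" where
  "skew_schur \<kappa> \<mu> w = (\<lambda>e. card {T \<in> ssyt \<kappa> \<mu>. (\<Sum>c\<in>skew_diagram \<kappa> \<mu>. w (T c)) = e})"

definition schur :: "(nat \<Rightarrow> nat) \<Rightarrow> (nat \<Rightarrow> 'e::ab_group_add) \<Rightarrow> 'e \<Rightarrow> nat" where
  "schur \<kappa> = skew_schur \<kappa> (\<lambda>_. 0)"

definition hook_schur ::
  "(nat \<Rightarrow> nat) \<Rightarrow> (nat \<Rightarrow> 'e::ab_group_add) \<Rightarrow> (nat \<Rightarrow> 'e) \<Rightarrow> 'e \<Rightarrow> nat" where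
  "hook_schur \<kappa> x y =
     fsum (\<lambda>\<mu>. fmul (schur \<mu> x) (skew_schur (conj_part \<kappa>) (conj_part \<mu>) y))
       {\<mu>. partition \<mu> \<and> \<mu> \<le> \<kappa>}"

definition HS :: "nat \<Rightarrow> (nat \<Rightarrow> 'e::ab_group_add) \<Rightarrow> (nat \<Rightarrow> 'e) \<Rightarrow> 'e \<Rightarrow> nat" where
  "HS k = hook_schur (row_part k)"


section \<open>The variables\<close>

text \<open>
  Monomials are written additively, as exponents in the dual of h + complex d.  The variables of each
  set are enumerated by the naturals via the bijection taking \<open>i\<close> to the pair of
  the (i mod n)-th element of \<open>'n\<close> and s = (i div n) + 1/2; Schur functions
  being symmetric, the choice of enumeration is immaterial.
\<close>

definition q_wt :: "'n::finite wt_hd" where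
  "q_wt = restrict_hd (- delta_imag)"

definition y_wt :: "'n::finite \<Rightarrow> 'n wt_hd" where
  "y_wt j = restrict_hd (eps_wt j)"

definition z_wt :: "'n::finite \<Rightarrow> 'n wt_hd" where
  "z_wt j = restrict_hd (del_wt j)"

definition q_pow :: "real \<Rightarrow> 'n::finite wt_hd" where
  "q_pow s = s *\<^sub>R q_wt"

definition var_index :: "nat \<Rightarrow> 'n::{finite,linorder}" where
  "var_index i = sorted_list_of_set UNIV ! (i mod CARD('n))"

definition with_q :: "('n::{finite,linorder} \<Rightarrow> 'n wt_hd) \<Rightarrow> nat \<Rightarrow> 'n wt_hd" where
  "with_q v = (\<lambda>i. v (var_index i) + q_pow (real (i div CARD('n)) + 1 / 2))"

definition yq :: "nat \<Rightarrow> 'n::{finite,linorder} wt_hd" where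
  "yq = with_q y_wt"

definition yinvq :: "nat \<Rightarrow> 'n::{finite,linorder} wt_hd" where
  "yinvq = with_q (\<lambda>j. - y_wt j)"

definition zq :: "nat \<Rightarrow> 'n::{finite,linorder} wt_hd" where
  "zq = with_q z_wt"

definition zinvq :: "nat \<Rightarrow> 'n::{finite,linorder} wt_hd" where
  "zinvq = with_q (\<lambda>j. - z_wt j)"

end

theory Submission
  imports Defs "HOL-Library.FSet" "HOL-Library.Multiset"
begin

text \<open>
  Both characters come from an explicit level-one module.  Let F be the Fock space of n free
  fermions (from the e_i) and n free bosons (from the f_j); the normally ordered quadratic
  expressions in the oscillators represent the affine superalgebra, and F splits by total charge.
  The states of charge l are counted by pairs of one-row hook Schur functions: particles give
  \<open>HS m zq yq\<close>, antiparticles give \<open>HS k zinvq yinvq\<close>.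

  The charge components are irreducible.  For one fermion, the Sugawara operator of its Heisenberg
  algebra multiplies each mode by its index, up to a shift (by the anticommutativity of the
  fermions), so commuting with it splits the action of an odd matrix unit into its single
  quadratic terms.  These terms separate the basis states and connect all states of equal charge.

  Finally, an irreducible highest weight module L is compared with a component by means of the
  pairs generated from the two highest weight vectors: since no lowering operator leads back to a
  highest weight vector and both modules are irreducible, these pairs form the graph of an
  isomorphism.
\<close>


text \<open>The delicate step is to isolate one quadratic term. A loop element only provides the sum
  over m of the terms taking mode m to mode m + k. All of these have the same weight under the
  Cartan subalgebra and d, so weights cannot separate them. The energy of a single fermion species
  can, because it sees the fermionic mode and ignores the boson. Bosonization expresses this energy
  through the currents of that species, so it preserves every invariant subspace, and a Vandermonde
  argument then extracts the terms.

  L is given abstractly, without a weight decomposition. Triangularity is therefore expressed by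
  polynomials in a principal grading operator that annihilate a vector.

  The half-integral exponents of q come from measuring integral modes from the midpoint between
  particles and antiparticles. This changes the degree by a multiple of the charge, which becomes
  the prefactor: its exponent is (1/2 - s) times the charge, where the shift s giving the highest
  weight vector degree 0 is 1 for l >= 0 and 0 for l < 0.\<close>

hide_const (open) comm_monoid_add_class.fsum

abbreviation "lookup \<equiv> Poly_Mapping.lookup"
abbreviation "single \<equiv> Poly_Mapping.single"
abbreviation "keys \<equiv> Poly_Mapping.keys"

section \<open>Actions of the matrix units\<close>

definition unit_sign :: "'n + 'n \<Rightarrow> 'n + 'n \<Rightarrow> 'n + 'n \<Rightarrow> 'n + 'n \<Rightarrow> complex" where
  "unit_sign x y z w = (if isl x \<noteq> isl y \<and> isl z \<noteq> isl w then - 1 else 1)"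

definition str_sign :: "'n + 'n \<Rightarrow> complex" where
  "str_sign x = (if isl x then 1 else - 1)"

definition raising :: "'n::{finite,linorder} + 'n \<Rightarrow> 'n + 'n \<Rightarrow> int \<Rightarrow> bool" where
  "raising x y k \<longleftrightarrow> k > 0 \<or> k = 0 \<and> ns_less x y"

definition lowering :: "'n::{finite,linorder} + 'n \<Rightarrow> 'n + 'n \<Rightarrow> int \<Rightarrow> bool" where
  "lowering x y k \<longleftrightarrow> k < 0 \<or> k = 0 \<and> ns_less y x"

definition position :: "'n::{finite,linorder} \<Rightarrow> nat" where
  "position i = card {j. j < i}"

text \<open>The ordered basis f_1 < e_1 < f_2 < ... is numbered 0, -1, -2, ..., so two heights
  differ by less than 2n. The coefficient 2n of \<open>k\<close> in \<open>height_deg\<close>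
  therefore lets a nonzero power of t decide the sign. This is the principal grading.\<close>

fun height :: "'n::{finite,linorder} + 'n \<Rightarrow> int" where
  "height (Inr j) = - 2 * int (position j)"
| "height (Inl i) = - 2 * int (position i) - 1"

definition height_deg :: "'n::{finite,linorder} + 'n \<Rightarrow> 'n + 'n \<Rightarrow> int \<Rightarrow> int" where
  "height_deg x y k = height x - height y + 2 * int CARD('n) * k"

lemma ns_less_cases: "x = y \<or> ns_less x y \<or> ns_less y x"
  for x y :: "'n::{finite,linorder} + 'n"
  by (cases x; cases y) auto

lemma triangular_cases: "raising x y k \<or> lowering x y k \<or> x = y \<and> k = 0"
  using ns_less_cases[of x y] unfolding raising_def lowering_def by auto

lemma position_mono: "position i \<le> position j" if "i \<le> j" for i j :: "'n::{finite,linorder}"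
  unfolding position_def using that by (intro card_mono) auto

lemma position_strict: "position i < position j" if "i < j" for i j :: "'n::{finite,linorder}"
  unfolding position_def using that by (intro psubset_card_mono) auto

lemma position_less: "position i < CARD('n)" for i :: "'n::{finite,linorder}"
  unfolding position_def by (intro psubset_card_mono) auto

lemma height_strict: "height y < height x" if "ns_less x y" for x y :: "'n::{finite,linorder} + 'n"
proof -
  have 1: "position i < position j" if "i < j" for i j :: 'n by (rule position_strict[OF that])
  have 2: "position i \<le> position j" if "i \<le> j" for i j :: 'n by (rule position_mono[OF that])
  show ?thesis
    using that by (cases x; cases y) (auto dest!: 1 2)
qed

lemma height_bounds: "height x \<le> 0" "height x > - 2 * int CARD('n)" for x :: "'n::{finite,linorder} + 'n"
  using position_less[of "projl x"] position_less[of "projr x"] by (cases x; auto)+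

lemma height_deg_lowering: "height_deg x y k < 0" if "lowering x y k"
  for x y :: "'n::{finite,linorder} + 'n"
proof (cases "k < 0")
  case True
  then have "2 * int CARD('n) * k \<le> 2 * int CARD('n) * (-1)"
    by (intro mult_left_mono) auto
  then show ?thesis
    using height_bounds[of x] height_bounds[of y] unfolding height_deg_def by linarith
next
  case False
  then have "k = 0" "ns_less y x" using that by (auto simp: lowering_def)
  then show ?thesis using height_strict[of y x] by (simp add: height_deg_def)
qed

text \<open>Level-one representations in terms of the operators of E_xy t^k and d: C has been
  replaced by 1, and \<open>T_comm\<close> is the super bracket solved for one product, so that
  inductions can move an operator to the right. Both L and the Fock space are instances.\<close>

locale unit_action = vector_space scale
  for scale :: "complex \<Rightarrow> 'v::ab_group_add \<Rightarrow> 'v" +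
  fixes T :: "'n::{finite,linorder} + 'n \<Rightarrow> 'n + 'n \<Rightarrow> int \<Rightarrow> 'v \<Rightarrow> 'v"
    and D :: "'v \<Rightarrow> 'v"
  assumes T_add: "T x y k (a + b) = T x y k a + T x y k b"
    and T_scale: "T x y k (scale c a) = scale c (T x y k a)"
    and D_add: "D (a + b) = D a + D b"
    and D_scale: "D (scale c a) = scale c (D a)"
    and T_comm: "T x y k (T z w l a) = scale (unit_sign x y z w) (T z w l (T x y k a))
       + (if y = z then T x w (k + l) a else 0)
       - (if x = w then scale (unit_sign x y z w) (T z y (k + l) a) else 0)
       + (if y = z \<and> x = w \<and> k + l = 0 then scale (of_int k * str_sign x) a else 0)"
    and D_T: "D (T x y k a) = T x y k (D a) + scale (of_int k) (T x y k a)"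
begin

lemma T_zero [simp]: "T x y k 0 = 0"
  using T_scale[of x y k 0 0] by simp

lemma D_zero [simp]: "D 0 = 0"
  using D_scale[of 0 0] by simp

lemma T_diff: "T x y k (a - b) = T x y k a - T x y k b"
  using T_add[of x y k a "scale (- 1) b"] T_scale[of x y k "- 1" b] by simp

lemma T_sum: "T x y k (sum f A) = (\<Sum>i\<in>A. T x y k (f i))"
  by (induction A rule: infinite_finite_induct) (auto simp: T_add)

lemma T_diag_comm: "T z z 0 (T x y k a) = T x y k (T z z 0 a)
    + (if z = x then T x y k a else 0) - (if z = y then T x y k a else 0)"
  using T_comm[of z z 0 x y k a] by (simp add: unit_sign_def)

text \<open>The principal grading operator: its commutator with each unit is an integer multiple of
  that unit, and the integer is negative for all lowering units at once.\<close>

definition H :: "'v \<Rightarrow> 'v" where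
  "H a = (\<Sum>z\<in>UNIV. scale (of_int (height z)) (T z z 0 a)) + scale (of_nat (2 * CARD('n))) (D a)"

lemma H_add: "H (a + b) = H a + H b"
  unfolding H_def by (simp add: T_add D_add scale_right_distrib sum.distrib algebra_simps)

lemma H_scale: "H (scale c a) = scale c (H a)"
  unfolding H_def by (simp add: T_scale D_scale scale_right_distrib scale_sum_right scale_scale ac_simps)

lemma H_T: "H (T x y k a) = T x y k (H a) + scale (of_int (height_deg x y k)) (T x y k a)"
proof -
  have "(\<Sum>z\<in>UNIV. scale (of_int (height z)) (T z z 0 (T x y k a)))
     = (\<Sum>z\<in>UNIV. scale (of_int (height z)) (T x y k (T z z 0 a))
         + (if z = x then scale (of_int (height x)) (T x y k a) else 0)
         - (if z = y then scale (of_int (height y)) (T x y k a) else 0))"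
    by (intro sum.cong refl) (auto simp: T_diag_comm scale_right_distrib scale_right_diff_distrib)
  also have "\<dots> = (\<Sum>z\<in>UNIV. scale (of_int (height z)) (T x y k (T z z 0 a)))
      + scale (of_int (height x)) (T x y k a) - scale (of_int (height y)) (T x y k a)"
    by (simp add: sum.distrib sum_subtractf)
  finally have 1: "(\<Sum>z\<in>UNIV. scale (of_int (height z)) (T z z 0 (T x y k a))) = \<dots>" .
  show ?thesis unfolding H_def 1
    by (simp add: T_add T_sum T_scale D_T scale_right_distrib height_deg_def
        scale_left_distrib scale_left_diff_distrib scale_scale)
qed

lemma H_diff: "H (a - b) = H a - H b"
  using H_add[of a "scale (- 1) b"] H_scale[of "- 1" b] by simp

primrec kill :: "complex \<Rightarrow> int list \<Rightarrow> 'v \<Rightarrow> 'v" where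
  "kill \<mu> [] a = a"
| "kill \<mu> (j # js) a = kill \<mu> js (H a - scale (\<mu> - of_int j) a)"

lemma kill_add: "kill \<mu> js (a + b) = kill \<mu> js a + kill \<mu> js b"
proof (induction js arbitrary: a b)
  case (Cons j js)
  have "H (a + b) - scale (\<mu> - of_int j) (a + b)
    = (H a - scale (\<mu> - of_int j) a) + (H b - scale (\<mu> - of_int j) b)"
    by (simp add: H_add scale_right_distrib)
  then show ?case using Cons by simp
qed simp

lemma kill_scale: "kill \<mu> js (scale c a) = scale c (kill \<mu> js a)"
proof (induction js arbitrary: a)
  case (Cons j js)
  have "H (scale c a) - scale (\<mu> - of_int j) (scale c a) = scale c (H a - scale (\<mu> - of_int j) a)"
    by (simp add: H_scale scale_right_diff_distrib scale_scale mult.commute)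
  then show ?case using Cons by simp
qed simp

lemma kill_diff: "kill \<mu> js (a - b) = kill \<mu> js a - kill \<mu> js b"
  using kill_add[of \<mu> js a "scale (- 1) b"] kill_scale[of \<mu> js "- 1" b] by simp

lemma kill_zero [simp]: "kill \<mu> js 0 = 0"
  using kill_scale[of \<mu> js 0 0] by simp

lemma kill_append: "kill \<mu> (is @ js) a = kill \<mu> js (kill \<mu> is a)"
  by (induction "is" arbitrary: a) auto

lemma kill_H: "kill \<mu> js (H a) = H (kill \<mu> js a)"
proof (induction js arbitrary: a)
  case (Cons j js)
  have "kill \<mu> (j # js) (H a) = kill \<mu> js (H (H a - scale (\<mu> - of_int j) a))"
    by (simp add: H_diff H_scale)
  then show ?case using Cons by simp
qed simp

lemma kill_commute: "kill \<mu> is (kill \<mu> js a) = kill \<mu> js (kill \<mu> is a)"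
proof (induction "is" arbitrary: a)
  case (Cons i "is")
  have "kill \<mu> js (H a - scale (\<mu> - of_int i) a) = H (kill \<mu> js a) - scale (\<mu> - of_int i) (kill \<mu> js a)"
    by (simp add: kill_diff kill_scale kill_H)
  then show ?case using Cons[of "H a - scale (\<mu> - of_int i) a"] by simp
qed simp

text \<open>A unit shifts \<open>H\<close> by \<open>height_deg x y k\<close>, so a factor passes
  through it once its index j is lowered by that amount. For a lowering unit the index grows and
  hence stays positive.\<close>

lemma kill_T: "kill \<mu> (map (\<lambda>j. j - height_deg x y k) js) (T x y k a) = T x y k (kill \<mu> js a)"
proof (induction js arbitrary: a)
  case (Cons j js)
  have "H (T x y k a) - scale (\<mu> - of_int (j - height_deg x y k)) (T x y k a)
      = T x y k (H a - scale (\<mu> - of_int j) a)"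
    by (simp add: H_T T_diff T_scale scale_left_distrib scale_left_diff_distrib)
  then show ?case using Cons by simp
qed simp

text \<open>The sums of \<open>H\<close>-eigenvectors whose eigenvalues lie below \<open>\<mu>\<close> by positive integers, described without decomposing them.\<close>

definition low :: "complex \<Rightarrow> 'v \<Rightarrow> bool" where
  "low \<mu> a \<longleftrightarrow> (\<exists>js. (\<forall>j\<in>set js. j > 0) \<and> kill \<mu> js a = 0)"

lemma low_zero: "low \<mu> 0"
  unfolding low_def by (rule exI[of _ "[]"]) simp

lemma low_add: "low \<mu> a \<Longrightarrow> low \<mu> b \<Longrightarrow> low \<mu> (a + b)"
proof -
  assume "low \<mu> a" "low \<mu> b"
  then obtain "is" js where "\<forall>j\<in>set is. j > 0" "kill \<mu> is a = 0" "\<forall>j\<in>set js. j > 0" "kill \<mu> js b = 0"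
    unfolding low_def by blast
  then have "kill \<mu> (is @ js) (a + b) = 0" "\<forall>j\<in>set (is @ js). j > 0"
    by (auto simp: kill_append kill_add kill_commute[of \<mu> js "is"])
  then show ?thesis unfolding low_def by blast
qed

lemma low_scale: "low \<mu> a \<Longrightarrow> low \<mu> (scale c a)"
  unfolding low_def by (auto simp: kill_scale)

lemma low_T: "low \<mu> a \<Longrightarrow> lowering x y k \<Longrightarrow> low \<mu> (T x y k a)"
proof -
  assume "low \<mu> a" "lowering x y k"
  then obtain js where js: "\<forall>j\<in>set js. j > 0" "kill \<mu> js a = 0"
    unfolding low_def by blast
  have "kill \<mu> (map (\<lambda>j. j - height_deg x y k) js) (T x y k a) = 0"
    unfolding kill_T js(2) by simp
  moreover have "\<forall>j\<in>set (map (\<lambda>j. j - height_deg x y k) js). j > 0"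
    using js(1) height_deg_lowering[OF \<open>lowering x y k\<close>] by (force)
  ultimately show ?thesis unfolding low_def by blast
qed

lemma low_T_eigen: "H a = scale \<mu> a \<Longrightarrow> lowering x y k \<Longrightarrow> low \<mu> (T x y k a)"
  unfolding low_def
  by (rule exI[of _ "[- height_deg x y k]"])
     (auto simp: H_T T_scale scale_left_distrib dest: height_deg_lowering)

text \<open>On an eigenvector of eigenvalue \<mu> the factor with index j acts as the scalar j, and
  a product of positive integers is nonzero.\<close>

lemma not_low: "H a = scale \<mu> a \<Longrightarrow> a \<noteq> 0 \<Longrightarrow> \<not> low \<mu> a"
proof
  assume a: "H a = scale \<mu> a" "a \<noteq> 0" and "low \<mu> a"
  then obtain js where js: "\<forall>j\<in>set js. j > 0" "kill \<mu> js a = 0"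
    unfolding low_def by blast
  have "kill \<mu> js a = scale (prod_list (map of_int js)) a"
    using a
  proof (induction js)
    case (Cons j js)
    have "kill \<mu> (j # js) a = kill \<mu> js (scale (of_int j) a)"
      using Cons.prems by (simp add: scale_left_diff_distrib)
    then show ?case using Cons by (simp add: kill_scale scale_scale)
  qed simp
  moreover have "prod_list (map of_int js) \<noteq> (0::complex)"
    using js(1) by (induction js) auto
  ultimately show False using js(2) a(2) by simp
qed

definition hw_vector :: "('n + 'n \<Rightarrow> complex) \<Rightarrow> 'v \<Rightarrow> bool" where
  "hw_vector \<Lambda> v \<longleftrightarrow> v \<noteq> 0 \<and> (\<forall>x y k. raising x y k \<longrightarrow> T x y k v = 0)
     \<and> (\<forall>x. T x x 0 v = scale (\<Lambda> x) v) \<and> D v = 0"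

lemma hw_vector_H: "hw_vector \<Lambda> v \<Longrightarrow> H v = scale (\<Sum>z\<in>UNIV. of_int (height z) * \<Lambda> z) v"
  unfolding hw_vector_def H_def by (simp add: scale_scale scale_sum_left)

end

text \<open>\<open>A\<close> is the abstract irreducible module, \<open>B\<close> the Fock space
  with a charge component \<open>F\<close>. The irreducibility hypotheses differ:
  \<open>irr1\<close> speaks only of graded subspaces that are also invariant under d, as the
  definition of a submodule requires, whereas \<open>irr2\<close> asks for neither.\<close>

locale two_actions = A: unit_action s1 T1 D1 + B: unit_action s2 T2 D2
  for s1 :: "complex \<Rightarrow> 'v::ab_group_add \<Rightarrow> 'v"
    and T1 :: "'n::{finite,linorder} + 'n \<Rightarrow> 'n + 'n \<Rightarrow> int \<Rightarrow> 'v \<Rightarrow> 'v" and D1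
    and s2 :: "complex \<Rightarrow> 'w::ab_group_add \<Rightarrow> 'w"
    and T2 :: "'n + 'n \<Rightarrow> 'n + 'n \<Rightarrow> int \<Rightarrow> 'w \<Rightarrow> 'w" and D2 +
  fixes V1 :: "bool \<Rightarrow> 'v set" and V2 :: "bool \<Rightarrow> 'w set" and F :: "'w set"
    and \<Lambda> :: "'n + 'n \<Rightarrow> complex" and v w p
  assumes sub1: "A.subspace (V1 r)" and sub2: "B.subspace (V2 r)"
    and disj2: "V2 False \<inter> V2 True = {0}"
    and par1: "a \<in> V1 r \<Longrightarrow> T1 x y k a \<in> V1 ((isl x \<noteq> isl y) \<noteq> r)"
    and par2: "b \<in> V2 r \<Longrightarrow> T2 x y k b \<in> V2 ((isl x \<noteq> isl y) \<noteq> r)"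
    and hw1: "A.hw_vector \<Lambda> v" and hw2: "B.hw_vector \<Lambda> w"
    and vp: "v \<in> V1 p" and wp: "w \<in> V2 p"
    and irr1: "A.subspace W \<Longrightarrow> (\<And>a. a \<in> W \<Longrightarrow> \<exists>a0\<in>W \<inter> V1 False. \<exists>a1\<in>W \<inter> V1 True. a = a0 + a1) \<Longrightarrow>
      (\<And>x y k a. a \<in> W \<Longrightarrow> T1 x y k a \<in> W) \<Longrightarrow> (\<And>a. a \<in> W \<Longrightarrow> D1 a \<in> W) \<Longrightarrow> W = {0} \<or> W = UNIV"
    and F_sub: "B.subspace F" and F_T: "b \<in> F \<Longrightarrow> T2 x y k b \<in> F" and wF: "w \<in> F"
    and irr2: "B.subspace W' \<Longrightarrow> W' \<subseteq> F \<Longrightarrow> (\<And>x y k b. b \<in> W' \<Longrightarrow> T2 x y k b \<in> W') \<Longrightarrow> W' = {0} \<or> W' = F"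
begin

text \<open>The graph of the isomorphism.  It suffices to close under lowering units: the triangular decomposition then gives closure under all units.\<close>

inductive nw :: "'v \<Rightarrow> 'w \<Rightarrow> bool" where
  nw_base: "nw v w"
| nw_lower: "nw a b \<Longrightarrow> lowering x y k \<Longrightarrow> nw (T1 x y k a) (T2 x y k b)"
| nw_add: "nw a b \<Longrightarrow> nw c d \<Longrightarrow> nw (a + c) (b + d)"
| nw_scale: "nw a b \<Longrightarrow> nw (s1 c a) (s2 c b)"

lemma nw_zero: "nw 0 0"
  using nw_scale[OF nw_base, of 0] by simp

lemma nw_diff: "nw a b \<Longrightarrow> nw c d \<Longrightarrow> nw (a - c) (b - d)"
  using nw_add[of a b "s1 (-1) c" "s2 (-1) d"] nw_scale[of c d "-1"] by simp

text \<open>Moving a unit past the outermost lowering unit leaves only terms in which some unit acts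
  on the earlier pair; hence the induction is over all \<open>x y k\<close> simultaneously.\<close>

lemma nw_T: "nw a b \<Longrightarrow> nw (T1 x y k a) (T2 x y k b)"
proof (induction arbitrary: x y k rule: nw.induct)
  case nw_base
  consider "raising x y k" | "lowering x y k" | "x = y" "k = 0" using triangular_cases by blast
  then show ?case
  proof cases
    case 1
    then show ?thesis using hw1 hw2 nw_zero by (simp add: A.hw_vector_def B.hw_vector_def)
  next
    case 2
    then show ?thesis by (intro nw_lower nw.nw_base)
  next
    case 3
    then show ?thesis using hw1 hw2 nw_scale[OF nw.nw_base]
      by (simp add: A.hw_vector_def B.hw_vector_def)
  qed
next
  case (nw_lower a b z u l)
  have *: "nw (if c then a' else 0) (if c then b' else 0)" if "nw a' b'" for a' b' c
    using that nw_zero by simp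
  show ?case unfolding A.T_comm[of x y k z u l a] B.T_comm[of x y k z u l b]
    by (intro nw_add nw_diff * nw_scale nw.nw_lower nw_lower)
next
  case (nw_add a b c d)
  then show ?case by (simp add: A.T_add B.T_add nw.nw_add)
next
  case (nw_scale a b c)
  then show ?case by (simp add: A.T_scale B.T_scale nw.nw_scale)
qed

lemma nw_D: "nw a b \<Longrightarrow> nw (D1 a) (D2 b)"
proof (induction rule: nw.induct)
  case nw_base
  then show ?case using hw1 hw2 nw_zero by (simp add: A.hw_vector_def B.hw_vector_def)
next
  case (nw_lower a b z u l)
  then show ?case unfolding A.D_T B.D_T by (intro nw_add nw_scale nw_T)
next
  case (nw_add a b c d)
  then show ?case by (simp add: A.D_add B.D_add nw.nw_add)
next
  case (nw_scale a b c)
  then show ?case by (simp add: A.D_scale B.D_scale nw.nw_scale)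
qed

lemma nw_F: "nw a b \<Longrightarrow> b \<in> F"
  by (induction rule: nw.induct) (auto simp: wF F_T F_sub B.subspace_add B.subspace_scale)

definition par_split :: "'v \<Rightarrow> 'w \<Rightarrow> bool" where
  "par_split a b \<longleftrightarrow> (\<exists>f g. a = f False + f True \<and> b = g False + g True
     \<and> (\<forall>r. nw (f r) (g r) \<and> f r \<in> V1 r \<and> g r \<in> V2 r))"

text \<open>Serves \<open>irr1\<close>, which admits only graded subspaces. The two coordinates
  split compatibly because v and w share the parity p and a unit changes parity equally on both
  sides.\<close>

lemma nw_parity: "nw a b \<Longrightarrow> par_split a b"
proof (induction rule: nw.induct)
  case nw_base
  have z: "0 \<in> V1 r" "0 \<in> V2 r" for r using sub1 sub2 by (auto simp: A.subspace_0 B.subspace_0)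
  show ?case unfolding par_split_def
    apply (rule exI[of _ "\<lambda>r. if r = p then v else 0"], rule exI[of _ "\<lambda>r. if r = p then w else 0"])
    using vp wp nw.nw_base nw_zero z by (cases p) auto
next
  case (nw_lower a b x y k)
  then obtain f g where h: "a = f False + f True" "b = g False + g True"
     "\<And>r. nw (f r) (g r)" "\<And>r. f r \<in> V1 r" "\<And>r. g r \<in> V2 r" unfolding par_split_def by blast
  define o' where "o' = (isl x \<noteq> isl y)"
  have "T1 x y k (f (o' \<noteq> r)) \<in> V1 r" "T2 x y k (g (o' \<noteq> r)) \<in> V2 r" for r
    using par1[OF h(4)[of "o' \<noteq> r"], of x y k] par2[OF h(5)[of "o' \<noteq> r"], of x y k]
    unfolding o'_def by (cases r; cases "isl x"; cases "isl y"; simp)+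
  moreover have "nw (T1 x y k (f (o' \<noteq> r))) (T2 x y k (g (o' \<noteq> r)))" for r
    by (rule nw.nw_lower[OF h(3) nw_lower(2)])
  moreover have "T1 x y k a = T1 x y k (f (o' \<noteq> False)) + T1 x y k (f (o' \<noteq> True))"
    "T2 x y k b = T2 x y k (g (o' \<noteq> False)) + T2 x y k (g (o' \<noteq> True))"
    unfolding h by (cases o'; simp add: A.T_add B.T_add add.commute)+
  ultimately show ?case unfolding par_split_def
    by (intro exI[of _ "\<lambda>r. T1 x y k (f (o' \<noteq> r))"] exI[of _ "\<lambda>r. T2 x y k (g (o' \<noteq> r))"]) blast
next
  case (nw_add a b c d)
  then obtain f g f' g' where h: "a = f False + f True" "b = g False + g True"
     "\<And>r. nw (f r) (g r)" "\<And>r. f r \<in> V1 r" "\<And>r. g r \<in> V2 r"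
     "c = f' False + f' True" "d = g' False + g' True"
     "\<And>r. nw (f' r) (g' r)" "\<And>r. f' r \<in> V1 r" "\<And>r. g' r \<in> V2 r"
    unfolding par_split_def by blast
  show ?case unfolding par_split_def
    apply (rule exI[of _ "\<lambda>r. f r + f' r"], rule exI[of _ "\<lambda>r. g r + g' r"])
    using h sub1 sub2 by (auto simp: A.subspace_add B.subspace_add intro: nw.nw_add)
next
  case (nw_scale a b c)
  then obtain f g where h: "a = f False + f True" "b = g False + g True"
     "\<And>r. nw (f r) (g r)" "\<And>r. f r \<in> V1 r" "\<And>r. g r \<in> V2 r" unfolding par_split_def by blast
  show ?case unfolding par_split_def
    apply (rule exI[of _ "\<lambda>r. s1 c (f r)"], rule exI[of _ "\<lambda>r. s2 c (g r)"])
    using h sub1 sub2 by (auto simp: A.subspace_scale B.subspace_scale A.scale_right_distrib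
        B.scale_right_distrib intro: nw.nw_scale)
qed

definition "hw_height = (\<Sum>z\<in>UNIV. of_int (height z) * \<Lambda> z)"

text \<open>The same c occurs in both coordinates: a lowering unit makes the whole pair low, and
  sums and multiples respect the form. This shared coefficient is what prevents v from being paired
  with 0.\<close>

lemma nw_triangular: "nw a b \<Longrightarrow> \<exists>c a' b'. a = s1 c v + a' \<and> b = s2 c w + b' \<and> A.low hw_height a' \<and> B.low hw_height b'"
proof (induction rule: nw.induct)
  case nw_base
  show ?case by (rule exI[of _ 1], rule exI[of _ 0], rule exI[of _ 0]) (simp add: A.low_zero B.low_zero)
next
  case (nw_lower a b x y k)
  then obtain c a' b' where h: "a = s1 c v + a'" "b = s2 c w + b'" "A.low hw_height a'" "B.low hw_height b'"
    by blast
  have "A.low hw_height (T1 x y k a)"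
    unfolding h A.T_add A.T_scale using A.hw_vector_H[OF hw1] nw_lower(2) h
    by (intro A.low_add A.low_scale A.low_T_eigen A.low_T) (auto simp: hw_height_def)
  moreover have "B.low hw_height (T2 x y k b)"
    unfolding h B.T_add B.T_scale using B.hw_vector_H[OF hw2] nw_lower(2) h
    by (intro B.low_add B.low_scale B.low_T_eigen B.low_T) (auto simp: hw_height_def)
  ultimately show ?case
    by (intro exI[of _ 0] exI[of _ "T1 x y k a"] exI[of _ "T2 x y k b"]) simp
next
  case (nw_add a b c d)
  then obtain r a' b' t c' d' where h: "a = s1 r v + a'" "b = s2 r w + b'" "A.low hw_height a'" "B.low hw_height b'"
     "c = s1 t v + c'" "d = s2 t w + d'" "A.low hw_height c'" "B.low hw_height d'"
    by blast
  show ?case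
    apply (rule exI[of _ "r + t"], rule exI[of _ "a' + c'"], rule exI[of _ "b' + d'"])
    using h by (auto simp: A.scale_left_distrib B.scale_left_distrib A.low_add B.low_add)
next
  case (nw_scale a b t)
  then obtain c a' b' where h: "a = s1 c v + a'" "b = s2 c w + b'" "A.low hw_height a'" "B.low hw_height b'"
    by blast
  show ?case
    apply (rule exI[of _ "t * c"], rule exI[of _ "s1 t a'"], rule exI[of _ "s2 t b'"])
    using h by (auto simp: A.scale_right_distrib B.scale_right_distrib A.low_scale B.low_scale)
qed

lemma not_nw_left: "\<not> nw v 0"
proof
  assume "nw v 0"
  then obtain c a' b' where h: "v = s1 c v + a'" "0 = s2 c w + b'" "A.low hw_height a'" "B.low hw_height b'"
    using nw_triangular by blast
  \<comment> \<open>Otherwise w would be a multiple of the low vector b', against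
    \<open>B.not_low\<close>.\<close>
  have "c = 0"
  proof (rule ccontr)
    assume "c \<noteq> 0"
    have "w = s2 (- inverse c) b'"
      using h(2) \<open>c \<noteq> 0\<close> by (metis B.scale_minus_left B.scale_one B.scale_scale add_eq_0_iff left_inverse
          minus_minus B.scale_minus_right)
    then have "B.low hw_height w" using B.low_scale h(4) by metis
    then show False using B.not_low B.hw_vector_H[OF hw2] hw2 by (auto simp: hw_height_def B.hw_vector_def)
  qed
  then have "A.low hw_height v" using h by simp
  then show False using A.not_low A.hw_vector_H[OF hw1] hw1 by (auto simp: hw_height_def A.hw_vector_def)
qed

lemma not_nw_right: "\<not> nw 0 w"
proof
  assume "nw 0 w"
  then have "nw (v - 0) (w - w)" by (intro nw_diff nw_base)
  then show False using not_nw_left by simp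
qed

text \<open>The vectors paired with 0 form a graded submodule that misses v, so irreducibility
  leaves only 0.\<close>

lemma nw_left_unique: "nw a 0 \<Longrightarrow> a = 0"
proof -
  have "{a. nw a 0} = {0} \<or> {a. nw a 0} = UNIV"
  proof (rule irr1)
    show "A.subspace {a. nw a 0}"
      by (rule A.subspaceI) (use nw_zero nw_add[of _ 0 _ 0] nw_scale[of _ 0] in auto)
    show "\<exists>a0\<in>{a. nw a 0} \<inter> V1 False. \<exists>a1\<in>{a. nw a 0} \<inter> V1 True. a = a0 + a1" if a: "a \<in> {a. nw a 0}" for a
    proof -
      obtain f g where h: "a = f False + f True" "0 = g False + g True"
        "\<And>r. nw (f r) (g r)" "\<And>r. f r \<in> V1 r" "\<And>r. g r \<in> V2 r"
        using nw_parity[of a 0] a unfolding par_split_def by auto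
      \<comment> \<open>The two components add up to 0, so each of them has both parities and
        vanishes. Hence the components of a are again paired with 0.\<close>
      have "g False = - g True" using h(2) by (simp add: eq_neg_iff_add_eq_0)
      then have "g False \<in> V2 True" using h(5)[of True] sub2 B.subspace_neg by metis
      then have "g False = 0" using disj2 h(5)[of False] by blast
      moreover from this have "g True = 0" using h(2) by simp
      ultimately have "nw (f r) 0" for r using h(3)[of r] by (cases r) auto
      then show ?thesis using h(1,4) by blast
    qed
    show "T1 x y k a \<in> {a. nw a 0}" if "a \<in> {a. nw a 0}" for x y k a
      using that nw_T[of a 0 x y k] by simp
    show "D1 a \<in> {a. nw a 0}" if "a \<in> {a. nw a 0}" for a
      using that nw_D[of a 0] by simp
  qed
  then show "nw a 0 \<Longrightarrow> a = 0" using not_nw_left by blast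
qed

lemma nw_right_unique: "nw 0 b \<Longrightarrow> b = 0"
proof -
  have "{b. nw 0 b} = {0} \<or> {b. nw 0 b} = F"
  proof (rule irr2)
    show "B.subspace {b. nw 0 b}"
      by (rule B.subspaceI) (use nw_zero nw_add[of 0 _ 0] nw_scale[of 0] in auto)
    show "{b. nw 0 b} \<subseteq> F" using nw_F by blast
    show "T2 x y k a \<in> {b. nw 0 b}" if "a \<in> {b. nw 0 b}" for x y k a
      using that nw_T[of 0 a x y k] by simp
  qed
  then show "nw 0 b \<Longrightarrow> b = 0" using not_nw_right wF by blast
qed

lemma nw_left_total: "\<exists>b. nw a b"
proof -
  have "{a. \<exists>b. nw a b} = {0} \<or> {a. \<exists>b. nw a b} = UNIV"
  proof (rule irr1)
    show "A.subspace {a. \<exists>b. nw a b}"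
      by (rule A.subspaceI) (use nw_zero nw_add nw_scale in blast)+
    show "\<exists>a0\<in>{a. \<exists>b. nw a b} \<inter> V1 False. \<exists>a1\<in>{a. \<exists>b. nw a b} \<inter> V1 True. a = a0 + a1"
      if "a \<in> {a. \<exists>b. nw a b}" for a
      using that nw_parity unfolding par_split_def by blast
  qed (use nw_T nw_D in blast)+
  moreover have "v \<noteq> 0" using hw1 by (simp add: A.hw_vector_def)
  ultimately show ?thesis using nw_base by blast
qed

lemma nw_right_total: "b \<in> F \<Longrightarrow> \<exists>a. nw a b"
proof -
  have "{b. \<exists>a. nw a b} = {0} \<or> {b. \<exists>a. nw a b} = F"
  proof (rule irr2)
    show "B.subspace {b. \<exists>a. nw a b}"
      by (rule B.subspaceI) (use nw_zero nw_add nw_scale in blast)+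
  qed (use nw_T nw_F in blast)+
  moreover have "w \<noteq> 0" using hw2 by (simp add: B.hw_vector_def)
  ultimately show "b \<in> F \<Longrightarrow> \<exists>a. nw a b" using nw_base by blast
qed

theorem isomorphism:
  obtains \<phi> :: "'v \<Rightarrow> 'w" where "Vector_Spaces.linear s1 s2 \<phi>" "inj \<phi>" "range \<phi> = F"
    "\<And>x y k a. \<phi> (T1 x y k a) = T2 x y k (\<phi> a)" "\<And>a. \<phi> (D1 a) = D2 (\<phi> a)"
proof -
  have u: "b = b'" if "nw a b" "nw a b'" for a b b'
    using nw_right_unique[of "b - b'"] nw_diff[OF that] by simp
  have u': "a = a'" if "nw a b" "nw a' b" for a a' b
    using nw_left_unique[of "a - a'"] nw_diff[OF that] by simp
  define \<phi> where "\<phi> a = (SOME b. nw a b)" for a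
  have \<phi>: "nw a (\<phi> a)" for a unfolding \<phi>_def by (rule someI_ex[OF nw_left_total])
  have e: "\<phi> a = b" if "nw a b" for a b using u[OF \<phi> that] .
  show ?thesis
  proof (rule that)
    show "Vector_Spaces.linear s1 s2 \<phi>"
      by unfold_locales (auto intro!: e nw_add nw_scale \<phi>)
    show "inj \<phi>" by (rule injI) (metis \<phi> u')
    show "range \<phi> = F" using nw_F[OF \<phi>] e nw_right_total by blast
  qed (auto intro!: e nw_T nw_D \<phi>)
qed

end


section \<open>The oscillator Fock space\<close>

text \<open>A state records the excitations above the vacuum: fermionic modes form a set by the
  exclusion principle, bosonic modes a multiset.\<close>

type_synonym 'n state = "('n \<times> int) fset \<times> ('n \<times> int) multiset"
type_synonym 'n fock = "'n state \<Rightarrow>\<^sub>0 complex"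

lift_definition fscale :: "complex \<Rightarrow> ('a \<Rightarrow>\<^sub>0 complex) \<Rightarrow> ('a \<Rightarrow>\<^sub>0 complex)" is "\<lambda>c f x. c * f x"
  by (erule rev_finite_subset) auto

lift_definition diag :: "('a \<Rightarrow> complex) \<Rightarrow> ('a \<Rightarrow>\<^sub>0 complex) \<Rightarrow> ('a \<Rightarrow>\<^sub>0 complex)" is "\<lambda>c f x. c x * f x"
  by (erule rev_finite_subset) auto

text \<open>Injectivity guarantees finite support of the result; otherwise the value is 0.\<close>

lift_definition pull :: "('a \<Rightarrow> complex) \<Rightarrow> ('a \<Rightarrow> 'a) \<Rightarrow> ('a \<Rightarrow>\<^sub>0 complex) \<Rightarrow> ('a \<Rightarrow>\<^sub>0 complex)"
  is "\<lambda>c g f x. if inj_on g {x. c x \<noteq> 0} then c x * f (g x) else 0"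
proof -
  fix c :: "'a \<Rightarrow> complex" and g :: "'a \<Rightarrow> 'a" and f :: "'a \<Rightarrow> complex"
  assume "finite {x. f x \<noteq> 0}"
  show "finite {x. (if inj_on g {x. c x \<noteq> 0} then c x * f (g x) else 0) \<noteq> 0}"
  proof (cases "inj_on g {x. c x \<noteq> 0}")
    case True
    have "finite (g -` {x. f x \<noteq> 0} \<inter> {x. c x \<noteq> 0})"
      by (rule finite_vimage_IntI[OF \<open>finite _\<close> True])
    then show ?thesis using True by (auto elim!: rev_finite_subset)
  qed auto
qed

lemma fscale_lookup [simp]: "lookup (fscale c f) x = c * lookup f x"
  by (simp add: fscale.rep_eq)

lemma diag_lookup [simp]: "lookup (diag c f) x = c x * lookup f x"
  by (simp add: diag.rep_eq)

interpretation fock: vector_space "fscale :: complex \<Rightarrow> ('a \<Rightarrow>\<^sub>0 complex) \<Rightarrow> _"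
  by unfold_locales (auto intro!: poly_mapping_eqI simp: lookup_add algebra_simps)

lemma pull_add: "pull c g (a + b) = pull c g a + pull c g b"
  by (rule poly_mapping_eqI) (auto simp: pull.rep_eq lookup_add algebra_simps)

lemma pull_scale: "pull c g (fscale r a) = fscale r (pull c g a)"
  by (rule poly_mapping_eqI) (auto simp: pull.rep_eq)

lemma diag_add: "diag c (a + b) = diag c a + diag c b"
  by (rule poly_mapping_eqI) (auto simp: lookup_add algebra_simps)

lemma diag_scale: "diag c (fscale r a) = fscale r (diag c a)"
  by (rule poly_mapping_eqI) auto

lemma diag_pull:
  assumes "\<And>x. k x \<noteq> 0 \<Longrightarrow> c x = c (g x) + r"
  shows "diag c (pull k g f) = pull k g (diag c f) + fscale r (pull k g f)"
proof (rule poly_mapping_eqI)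
  fix x
  show "lookup (diag c (pull k g f)) x = lookup (pull k g (diag c f) + fscale r (pull k g f)) x"
    using assms[of x] by (cases "k x = 0") (auto simp: pull.rep_eq lookup_add algebra_simps)
qed

lemma diag_pull_mult:
  assumes "\<And>x. k x \<noteq> 0 \<Longrightarrow> c x = r * c (g x)"
  shows "diag c (pull k g f) = fscale r (pull k g (diag c f))"
proof (rule poly_mapping_eqI)
  fix x
  show "lookup (diag c (pull k g f)) x = lookup (fscale r (pull k g (diag c f))) x"
    using assms[of x] by (cases "k x = 0") (auto simp: pull.rep_eq lookup_add algebra_simps)
qed

section \<open>Creation and annihilation operators and their relations\<close>

definition mode_less :: "'n::linorder \<times> int \<Rightarrow> 'n \<times> int \<Rightarrow> bool" where
  "mode_less a b \<longleftrightarrow> fst a < fst b \<or> fst a = fst b \<and> snd a < snd b"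

text \<open>The Jordan-Wigner sign, which makes the fermions anticommute.\<close>

definition fsign :: "'n::linorder \<times> int \<Rightarrow> ('n \<times> int) fset \<Rightarrow> complex" where
  "fsign a A = (- 1) ^ card {b \<in> fset A. mode_less b a}"

lemma fsign_nz [simp]: "fsign a A \<noteq> 0"
  by (simp add: fsign_def)

lemma fsign_sq [simp]: "fsign a A * fsign a A = 1" "fsign a A * (fsign a A * z) = z"
  by (simp_all add: fsign_def flip: power_add mult.assoc)

lemma mode_less_irrefl [simp]: "\<not> mode_less a a"
  by (auto simp: mode_less_def)

lemma mode_less_iff: "a \<noteq> b \<Longrightarrow> mode_less a b \<longleftrightarrow> \<not> mode_less b a"
  by (cases a; cases b) (auto simp: mode_less_def)

lemma fsign_insert: "a |\<notin>| A \<Longrightarrow> fsign b (finsert a A) = (if mode_less a b then - fsign b A else fsign b A)"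
proof -
  assume "a |\<notin>| A"
  then have "{c \<in> fset (finsert a A). mode_less c b} =
    (if mode_less a b then insert a {c \<in> fset A. mode_less c b} else {c \<in> fset A. mode_less c b})"
    by auto
  then show ?thesis using \<open>a |\<notin>| A\<close> by (simp add: fsign_def)
qed

lemma fsign_insert_same [simp]: "fsign a (finsert a A) = fsign a A"
  by (cases "a |\<in>| A") (auto simp: fsign_insert finsert_absorb)

lemma fsign_remove: "a |\<in>| A \<Longrightarrow> fsign b (A |-| {|a|}) = (if mode_less a b then - fsign b A else fsign b A)"
proof -
  assume "a |\<in>| A"
  then have "finsert a (A |-| {|a|}) = A" by auto
  with fsign_insert[of a "A |-| {|a|}" b]
  have "fsign b A = (if mode_less a b then - fsign b (A |-| {|a|}) else fsign b (A |-| {|a|}))"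
    by simp
  then show ?thesis by (cases "mode_less a b") (simp_all only: if_True if_False minus_minus)
qed

text \<open>The four oscillators are given by coefficients: the coefficient of the result at a state
  is read off at the one state it comes from. Creation thus looks up the state with the mode
  removed.\<close>

definition fcr :: "'n::linorder \<times> int \<Rightarrow> 'n fock \<Rightarrow> 'n fock" where
  "fcr a = pull (\<lambda>(A, B). if a |\<in>| A then fsign a A else 0) (\<lambda>(A, B). (A |-| {|a|}, B))"

definition fan :: "'n::linorder \<times> int \<Rightarrow> 'n fock \<Rightarrow> 'n fock" where
  "fan a = pull (\<lambda>(A, B). if a |\<in>| A then 0 else fsign a A) (\<lambda>(A, B). (finsert a A, B))"

definition bcr :: "'n::linorder \<times> int \<Rightarrow> 'n fock \<Rightarrow> 'n fock" where
  "bcr b = pull (\<lambda>(A, B). if b \<in># B then 1 else 0) (\<lambda>(A, B). (A, B - {#b#}))"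

text \<open>Bosonic states are unnormalised monomials: \<open>bcr\<close> multiplies by a variable
  and \<open>ban\<close> differentiates. The coefficient at B comes from the monomial with one more
  b, whose exponent is \<open>Suc (count B b)\<close>.\<close>

definition ban :: "'n::linorder \<times> int \<Rightarrow> 'n fock \<Rightarrow> 'n fock" where
  "ban b = pull (\<lambda>(A, B). of_nat (Suc (count B b))) (\<lambda>(A, B). (A, add_mset b B))"

lemma fcr_lookup: "lookup (fcr a f) (A, B) = (if a |\<in>| A then fsign a A * lookup f (A |-| {|a|}, B) else 0)"
proof -
  have "inj_on (\<lambda>(A, B). (A |-| {|a|}, B)) {x. (case x of (A, B :: ('a \<times> int) multiset) \<Rightarrow> if a |\<in>| A then fsign a A else 0) \<noteq> 0}"
    by (rule inj_on_inverseI[of _ "\<lambda>(A, B). (finsert a A, B)"]) (auto simp: finsert_absorb split: if_splits)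
  then show ?thesis by (simp add: fcr_def pull.rep_eq)
qed

lemma fan_lookup: "lookup (fan a f) (A, B) = (if a |\<in>| A then 0 else fsign a A * lookup f (finsert a A, B))"
proof -
  have "inj_on (\<lambda>(A, B). (finsert a A, B)) {x. (case x of (A, B :: ('a \<times> int) multiset) \<Rightarrow> if a |\<in>| A then 0 else fsign a A) \<noteq> 0}"
    by (rule inj_onI) (auto split: if_splits)
  then show ?thesis by (simp add: fan_def pull.rep_eq)
qed

lemma bcr_lookup: "lookup (bcr b f) (A, B) = (if b \<in># B then lookup f (A, B - {#b#}) else 0)"
proof -
  have "inj_on (\<lambda>(A :: ('a \<times> int) fset, B). (A, B - {#b#})) {x. (case x of (A, B) \<Rightarrow> if b \<in># B then 1 else 0) \<noteq> (0::complex)}"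
    by (rule inj_on_inverseI[of _ "\<lambda>(A, B). (A, add_mset b B)"]) (auto split: if_splits)
  then show ?thesis by (simp add: bcr_def pull.rep_eq)
qed

lemma ban_lookup: "lookup (ban b f) (A, B) = of_nat (Suc (count B b)) * lookup f (A, add_mset b B)"
proof -
  have "inj_on (\<lambda>(A :: ('a \<times> int) fset, B). (A, add_mset b B)) {x. (case x of (A, B) \<Rightarrow> of_nat (Suc (count B b))) \<noteq> (0::complex)}"
    by (rule inj_onI) auto
  then show ?thesis by (simp add: ban_def pull.rep_eq)
qed

lemmas osc_lookup = fcr_lookup fan_lookup bcr_lookup ban_lookup

lemma fock_eqI: "(\<And>A B. lookup f (A, B) = lookup g (A, B)) \<Longrightarrow> f = (g :: 'n fock)"
  by (rule poly_mapping_eqI) auto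

lemma fminus_commute: "A |-| {|a|} |-| {|b|} = A |-| {|b|} |-| {|a|}"
  by (auto simp: fset_eq_iff)

lemma finsert_fminus_neq: "a \<noteq> b \<Longrightarrow> finsert a A |-| {|b|} = finsert a (A |-| {|b|})"
  by (auto simp: fset_eq_iff)

lemma fcr_fcr: "fcr a (fcr b f) = - fcr b (fcr a f)"
proof (rule fock_eqI)
  fix A B
  show "lookup (fcr a (fcr b f)) (A, B) = lookup (- fcr b (fcr a f)) (A, B)"
    by (cases "a = b") (auto simp: osc_lookup fsign_remove mode_less_iff[of a b] fminus_commute[of A a b])
qed

lemma fan_fan: "fan a (fan b f) = - fan b (fan a f)"
proof (rule fock_eqI)
  fix A B
  show "lookup (fan a (fan b f)) (A, B) = lookup (- fan b (fan a f)) (A, B)"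
    by (cases "a = b") (auto simp: osc_lookup fsign_insert mode_less_iff[of a b] finsert_commute[of a b A])
qed

lemma fan_fcr: "fan a (fcr b f) = (if a = b then f else 0) - fcr b (fan a f)"
proof (rule fock_eqI)
  fix A B
  show "lookup (fan a (fcr b f)) (A, B) = lookup ((if a = b then f else 0) - fcr b (fan a f)) (A, B)"
    by (cases "a = b") (auto simp: osc_lookup fsign_insert fsign_remove lookup_minus mode_less_iff[of a b]
       finsert_fminus_neq finsert_absorb)
qed

lemma bcr_bcr: "bcr a (bcr b f) = bcr b (bcr a f)"
proof (rule fock_eqI)
  fix A B
  show "lookup (bcr a (bcr b f)) (A, B) = lookup (bcr b (bcr a f)) (A, B)"
    by (cases "a = b") (auto simp: osc_lookup in_diff_count add_mset_commute)
qed

lemma ban_ban: "ban a (ban b f) = ban b (ban a f)"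
proof (rule fock_eqI)
  fix A B
  show "lookup (ban a (ban b f)) (A, B) = lookup (ban b (ban a f)) (A, B)"
    by (cases "a = b") (auto simp: osc_lookup add_mset_commute[of a b])
qed

lemma ban_bcr: "ban a (bcr b f) = (if a = b then f else 0) + bcr b (ban a f)"
proof (rule fock_eqI)
  fix A B
  show "lookup (ban a (bcr b f)) (A, B) = lookup ((if a = b then f else 0) + bcr b (ban a f)) (A, B)"
  proof (cases "a = b")
    case True
    then show ?thesis
      by (auto simp: osc_lookup lookup_add algebra_simps not_in_iff count_greater_zero_iff[symmetric]
          simp del: count_greater_zero_iff)
  next
    case False
    have "b \<in># B \<Longrightarrow> add_mset a B - {#b#} = add_mset a (B - {#b#})" by simp
    with False show ?thesis by (auto simp: osc_lookup)
  qed
qed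

lemma ferm_bos: "fcr a (bcr b f) = bcr b (fcr a f)" "fcr a (ban b f) = ban b (fcr a f)"
  "fan a (bcr b f) = bcr b (fan a f)" "fan a (ban b f) = ban b (fan a f)"
  by (rule fock_eqI; simp add: osc_lookup)+

lemma osc_add: "fcr a (f + g) = fcr a f + fcr a g" "fan a (f + g) = fan a f + fan a g"
  "bcr a (f + g) = bcr a f + bcr a g" "ban a (f + g) = ban a f + ban a g"
  by (simp_all add: fcr_def fan_def bcr_def ban_def pull_add)

lemma osc_scale: "fcr a (fscale c f) = fscale c (fcr a f)" "fan a (fscale c f) = fscale c (fan a f)"
  "bcr a (fscale c f) = fscale c (bcr a f)" "ban a (fscale c f) = fscale c (ban a f)"
  by (simp_all add: fcr_def fan_def bcr_def ban_def pull_scale)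

text \<open>
  \<open>psi x m\<close> multiplies by the basis vector with index \<open>x\<close> tensored with t^m, and \<open>dual x m\<close> contracts with its dual.
  The vacuum is killed by the former for \<open>m \<ge> 0\<close> and by the latter for \<open>m < 0\<close>.  Hence a mode \<open>m < 0\<close> is
  occupied by particles, a mode \<open>m \<ge> 0\<close> by antiparticles.  Fermionic indices are the \<open>Inl i\<close>.
\<close>

definition psi :: "'n::linorder + 'n \<Rightarrow> int \<Rightarrow> 'n fock \<Rightarrow> 'n fock" where
  "psi x m f = (case x of Inl i \<Rightarrow> if m < 0 then fcr (i, m) f else fan (i, m) f
     | Inr j \<Rightarrow> if m < 0 then bcr (j, m) f else - ban (j, m) f)"

definition dual :: "'n::linorder + 'n \<Rightarrow> int \<Rightarrow> 'n fock \<Rightarrow> 'n fock" where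
  "dual x m f = (case x of Inl i \<Rightarrow> if m < 0 then fan (i, m) f else fcr (i, m) f
     | Inr j \<Rightarrow> if m < 0 then ban (j, m) f else bcr (j, m) f)"

text \<open>The statistics of the oscillators is opposite to the parity of the basis vectors: the
  even e_i give fermions, the odd f_j give bosons. On quadratic expressions both conventions yield
  the same parity.\<close>

definition koszul :: "'n + 'n \<Rightarrow> 'n + 'n \<Rightarrow> complex" where
  "koszul x y = (if isl x \<and> isl y then - 1 else 1)"

lemma osc_minus: "fcr a (- f) = - fcr a f" "fan a (- f) = - fan a f"
  "bcr a (- f) = - bcr a f" "ban a (- f) = - ban a f"
  using osc_scale[of a "- 1" f] by simp_all

lemma psi_add: "psi x m (f + g) = psi x m f + psi x m g" and dual_add: "dual x m (f + g) = dual x m f + dual x m g"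
  by (auto simp: psi_def dual_def osc_add split: sum.split)

lemma psi_scale: "psi x m (fscale c f) = fscale c (psi x m f)" and dual_scale: "dual x m (fscale c f) = fscale c (dual x m f)"
  by (auto simp: psi_def dual_def osc_scale split: sum.split)

lemma psi_minus: "psi x m (- f) = - psi x m f" and dual_minus: "dual x m (- f) = - dual x m f"
  using psi_scale[of x m "- 1" f] dual_scale[of x m "- 1" f] by simp_all

lemma psi_diff: "psi x m (f - g) = psi x m f - psi x m g" and dual_diff: "dual x m (f - g) = dual x m f - dual x m g"
  using psi_add[of x m f "- g"] dual_add[of x m f "- g"] by (simp_all add: psi_minus dual_minus)

lemma psi_zero [simp]: "psi x m 0 = 0" and dual_zero [simp]: "dual x m 0 = 0"
  using psi_scale[of x m 0 0] dual_scale[of x m 0 0] by simp_all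

lemma psi_sum: "psi x m (sum f I) = (\<Sum>i\<in>I. psi x m (f i))" and dual_sum: "dual x m (sum f I) = (\<Sum>i\<in>I. dual x m (f i))"
  by (induction I rule: infinite_finite_induct) (auto simp: psi_add dual_add)

lemma psi_psi: "psi x m (psi y k f) = fscale (koszul x y) (psi y k (psi x m f))"
  by (cases x; cases y; cases "m < 0"; cases "k < 0")
    (auto simp: psi_def koszul_def fan_fcr ban_bcr ferm_bos osc_minus intro: fcr_fcr fan_fan bcr_bcr ban_ban)

lemma dual_dual: "dual x m (dual y k f) = fscale (koszul x y) (dual y k (dual x m f))"
  by (cases x; cases y; cases "m < 0"; cases "k < 0")
    (auto simp: dual_def koszul_def fan_fcr ban_bcr ferm_bos osc_minus intro: fcr_fcr fan_fan bcr_bcr ban_ban)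

text \<open>The minus sign of \<open>psi\<close> on bosonic modes m >= 0 makes the contraction +1
  for every mode, on either side of the vacuum cut.\<close>

lemma dual_psi: "dual x m (psi y k f) = (if x = y \<and> m = k then f else 0) + fscale (koszul x y) (psi y k (dual x m f))"
  by (cases x; cases y; cases "m < 0"; cases "k < 0")
    (auto simp: psi_def dual_def koszul_def fan_fcr ban_bcr ferm_bos osc_minus intro: fcr_fcr fan_fan bcr_bcr ban_ban)

lemma koszul_sq [simp]: "koszul x y * koszul x y = 1" "koszul x y * (koszul x y * c) = c"
  by (auto simp: koszul_def)

lemma koszul_sym: "koszul x y = koszul y x"
  by (auto simp: koszul_def)

lemma psi_dual: "psi x m (dual y k f) = fscale (koszul x y) (dual y k (psi x m f) - (if x = y \<and> m = k then f else 0))"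
  unfolding dual_psi by (auto simp: fock.scale_right_distrib koszul_sym[of x y] )

section \<open>The vacuum, cyclicity and windows\<close>

definition vac :: "'n fock" where
  "vac = single ({||}, {#}) 1"

lemma fock_single_induct:
  assumes "\<And>f g. C f \<Longrightarrow> C g \<Longrightarrow> C (f + g)" "\<And>c f. C f \<Longrightarrow> C (fscale c f)" "\<And>S. C (single S 1)"
  shows "C (f :: 'a \<Rightarrow>\<^sub>0 complex)"
proof (induction f rule: Poly_Mapping.update_induct)
  case const
  show ?case using assms(2)[OF assms(3), of 0] by simp
next
  case (update f a b)
  have "Poly_Mapping.update a b f = f + fscale b (single a 1)"
    using update(1) by (intro poly_mapping_eqI)
      (auto simp: lookup_update lookup_add lookup_single when_def in_keys_iff)
  then show ?case using assms update by metis
qed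

lemma fcr_single: "a |\<notin>| A \<Longrightarrow> fcr a (single (A, B) 1) = fscale (fsign a A) (single (finsert a A, B) 1)"
  by (rule fock_eqI) (auto simp: osc_lookup lookup_single when_def fsign_remove finsert_absorb)

lemma fan_single: "a |\<in>| A \<Longrightarrow> fan a (single (A, B) 1) = fscale (fsign a A) (single (A |-| {|a|}, B) 1)"
  by (rule fock_eqI) (auto simp: osc_lookup lookup_single when_def fsign_remove finsert_absorb)

lemma bcr_single: "bcr b (single (A, B) 1) = single (A, add_mset b B) 1"
  by (rule fock_eqI) (auto simp: osc_lookup lookup_single when_def)

lemma ban_single: "ban b (single (A, B) 1) = fscale (of_nat (count B b)) (single (A, B - {#b#}) 1)"
  by (rule fock_eqI) (auto simp: osc_lookup lookup_single when_def count_greater_zero_iff simp flip: not_in_iff)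

lemma fcr_single_in: "a |\<in>| A \<Longrightarrow> fcr a (single (A, B) 1) = 0"
  by (rule fock_eqI) (auto simp: osc_lookup lookup_single when_def)

lemma fan_single_notin: "a |\<notin>| A \<Longrightarrow> fan a (single (A, B) 1) = 0"
  by (rule fock_eqI) (auto simp: osc_lookup lookup_single when_def)

text \<open>Cyclicity of the vacuum: each creation operator is a \<open>psi\<close> or a
  \<open>dual\<close>, depending on the sign of its mode. Linear identities thus reduce to exchange
  relations and a check on \<open>vac\<close>.\<close>

lemma fock_induct [case_names add scale vac psi dual]:
  assumes "\<And>f g. C f \<Longrightarrow> C g \<Longrightarrow> C (f + g)" "\<And>c f. C f \<Longrightarrow> C (fscale c f)" "C vac"
    "\<And>x m f. C f \<Longrightarrow> C (psi x m f)" "\<And>x m f. C f \<Longrightarrow> C (dual x m f)"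
  shows "C (f :: 'n::linorder fock)"
proof (rule fock_single_induct[of C])
  have b: "C (bcr (j, m) f)" if "C f" for j m f
    using that assms(4)[of f "Inr j" m] assms(5)[of f "Inr j" m] by (cases "m < 0") (auto simp: psi_def dual_def)
  have c: "C (fcr (i, m) f)" if "C f" for i m f
    using that assms(4)[of f "Inl i" m] assms(5)[of f "Inl i" m] by (cases "m < 0") (auto simp: psi_def dual_def)
  have "C (single (A, B) 1)" for A B
  proof (induction A)
    case empty
    show ?case
    proof (induction B)
      case empty
      then show ?case using assms(3) by (simp add: vac_def)
    next
      case (add b B)
      then show ?case using b[of _ "fst b" "snd b"] bcr_single[of b "{||}" B] by (metis prod.collapse)
    qed
  next
    case (insert a A)
    then have "C (fscale (fsign a A) (fcr a (single (A, B) 1)))"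
      using c[of _ "fst a" "snd a"] assms(2) by auto
    then show ?case using insert(1) by (simp add: fcr_single)
  qed
  then show "C (single S 1)" for S by (cases S) auto
qed (use assms in auto)

text \<open>All modes outside the window are in their vacuum state, so that the infinite sums below become finite.\<close>

definition window :: "int \<Rightarrow> 'n::linorder fock \<Rightarrow> bool" where
  "window N f \<longleftrightarrow> N \<ge> 0 \<and> (\<forall>x m. m \<ge> N \<longrightarrow> psi x m f = 0) \<and> (\<forall>x m. m < - N \<longrightarrow> dual x m f = 0)"

lemma window_mono: "window N f \<Longrightarrow> N \<le> N' \<Longrightarrow> window N' f"
  unfolding window_def by auto

lemma window_vac: "window 0 vac"
proof -
  have "fan a vac = 0" "ban a vac = 0" for a :: "'a \<times> int"
    by (simp_all add: vac_def fan_single_notin ban_single)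
  then show ?thesis by (auto simp: window_def psi_def dual_def split: sum.split)
qed

lemma window_add: "window N f \<Longrightarrow> window N g \<Longrightarrow> window N (f + g)"
  unfolding window_def by (auto simp: psi_add dual_add)

lemma window_scale: "window N f \<Longrightarrow> window N (fscale c f)"
  unfolding window_def by (auto simp: psi_scale dual_scale)

lemma window_psi: "window N f \<Longrightarrow> \<bar>m\<bar> < N \<Longrightarrow> window N (psi x m f)"
  unfolding window_def by (auto simp: psi_psi[of _ _ x m] dual_psi[of _ _ x m])

lemma window_dual: "window N f \<Longrightarrow> \<bar>m\<bar> < N \<Longrightarrow> window N (dual x m f)"
  unfolding window_def by (auto simp: psi_dual[of _ _ x m] dual_dual[of _ _ x m])

lemma window_exists: "\<exists>N. window N f"
proof (induction f rule: fock_induct)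
  case (add f g)
  then obtain N M where "window N f" "window M g" by blast
  then have "window (max N M) f" "window (max N M) g" by (auto elim: window_mono)
  then show ?case using window_add by blast
next
  case (psi x m f)
  then obtain N where "window N f" by blast
  then have "window (max N (\<bar>m\<bar> + 1)) f" by (auto elim: window_mono)
  then show ?case using window_psi[of "max N (\<bar>m\<bar> + 1)" f m x] by (intro exI[of _ "max N (\<bar>m\<bar> + 1)"]) auto
next
  case (dual x m f)
  then obtain N where "window N f" by blast
  then have "window (max N (\<bar>m\<bar> + 1)) f" by (auto elim: window_mono)
  then show ?case using window_dual[of "max N (\<bar>m\<bar> + 1)" f m x] by (intro exI[of _ "max N (\<bar>m\<bar> + 1)"]) auto
qed (use window_vac window_scale in blast)+

lemma common_window: obtains N where "window N f" "window N g"
proof -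
  obtain N M where "window N f" "window M g" using window_exists by metis
  then show ?thesis by (intro that[of "max N M"]) (auto elim: window_mono)
qed

text \<open>Normal ordering: for m >= 0 the vacuum is an eigenvector of \<open>psi x m\<close> after
  \<open>dual x m\<close>, with eigenvalue 1 for a fermion and -1 for a boson, which is
  \<open>str_sign x\<close>. Without the subtraction the sum over m would be infinite on the
  vacuum.\<close>

definition npair :: "'n::linorder + 'n \<Rightarrow> int \<Rightarrow> 'n + 'n \<Rightarrow> int \<Rightarrow> 'n fock \<Rightarrow> 'n fock" where
  "npair x m y k f = psi x m (dual y k f) - (if x = y \<and> m = k \<and> m \<ge> 0 then fscale (str_sign x) f else 0)"

lemma npair_add: "npair x m y k (f + g) = npair x m y k f + npair x m y k g"
  by (simp add: npair_def psi_add dual_add fock.scale_right_distrib)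

lemma npair_scale: "npair x m y k (fscale c f) = fscale c (npair x m y k f)"
  by (simp add: npair_def psi_scale dual_scale fock.scale_right_diff_distrib mult.commute)

text \<open>For m >= N, exchanging the two factors leaves exactly the constant that
  \<open>npair\<close> subtracts.\<close>

lemma npair_outside: "window N f \<Longrightarrow> k < - N \<or> m \<ge> N \<Longrightarrow> npair x m y k f = 0"
proof (cases "m \<ge> N")
  case True
  assume "window N f"
  with True have "psi x m f = 0" "m \<ge> 0" by (auto simp: window_def)
  then show ?thesis
    by (auto simp: npair_def psi_dual koszul_def str_sign_def)
next
  case False
  assume "window N f" "k < - N \<or> m \<ge> N"
  with False have "dual y k f = 0" "k < 0" by (auto simp: window_def)
  then show ?thesis by (auto simp: npair_def)
qed

text \<open>The action of the matrix unit of \<open>x\<close> and \<open>y\<close> tensored with t^k.\<close>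

definition bilin :: "'n::linorder + 'n \<Rightarrow> 'n + 'n \<Rightarrow> int \<Rightarrow> 'n fock \<Rightarrow> 'n fock" where
  "bilin x y k f = (\<Sum>m | npair x (m + k) y m f \<noteq> 0. npair x (m + k) y m f)"

lemma bilin_eq:
  assumes "finite M" "\<And>m. m \<notin> M \<Longrightarrow> npair x (m + k) y m f = 0"
  shows "bilin x y k f = (\<Sum>m\<in>M. npair x (m + k) y m f)"
  unfolding bilin_def using assms by (intro sum.mono_neutral_left) auto

lemma bilin_window:
  assumes "window N f" "a \<le> - N" "N - k \<le> b"
  shows "bilin x y k f = (\<Sum>m\<in>{a..<b}. npair x (m + k) y m f)"
  using assms by (intro bilin_eq) (auto intro!: npair_outside[of N])

lemma bilin_add: "bilin x y k (f + g) = bilin x y k f + bilin x y k g"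
proof -
  obtain N where w: "window N f" "window N g" by (rule common_window)
  note w = w window_add[OF w]
  note e = bilin_window[of N _ "- N" k "N - k" x y, OF _ order.refl order.refl]
  show ?thesis by (simp only: e[OF w(1)] e[OF w(2)] e[OF w(3)] npair_add sum.distrib)
qed

lemma bilin_scale: "bilin x y k (fscale c f) = fscale c (bilin x y k f)"
proof -
  obtain N where w: "window N f" using window_exists by metis
  note w = w window_scale[OF w]
  note e = bilin_window[of N _ "- N" k "N - k" x y, OF _ order.refl order.refl]
  show ?thesis by (simp only: e[OF w(1)] e[OF w(2)] npair_scale fock.scale_sum_right)
qed

lemma npair_psi: "npair x m y n (psi z l f) = fscale (koszul x z * koszul y z) (psi z l (npair x m y n f))
    + (if y = z \<and> n = l then psi x m f else 0)"
proof -
  have 1: "psi x m (dual y n (psi z l f)) = fscale (koszul x z * koszul y z) (psi z l (psi x m (dual y n f)))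
    + (if y = z \<and> n = l then psi x m f else 0)"
    by (simp add: dual_psi psi_add psi_scale psi_psi[of x m z l] mult.commute add.commute)
  show ?thesis
    by (auto simp: npair_def 1 psi_diff psi_scale fock.scale_right_diff_distrib)
qed

lemma npair_dual: "npair x m y n (dual z l f) = fscale (koszul x z * koszul y z) (dual z l (npair x m y n f)
    - (if x = z \<and> m = l then dual y n f else 0))"
proof -
  have 1: "psi x m (dual y n (dual z l f)) = fscale (koszul x z * koszul y z) (dual z l (psi x m (dual y n f))
    - (if x = z \<and> m = l then dual y n f else 0))"
    by (simp add: psi_dual[of x m z l] dual_dual[of y n z l] psi_scale mult.commute)
  show ?thesis
    by (auto simp: npair_def 1 dual_diff dual_scale fock.scale_right_diff_distrib)
qed

text \<open>Only the summand m = l contracts with \<open>psi z l\<close>. The outcome is the natural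
  action of a matrix unit on the vector z t^l; \<open>bilin_dual\<close> is the contragredient
  one.\<close>

lemma bilin_psi: "bilin x y k (psi z l f) = fscale (koszul x z * koszul y z) (psi z l (bilin x y k f))
    + (if y = z then psi x (l + k) f else 0)"
proof -
  obtain N where "window N f" using window_exists by metis
  define K where "K = max N (\<bar>l\<bar> + 1) + \<bar>k\<bar>"
  have wf: "window K f" unfolding K_def by (rule window_mono[OF \<open>window N f\<close>]) auto
  have wP: "window K (psi z l f)" unfolding K_def
    by (rule window_mono[OF window_psi[OF window_mono[OF \<open>window N f\<close>], of "max N (\<bar>l\<bar> + 1)"]]) auto
  define M where "M = {- K..<K + \<bar>k\<bar>}"
  have l: "l \<in> M" by (auto simp: M_def K_def)
  have e: "bilin x y k g = (\<Sum>m\<in>M. npair x (m + k) y m g)" if "window K g" for g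
    unfolding M_def by (rule bilin_window[OF that]) auto
  have "(\<Sum>m\<in>M. npair x (m + k) y m (psi z l f)) =
     (\<Sum>m\<in>M. fscale (koszul x z * koszul y z) (psi z l (npair x (m + k) y m f))
       + (if m = l then if y = z then psi x (l + k) f else 0 else 0))"
    by (intro sum.cong) (auto simp: npair_psi)
  also have "\<dots> = fscale (koszul x z * koszul y z) (psi z l (\<Sum>m\<in>M. npair x (m + k) y m f))
       + (if y = z then psi x (l + k) f else 0)"
    using l by (simp add: sum.distrib psi_sum fock.scale_sum_right M_def)
  finally show ?thesis by (simp only: e[OF wP] e[OF wf])
qed

lemma bilin_dual: "bilin x y k (dual z l f) = fscale (koszul x z * koszul y z) (dual z l (bilin x y k f)
    - (if x = z then dual y (l - k) f else 0))"
proof -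
  obtain N where "window N f" using window_exists by metis
  define K where "K = max N (\<bar>l\<bar> + 1) + \<bar>k\<bar>"
  have wf: "window K f" unfolding K_def by (rule window_mono[OF \<open>window N f\<close>]) auto
  have wQ: "window K (dual z l f)" unfolding K_def
    by (rule window_mono[OF window_dual[OF window_mono[OF \<open>window N f\<close>], of "max N (\<bar>l\<bar> + 1)"]]) auto
  define M where "M = {- K..<K + \<bar>k\<bar>}"
  have l: "l - k \<in> M" by (auto simp: M_def K_def)
  have e: "bilin x y k g = (\<Sum>m\<in>M. npair x (m + k) y m g)" if "window K g" for g
    unfolding M_def by (rule bilin_window[OF that]) auto
  have "(\<Sum>m\<in>M. npair x (m + k) y m (dual z l f)) =
     (\<Sum>m\<in>M. fscale (koszul x z * koszul y z) (dual z l (npair x (m + k) y m f)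
       - (if m = l - k then if x = z then dual y (l - k) f else 0 else 0)))"
    by (intro sum.cong) (auto simp: npair_dual)
  also have "\<dots> = fscale (koszul x z * koszul y z) (dual z l (\<Sum>m\<in>M. npair x (m + k) y m f)
       - (if x = z then dual y (l - k) f else 0))"
    using l by (simp add: sum_subtractf dual_sum M_def flip: fock.scale_sum_right)
  finally show ?thesis by (simp only: e[OF wQ] e[OF wf])
qed

lemma bilin_zero [simp]: "bilin x y k 0 = 0"
  using bilin_scale[of x y k 0 0] by simp

lemma bilin_minus: "bilin x y k (- f) = - bilin x y k f"
  using bilin_scale[of x y k "- 1" f] by simp

lemma bilin_diff: "bilin x y k (f - g) = bilin x y k f - bilin x y k g"
  using bilin_add[of x y k f "- g"] by (simp add: bilin_minus)

lemma bilin_sum: "bilin x y k (sum f I) = (\<Sum>i\<in>I. bilin x y k (f i))"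
  by (induction I rule: infinite_finite_induct) (auto simp: bilin_add)

text \<open>Without normal ordering each mode 0, ..., b - 1 adds its vacuum constant, so the
  truncated sum remembers its upper end b. This is the source of the central term.\<close>

lemma psi_dual_sum:
  assumes "window N f" "a \<le> - N" "N - k \<le> b" "b \<ge> 0"
  shows "(\<Sum>m\<in>{a..<b}. psi x (m + k) (dual y m f))
    = bilin x y k f + (if x = y \<and> k = 0 then fscale (of_int b * str_sign x) f else 0)"
proof -
  have "a \<le> 0" using assms by (auto simp: window_def)
  have "(\<Sum>m\<in>{a..<b}. psi x (m + k) (dual y m f)) = (\<Sum>m\<in>{a..<b}. npair x (m + k) y m f
     + (if m \<ge> 0 then (if x = y \<and> k = 0 then fscale (str_sign x) f else 0) else 0))"
    by (intro sum.cong) (auto simp: npair_def)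
  also have "\<dots> = bilin x y k f + (\<Sum>m\<in>{a..<b}. (if m \<ge> 0 then (if x = y \<and> k = 0 then fscale (str_sign x) f else 0) else 0))"
    using bilin_window[OF assms(1-3)] by (simp add: sum.distrib)
  also have "(\<Sum>m\<in>{a..<b}. (if m \<ge> 0 then (if x = y \<and> k = 0 then fscale (str_sign x) f else 0) else 0))
     = (\<Sum>m\<in>{0..<b}. (if x = y \<and> k = 0 then fscale (str_sign x) f else 0))"
    using \<open>a \<le> 0\<close> by (intro sum.mono_neutral_cong_right) auto
  also have "\<dots> = (if x = y \<and> k = 0 then fscale (of_int b * str_sign x) f else 0)"
    using assms(4) by (auto intro!: poly_mapping_eqI simp: lookup_sum)
  finally show ?thesis .
qed

lemma unit_sign_koszul: "koszul x z * koszul y z * (koszul x w * koszul y w) = unit_sign x y z w"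
  by (auto simp: koszul_def unit_sign_def)

lemma bilin_npair: "bilin x y k (npair z (m + l) w m f) = fscale (unit_sign x y z w) (npair z (m + l) w m (bilin x y k f))
   + (if y = z then psi x (m + (k + l)) (dual w m f) else 0)
   - (if x = w then fscale (unit_sign x y z w) (psi z (m + l) (dual y (m - k) f)) else 0)"
proof -
  have "bilin x y k (psi z (m + l) (dual w m f)) = fscale (unit_sign x y z w) (psi z (m + l) (dual w m (bilin x y k f)))
   + (if y = z then psi x (m + (k + l)) (dual w m f) else 0)
   - (if x = w then fscale (unit_sign x y z w) (psi z (m + l) (dual y (m - k) f)) else 0)"
    unfolding unit_sign_koszul[of x z y w, symmetric]
    by (simp add: bilin_psi bilin_dual psi_scale psi_diff fock.scale_right_diff_distrib ac_simps)
  then show ?thesis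
    by (auto simp: npair_def bilin_diff bilin_scale fock.scale_right_diff_distrib unit_sign_def)
qed

text \<open>Both bracket terms arise as truncated sums without normal ordering. Reindexing the
  second by k moves its upper end from K to K - k, so the vacuum constants differ by k: the cocycle
  at level one.\<close>

theorem bilin_comm: "bilin x y k (bilin z w l f) = fscale (unit_sign x y z w) (bilin z w l (bilin x y k f))
       + (if y = z then bilin x w (k + l) f else 0)
       - (if x = w then fscale (unit_sign x y z w) (bilin z y (k + l) f) else 0)
       + (if y = z \<and> x = w \<and> k + l = 0 then fscale (of_int k * str_sign x) f else 0)"
proof -
  obtain L where w: "window L f" "window L (bilin x y k f)" by (rule common_window)
  define K where "K = L + \<bar>k\<bar> + \<bar>l\<bar>"
  have K: "- K \<le> - L" "L - k \<le> K" "L - l \<le> K" "L - (k + l) \<le> K" "0 \<le> K" "0 \<le> K - k" "- K - k \<le> - L"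
     "L - (k + l) \<le> K - k"
    using w(1) unfolding K_def window_def by auto
  define s where "s = unit_sign x y z w"
  define M where "M = {- K..<K}"
  have e: "bilin z w l g = (\<Sum>m\<in>M. npair z (m + l) w m g)" if "window L g" for g
    unfolding M_def by (rule bilin_window[OF that]) (use K in auto)
  have "bilin x y k (bilin z w l f) = (\<Sum>m\<in>M. bilin x y k (npair z (m + l) w m f))"
    by (simp add: e[OF w(1)] bilin_sum)
  also have "\<dots> = fscale s (\<Sum>m\<in>M. npair z (m + l) w m (bilin x y k f))
       + (if y = z then \<Sum>m\<in>M. psi x (m + (k + l)) (dual w m f) else 0)
       - (if x = w then fscale s (\<Sum>m\<in>M. psi z (m + l) (dual y (m - k) f)) else 0)"
    unfolding bilin_npair s_def by (auto simp: sum.distrib sum_subtractf fock.scale_sum_right)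
  also have "(\<Sum>m\<in>M. npair z (m + l) w m (bilin x y k f)) = bilin z w l (bilin x y k f)"
    by (simp add: e[OF w(2)])
  also have "(\<Sum>m\<in>M. psi x (m + (k + l)) (dual w m f)) = bilin x w (k + l) f
     + (if x = w \<and> k + l = 0 then fscale (of_int K * str_sign x) f else 0)"
    unfolding M_def by (rule psi_dual_sum[OF w(1)]) (use K in auto)
  also have "(\<Sum>m\<in>M. psi z (m + l) (dual y (m - k) f)) = (\<Sum>m\<in>{- K - k..<K - k}. psi z (m + (k + l)) (dual y m f))"
    unfolding M_def
    by (rule sum.reindex_bij_witness[of _ "\<lambda>m. m + k" "\<lambda>m. m - k"]) (auto simp: algebra_simps)
  also have "\<dots> = bilin z y (k + l) f
     + (if z = y \<and> k + l = 0 then fscale (of_int (K - k) * str_sign z) f else 0)"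
    by (rule psi_dual_sum[OF w(1)]) (use K in auto)
  finally have *: "bilin x y k (bilin z w l f) = fscale s (bilin z w l (bilin x y k f))
     + (if y = z then bilin x w (k + l) f + (if x = w \<and> k + l = 0 then fscale (of_int K * str_sign x) f else 0) else 0)
     - (if x = w then fscale s (bilin z y (k + l) f
         + (if z = y \<and> k + l = 0 then fscale (of_int (K - k) * str_sign z) f else 0)) else 0)" .
  have "fscale s (fscale (of_int (K - k) * str_sign z) f)
      = fscale (of_int K * str_sign x) f - fscale (of_int k * str_sign x) f" if "y = z" "x = w"
  proof -
    \<comment> \<open>For an odd unit s is -1 and the signs of x and z differ; for an even unit s is
      1 and they agree.\<close>
    have "s * (of_int (K - k) * str_sign z) = of_int (K - k) * str_sign x"
      using that unfolding s_def unit_sign_def str_sign_def by auto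
    also have "\<dots> = of_int K * str_sign x - of_int k * str_sign x"
      by (simp add: left_diff_distrib)
    finally show ?thesis by (simp only: fock.scale_scale fock.scale_left_diff_distrib)
  qed
  then show ?thesis unfolding * s_def[symmetric]
    by (cases "y = z"; cases "x = w"; cases "k + l = 0")
      (simp_all only: fock.scale_right_distrib simp_thms if_True if_False add_0_right diff_0_right, simp_all)
qed

section \<open>Charge, weight and degree as diagonal operators\<close>

definition osign :: "int \<Rightarrow> complex" where
  "osign m = (if m < 0 then 1 else - 1)"

text \<open>Antiparticles count negatively. Since \<open>psi x m\<close> either adds a particle or
  removes an antiparticle, it always raises this sum by \<open>c x m\<close>, and
  \<open>dual x m\<close> lowers it by as much.\<close>

definition wsum :: "('n::linorder + 'n \<Rightarrow> int \<Rightarrow> complex) \<Rightarrow> 'n state \<Rightarrow> complex" where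
  "wsum c = (\<lambda>(A, B). (\<Sum>a\<in>fset A. osign (snd a) * c (Inl (fst a)) (snd a))
      + (\<Sum>b\<in>#B. osign (snd b) * c (Inr (fst b)) (snd b)))"

lemma wsum_finsert: "a |\<notin>| A \<Longrightarrow> wsum c (finsert a A, B) = osign (snd a) * c (Inl (fst a)) (snd a) + wsum c (A, B)"
  by (simp add: wsum_def)

lemma wsum_fremove: "a |\<in>| A \<Longrightarrow> wsum c (A, B) = osign (snd a) * c (Inl (fst a)) (snd a) + wsum c (A |-| {|a|}, B)"
  using wsum_finsert[of a "A |-| {|a|}" c B] by (simp add: finsert_absorb)

lemma wsum_add_mset: "wsum c (A, add_mset b B) = osign (snd b) * c (Inr (fst b)) (snd b) + wsum c (A, B)"
  by (simp add: wsum_def)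

lemma wsum_remove: "b \<in># B \<Longrightarrow> wsum c (A, B) = osign (snd b) * c (Inr (fst b)) (snd b) + wsum c (A, B - {#b#})"
  using wsum_add_mset[of c A b "B - {#b#}"] by simp

lemma diag_fcr: "diag (wsum c) (fcr a f) = fcr a (diag (wsum c) f) + fscale (osign (snd a) * c (Inl (fst a)) (snd a)) (fcr a f)"
  unfolding fcr_def by (rule diag_pull) (auto simp: wsum_fremove split: if_splits)

lemma diag_fan: "diag (wsum c) (fan a f) = fan a (diag (wsum c) f) - fscale (osign (snd a) * c (Inl (fst a)) (snd a)) (fan a f)"
  unfolding fan_def by (subst diag_pull[where r = "- (osign (snd a) * c (Inl (fst a)) (snd a))"])
    (auto simp: wsum_finsert split: if_splits)

lemma diag_bcr: "diag (wsum c) (bcr b f) = bcr b (diag (wsum c) f) + fscale (osign (snd b) * c (Inr (fst b)) (snd b)) (bcr b f)"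
  unfolding bcr_def by (rule diag_pull) (auto simp: wsum_remove split: if_splits)

lemma diag_ban: "diag (wsum c) (ban b f) = ban b (diag (wsum c) f) - fscale (osign (snd b) * c (Inr (fst b)) (snd b)) (ban b f)"
  unfolding ban_def by (subst diag_pull[where r = "- (osign (snd b) * c (Inr (fst b)) (snd b))"])
    (auto simp: wsum_add_mset split: if_splits)

lemma diag_minus: "diag c (- f) = - diag c f"
  using diag_scale[of c "- 1" f] by simp

lemma diag_diff: "diag c (f - g) = diag c f - diag c g"
  using diag_add[of c f "- g"] by (simp add: diag_minus)

lemma diag_zero [simp]: "diag c 0 = 0"
  using diag_scale[of c 0 0] by simp

lemma diag_sum: "diag c (sum f I) = (\<Sum>i\<in>I. diag c (f i))"
  by (induction I rule: infinite_finite_induct) (auto simp: diag_add)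

lemma diag_psi: "diag (wsum c) (psi x m f) = psi x m (diag (wsum c) f) + fscale (c x m) (psi x m f)"
  by (cases x; cases "m < 0") (simp_all add: psi_def diag_fcr diag_fan diag_bcr diag_ban osign_def diag_minus)

lemma diag_dual: "diag (wsum c) (dual x m f) = dual x m (diag (wsum c) f) - fscale (c x m) (dual x m f)"
  by (cases x; cases "m < 0") (simp_all add: dual_def diag_fcr diag_fan diag_bcr diag_ban osign_def diag_minus)

lemma diag_npair: "diag (wsum c) (npair x m y n f) = npair x m y n (diag (wsum c) f) + fscale (c x m - c y n) (npair x m y n f)"
  by (auto simp: npair_def diag_psi diag_dual diag_diff diag_scale psi_diff psi_scale fock.scale_left_diff_distrib
      fock.scale_right_diff_distrib)

lemma diag_bilin:
  assumes "\<And>m. c x (m + k) - c y m = d"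
  shows "diag (wsum c) (bilin x y k f) = bilin x y k (diag (wsum c) f) + fscale d (bilin x y k f)"
proof -
  obtain L where w: "window L f" "window L (diag (wsum c) f)" by (rule common_window)
  have e: "bilin x y k g = (\<Sum>m\<in>{- L..<L - k}. npair x (m + k) y m g)" if "window L g" for g
    by (rule bilin_window[OF that]) auto
  show ?thesis unfolding e[OF w(1)] e[OF w(2)]
    by (simp add: diag_sum diag_npair assms sum.distrib fock.scale_sum_right)
qed

lemma wsum_vac: "diag (wsum c) vac = 0"
  by (rule poly_mapping_eqI) (auto simp: vac_def lookup_single when_def wsum_def)

lemma bilin_vac: "k \<ge> 0 \<Longrightarrow> bilin x y k vac = 0"
  using bilin_window[OF window_vac, of 0 k 0 x y] by simp

text \<open>Both operators kill the vacuum and have the same commutators with all oscillators, which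
  determines them.\<close>

lemma bilin_diag: "bilin x x 0 f = diag (wsum (\<lambda>z m. if z = x then 1 else 0)) f"
proof (induction f rule: fock_induct)
  case (psi z m f)
  then show ?case by (auto simp: bilin_psi diag_psi)
next
  case (dual z m f)
  then show ?case by (auto simp: bilin_dual diag_dual)
qed (simp_all add: bilin_add diag_add bilin_scale diag_scale bilin_vac wsum_vac)

text \<open>The action of d.  The shift \<open>s\<close> changes it by a multiple of the charge and is used to give highest weight vectors degree 0.\<close>

definition energy :: "int \<Rightarrow> 'n::linorder fock \<Rightarrow> 'n fock" where
  "energy s = diag (wsum (\<lambda>x m. of_int (m + s)))"

interpretation fock: unit_action "fscale :: complex \<Rightarrow> 'n::{finite,linorder} fock \<Rightarrow> _" bilin "energy s" for s
proof
  fix x y :: "'n + 'n" and k and a :: "'n fock"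
  show "energy s (bilin x y k a) = bilin x y k (energy s a) + fscale (complex_of_int k) (bilin x y k a)"
    unfolding energy_def by (rule diag_bilin) simp
qed (rule bilin_add bilin_scale bilin_comm | simp add: energy_def diag_add diag_scale)+


section \<open>Irreducibility of the charge components\<close>

lemma fock_eq_minus_self: "f = - f \<Longrightarrow> f = (0 :: 'a \<Rightarrow>\<^sub>0 complex)"
proof (rule poly_mapping_eqI)
  fix x
  assume "f = - f"
  then have "lookup f x = - lookup f x" by (metis lookup_uminus)
  then show "lookup f x = lookup 0 x" by simp
qed

text \<open>The reflection of k to d - c - k exchanges the two modes, and the hypothesis makes the
  range invariant under it. Anticommutation then turns the sum into its own negative.\<close>

lemma antisymmetric_sum:
  assumes "a + b = d - c + 1"
  shows "(\<Sum>k\<in>{a..<b}. psi (Inl i) (c + k) (psi (Inl i) (d - k) f)) = 0"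
proof (rule fock_eq_minus_self)
  have "(\<Sum>k\<in>{a..<b}. psi (Inl i) (c + k) (psi (Inl i) (d - k) f))
     = (\<Sum>k\<in>{a..<b}. psi (Inl i) (d - k) (psi (Inl i) (c + k) f))"
    by (rule sum.reindex_bij_witness[of _ "\<lambda>k. d - c - k" "\<lambda>k. d - c - k"]) (use assms in auto)
  also have "\<dots> = (\<Sum>k\<in>{a..<b}. - psi (Inl i) (c + k) (psi (Inl i) (d - k) f))"
    by (intro sum.cong refl, subst psi_psi) (simp add: koszul_def)
  finally show "(\<Sum>k\<in>{a..<b}. psi (Inl i) (c + k) (psi (Inl i) (d - k) f)) =
     - (\<Sum>k\<in>{a..<b}. psi (Inl i) (c + k) (psi (Inl i) (d - k) f))"
    by (simp add: sum_negf)
qed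

section \<open>Bosonization: the Sugawara operator of one fermion species\<close>

definition heis :: "'n::linorder \<Rightarrow> int \<Rightarrow> 'n fock \<Rightarrow> 'n fock" where
  "heis i = bilin (Inl i) (Inl i)"

lemma heis_psi: "heis i k (psi z l f) = psi z l (heis i k f) + (if z = Inl i then psi z (l + k) f else 0)"
  by (auto simp: heis_def bilin_psi)

lemma heis_dual: "heis i k (dual z l f) = dual z l (heis i k f) - (if z = Inl i then dual z (l - k) f else 0)"
  by (auto simp: heis_def bilin_dual)

lemma heis_add: "heis i k (f + g) = heis i k f + heis i k g"
  and heis_scale: "heis i k (fscale c f) = fscale c (heis i k f)"
  and heis_diff: "heis i k (f - g) = heis i k f - heis i k g"
  and heis_minus: "heis i k (- f) = - heis i k f"
  and heis_zero [simp]: "heis i k 0 = 0"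
  and heis_sum: "heis i k (sum h I) = (\<Sum>j\<in>I. heis i k (h j))"
  by (simp_all add: heis_def bilin_add bilin_scale bilin_diff bilin_minus bilin_sum)

text \<open>The commutator of the Sugawara operator with \<open>psi (Inl i) r\<close>, less half of the latter; \<open>K\<close> cuts off the sums.\<close>

definition cubic :: "'n::linorder \<Rightarrow> int \<Rightarrow> int \<Rightarrow> 'n fock \<Rightarrow> 'n fock" where
  "cubic i r K f = (\<Sum>k\<in>{1..K}. heis i (- k) (psi (Inl i) (r + k) f)) + (\<Sum>k\<in>{0..K}. psi (Inl i) (r - k) (heis i k f))"

lemma cubic_add: "cubic i r K (f + g) = cubic i r K f + cubic i r K g"
  by (simp add: cubic_def heis_add psi_add sum.distrib)

lemma cubic_scale: "cubic i r K (fscale c f) = fscale c (cubic i r K f)"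
  by (simp add: cubic_def heis_scale psi_scale fock.scale_right_distrib fock.scale_sum_right)

lemma sum_split_sign: "K \<ge> 0 \<Longrightarrow> (\<Sum>k\<in>{1..K}. g k) + (\<Sum>k\<in>{0..K}. g (- k)) = (\<Sum>k\<in>{- K..<K + 1}. g k)"
  for g :: "int \<Rightarrow> 'a::comm_monoid_add"
proof -
  assume "K \<ge> 0"
  have "(\<Sum>k\<in>{0..K}. g (- k)) = (\<Sum>k\<in>{- K..0}. g k)"
    by (rule sum.reindex_bij_witness[of _ uminus uminus]) auto
  moreover have "{- K..<K + 1} = {1..K} \<union> {- K..0}" using \<open>K \<ge> 0\<close> by auto
  ultimately show ?thesis by (simp add: sum.union_disjoint)
qed

text \<open>The extra terms from the two halves of \<open>cubic\<close> join into one sum over k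
  from -K to K, which \<open>antisymmetric_sum\<close> removes once its ends are trimmed.\<close>

lemma cubic_psi: "K \<ge> 0 \<Longrightarrow> cubic i r K (psi z l f) = fscale (koszul (Inl i) z) (psi z l (cubic i r K f))
   + (if z = Inl i then \<Sum>k\<in>{- K..<K + 1}. psi z (r + k) (psi z (l - k) f) else 0)"
proof -
  assume K: "K \<ge> 0"
  have 1: "heis i (- k) (psi (Inl i) (r + k) (psi z l f)) = fscale (koszul (Inl i) z) (psi z l (heis i (- k) (psi (Inl i) (r + k) f)))
     + (if z = Inl i then psi z (r + k) (psi z (l - k) f) else 0)" for k
    using psi_psi[of "Inl i" "l - k" "Inl i" "r + k" f]
    by (simp add: psi_psi[of "Inl i" "r + k" z l] heis_scale heis_psi[of i _ z] fock.scale_right_distrib)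
  have 2: "psi (Inl i) (r - k) (heis i k (psi z l f)) = fscale (koszul (Inl i) z) (psi z l (psi (Inl i) (r - k) (heis i k f)))
     + (if z = Inl i then psi z (r - k) (psi z (l + k) f) else 0)" for k
    by (simp add: heis_psi psi_add psi_psi[of "Inl i" "r - k" z l])
  have "cubic i r K (psi z l f) = fscale (koszul (Inl i) z) (psi z l (cubic i r K f))
    + (if z = Inl i then (\<Sum>k\<in>{1..K}. psi z (r + k) (psi z (l - k) f)) + (\<Sum>k\<in>{0..K}. psi z (r - k) (psi z (l + k) f)) else 0)"
    unfolding cubic_def 1 2
    by (simp add: sum.distrib psi_add psi_sum fock.scale_right_distrib fock.scale_sum_right)
  also have "(\<Sum>k\<in>{1..K}. psi z (r + k) (psi z (l - k) f)) + (\<Sum>k\<in>{0..K}. psi z (r - k) (psi z (l + k) f))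
     = (\<Sum>k\<in>{- K..<K + 1}. psi z (r + k) (psi z (l - k) f))"
    using sum_split_sign[OF K, of "\<lambda>k. psi z (r + k) (psi z (l - k) f)"] by simp
  finally show ?thesis .
qed

text \<open>For r = l the contractions contribute K and the quadratic sum takes away l + K + 1 by
  \<open>psi_dual_sum\<close>; the difference -(r + 1) is free of K. The remaining
  \<open>heis i (r - l)\<close> cancels against the normally ordered part of the quadratic
  sum.\<close>

lemma cubic_dual:
  assumes "K \<ge> \<bar>r - l\<bar>" "window N f" "K \<ge> N + \<bar>r\<bar> + \<bar>l\<bar>"
  shows "cubic i r K (dual z l f) = fscale (koszul (Inl i) z) (dual z l (cubic i r K f))
   - (if z = Inl i \<and> r = l then fscale (of_int (r + 1)) f else 0)"
proof -
  have K: "K \<ge> 0" using assms(1) by linarith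
  have N: "N \<ge> 0" using assms(2) by (simp add: window_def)
  have 1: "heis i (- k) (psi (Inl i) (r + k) (dual z l f)) = fscale (koszul (Inl i) z) (dual z l (heis i (- k) (psi (Inl i) (r + k) f)))
     + (if z = Inl i then (if r = l then f else 0) - psi z (r + k) (dual z (l + k) f) + (if k = l - r then heis i (r - l) f else 0) else 0)" for k
  proof (cases "z = Inl i")
    case True
    have "psi z (r + k) (dual z l f) = (if r + k = l then f else 0) - dual z l (psi z (r + k) f)"
      using True by (simp add: psi_dual[of "Inl i" "r + k" "Inl i" l] koszul_def)
    then have "heis i (- k) (psi z (r + k) (dual z l f)) = heis i (- k) (if r + k = l then f else 0) - heis i (- k) (dual z l (psi z (r + k) f))"
      by (simp only: heis_diff)
    also have "heis i (- k) (dual z l (psi z (r + k) f)) = dual z l (heis i (- k) (psi z (r + k) f)) - dual z (l + k) (psi z (r + k) f)"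
      using True by (simp add: heis_dual)
    also have "dual z (l + k) (psi z (r + k) f) = (if r = l then f else 0) - psi z (r + k) (dual z (l + k) f)"
      using True by (simp add: dual_psi koszul_def)
    also have "heis i (- k) (if r + k = l then f else 0) = (if k = l - r then heis i (r - l) f else 0)"
      by auto
    finally show ?thesis using True by (simp add: koszul_def algebra_simps)
  next
    case False
    then show ?thesis by (simp add: psi_dual[of "Inl i" "r + k" z l] heis_scale heis_dual)
  qed
  have 2: "psi (Inl i) (r - k) (heis i k (dual z l f)) = fscale (koszul (Inl i) z) (dual z l (psi (Inl i) (r - k) (heis i k f)))
     + (if z = Inl i then (if k = r - l then heis i (r - l) f else 0) - psi z (r - k) (dual z (l - k) f) else 0)" for k
  proof (cases "z = Inl i")
    case True
    have "psi z (r - k) (dual z l (heis i k f)) = (if r - k = l then heis i k f else 0) - dual z l (psi z (r - k) (heis i k f))"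
      using True by (simp add: psi_dual[of "Inl i" "r - k" "Inl i" l] koszul_def)
    moreover have "(if r - k = l then heis i k f else 0) = (if k = r - l then heis i (r - l) f else 0)"
      by auto
    ultimately show ?thesis using True by (simp add: heis_dual psi_diff koszul_def)
  next
    case False
    then show ?thesis by (simp add: heis_dual psi_dual[of "Inl i" "r - k" z l])
  qed
  have "cubic i r K (dual z l f) = fscale (koszul (Inl i) z) (dual z l (cubic i r K f))
    + (if z = Inl i then (\<Sum>k\<in>{1..K}. (if r = l then f else 0) - psi z (r + k) (dual z (l + k) f) + (if k = l - r then heis i (r - l) f else 0))
       + (\<Sum>k\<in>{0..K}. (if k = r - l then heis i (r - l) f else 0) - psi z (r - k) (dual z (l - k) f)) else 0)"
    unfolding cubic_def 1 2
    by (simp add: sum.distrib dual_add dual_sum fock.scale_right_distrib fock.scale_sum_right)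
  also have "(\<Sum>k\<in>{1..K}. (if r = l then f else 0) - psi z (r + k) (dual z (l + k) f) + (if k = l - r then heis i (r - l) f else 0))
       + (\<Sum>k\<in>{0..K}. (if k = r - l then heis i (r - l) f else 0) - psi z (r - k) (dual z (l - k) f))
    = (\<Sum>k\<in>{1..K}. if r = l then f else 0)
      + ((\<Sum>k\<in>{1..K}. if k = l - r then heis i (r - l) f else 0) + (\<Sum>k\<in>{0..K}. if k = r - l then heis i (r - l) f else 0))
      - ((\<Sum>k\<in>{1..K}. psi z (r + k) (dual z (l + k) f)) + (\<Sum>k\<in>{0..K}. psi z (r - k) (dual z (l - k) f)))"
    by (simp only: sum.distrib sum_subtractf) (simp add: algebra_simps)
  \<comment> \<open>Exactly one of the two deltas is hit: the first if l > r, the second if l <= r.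
    The bound K >= |r - l| keeps it inside the range.\<close>
  also have "(\<Sum>k\<in>{1..K}. if k = l - r then heis i (r - l) f else 0) + (\<Sum>k\<in>{0..K}. if k = r - l then heis i (r - l) f else 0)
     = heis i (r - l) f"
    using assms(1) by (auto simp: sum.delta)
  also have "(\<Sum>k\<in>{1..K}. psi z (r + k) (dual z (l + k) f)) + (\<Sum>k\<in>{0..K}. psi z (r - k) (dual z (l - k) f))
     = (\<Sum>k\<in>{- K..<K + 1}. psi z (r + k) (dual z (l + k) f))"
    using sum_split_sign[OF K, of "\<lambda>k. psi z (r + k) (dual z (l + k) f)"] by simp
  also have "\<dots> = (\<Sum>m\<in>{l - K..<l + K + 1}. psi z (m + (r - l)) (dual z m f))"
    by (rule sum.reindex_bij_witness[of _ "\<lambda>m. m - l" "\<lambda>m. m + l"]) (auto simp: algebra_simps)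
  also have "\<dots> = bilin z z (r - l) f + (if z = z \<and> r - l = 0 then fscale (of_int (l + K + 1) * str_sign z) f else 0)"
    by (rule psi_dual_sum[OF assms(2)]) (use assms(1,3) N in linarith)+
  also have "(\<Sum>k\<in>{1..K}. if r = l then f else 0) = (if r = l then fscale (of_int K) f else 0)"
    using K by (auto intro!: poly_mapping_eqI simp: lookup_sum)
  finally show ?thesis
    by (auto simp: heis_def str_sign_def algebra_simps simp flip: fock.scale_left_distrib)
qed

lemma cubic_vac: "K \<ge> \<bar>r\<bar> \<Longrightarrow> cubic i r K vac = - fscale (of_int (r + 1)) (psi (Inl i) r vac)"
proof (cases "r \<ge> 0")
  case True
  have psi: "psi x m vac = 0" if "m \<ge> 0" for x :: "'a + 'a" and m using window_vac that by (auto simp: window_def)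
  show ?thesis using True by (simp add: cubic_def psi heis_def bilin_vac)
next
  case False
  assume K: "K \<ge> \<bar>r\<bar>"
  have psi: "psi x m vac = 0" if "m \<ge> 0" for x :: "'a + 'a" and m using window_vac that by (auto simp: window_def)
  have "cubic i r K vac = (\<Sum>k\<in>{1..K}. heis i (- k) (psi (Inl i) (r + k) vac))"
    by (simp add: cubic_def heis_def bilin_vac)
  \<comment> \<open>Modes r + k >= 0 annihilate the vacuum. The -r - 1 values of k that remain are
    the origin of the factor -(r + 1).\<close>
  also have "\<dots> = (\<Sum>k\<in>{1..<- r}. heis i (- k) (psi (Inl i) (r + k) vac))"
    using K psi False by (intro sum.mono_neutral_right) auto
  also have "\<dots> = (\<Sum>k\<in>{1..<- r}. psi (Inl i) r vac) + (\<Sum>k\<in>{1..<- r}. psi (Inl i) (r + k) (heis i (- k) vac))"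
    by (simp add: heis_psi sum.distrib add.commute)
  also have "(\<Sum>k\<in>{1..<- r}. psi (Inl i) (r + k) (heis i (- k) vac))
     = (\<Sum>k\<in>{1..<- r}. \<Sum>m\<in>{0..<- r}. if m < k then psi (Inl i) (r + k) (psi (Inl i) (m - k) (dual (Inl i) m vac)) else 0)"
  proof (rule sum.cong[OF refl])
    fix k assume k: "k \<in> {1..<- r}"
    have "heis i (- k) vac = (\<Sum>m\<in>{0..<k}. npair (Inl i) (m - k) (Inl i) m vac)"
      unfolding heis_def using bilin_window[OF window_vac, of 0 "- k" k] k by auto
    also have "\<dots> = (\<Sum>m\<in>{0..<k}. psi (Inl i) (m - k) (dual (Inl i) m vac))"
      using k by (intro sum.cong) (auto simp: npair_def)
    finally have "psi (Inl i) (r + k) (heis i (- k) vac) = (\<Sum>m\<in>{0..<k}. psi (Inl i) (r + k) (psi (Inl i) (m - k) (dual (Inl i) m vac)))"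
      by (simp add: psi_sum)
    also have "\<dots> = (\<Sum>m\<in>{0..<- r}. if m < k then psi (Inl i) (r + k) (psi (Inl i) (m - k) (dual (Inl i) m vac)) else 0)"
      using k by (intro sum.mono_neutral_cong_left) auto
    finally show "psi (Inl i) (r + k) (heis i (- k) vac) = \<dots>" .
  qed
  \<comment> \<open>With m outermost, the inner sum over k becomes antisymmetric in its two
    \<open>psi\<close> factors.\<close>
  also have "\<dots> = (\<Sum>m\<in>{0..<- r}. \<Sum>k\<in>{1..<- r}. if m < k then psi (Inl i) (r + k) (psi (Inl i) (m - k) (dual (Inl i) m vac)) else 0)"
    by (rule sum.swap)
  also have "\<dots> = (\<Sum>m\<in>{0..<- r}. \<Sum>k\<in>{m + 1..<- r}. psi (Inl i) (r + k) (psi (Inl i) (m - k) (dual (Inl i) m vac)))"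
    by (intro sum.cong[OF refl] sum.mono_neutral_cong_right) auto
  also have "\<dots> = 0"
    by (intro sum.neutral ballI antisymmetric_sum) auto
  also have "(\<Sum>k\<in>{1..<- r}. psi (Inl i) r vac) + 0 = - fscale (of_int (r + 1)) (psi (Inl i) r vac)"
    using False by (auto intro!: poly_mapping_eqI simp: lookup_sum lookup_add algebra_simps)
  finally show ?thesis .
qed

text \<open>The cubic expression collapses to a linear one: for large K both sides exchange alike
  with every oscillator, and they agree on the vacuum.\<close>

lemma cubic_eq: "\<exists>K0. \<forall>K\<ge>K0. cubic i r K f = - fscale (of_int (r + 1)) (psi (Inl i) r f)"
proof (induction f rule: fock_induct)
  case (add f g)
  then obtain K0 K1 where "\<forall>K\<ge>K0. cubic i r K f = - fscale (of_int (r + 1)) (psi (Inl i) r f)"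
    "\<forall>K\<ge>K1. cubic i r K g = - fscale (of_int (r + 1)) (psi (Inl i) r g)" by blast
  then show ?case
    by (intro exI[of _ "max K0 K1"]) (simp add: cubic_add psi_add fock.scale_right_distrib)
next
  case (scale c f)
  then obtain K0 where "\<forall>K\<ge>K0. cubic i r K f = - fscale (of_int (r + 1)) (psi (Inl i) r f)" by blast
  then show ?case
    by (intro exI[of _ K0]) (simp add: cubic_scale psi_scale mult.commute)
next
  case vac
  then show ?case using cubic_vac by blast
next
  case (psi z l f)
  then obtain K0 where K0: "\<forall>K\<ge>K0. cubic i r K f = - fscale (of_int (r + 1)) (psi (Inl i) r f)" by blast
  obtain N where N: "window N f" using window_exists by blast
  define K1 where "K1 = max K0 (max 0 (N + \<bar>r\<bar> + \<bar>l\<bar>))"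
  show ?case
  proof (intro exI[of _ K1] allI impI)
    fix K assume K: "K1 \<le> K"
    \<comment> \<open>The trimmed range is invariant under k to l - r - k; outside it one of the
      modes l - k and r + k is at least N and annihilates f.\<close>
    have "(\<Sum>k\<in>{- K..<K + 1}. psi (Inl i) (r + k) (psi (Inl i) (l - k) f))
      = (\<Sum>k\<in>{l - N + 1..<N - r}. psi (Inl i) (r + k) (psi (Inl i) (l - k) f))"
    proof (rule sum.mono_neutral_right)
      show "\<forall>k\<in>{- K..<K + 1} - {l - N + 1..<N - r}. psi (Inl i) (r + k) (psi (Inl i) (l - k) f) = 0"
      proof
        fix k assume "k \<in> {- K..<K + 1} - {l - N + 1..<N - r}"
        then consider "l - k \<ge> N" | "r + k \<ge> N" by force
        then show "psi (Inl i) (r + k) (psi (Inl i) (l - k) f) = 0"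
        proof cases
          case 1
          then show ?thesis using N by (simp add: window_def)
        next
          case 2
          then show ?thesis using N by (subst psi_psi) (simp add: window_def)
        qed
      qed
    qed (use K in \<open>auto simp: K1_def\<close>)
    also have "\<dots> = 0" by (rule antisymmetric_sum) auto
    finally have "cubic i r K (psi z l f) = fscale (koszul (Inl i) z) (psi z l (cubic i r K f))"
      using K by (auto simp: cubic_psi K1_def)
    then show "cubic i r K (psi z l f) = - fscale (of_int (r + 1)) (psi (Inl i) r (psi z l f))"
      using K0 K by (simp add: psi_psi[of "Inl i" r z l] K1_def psi_scale psi_minus mult.commute)
  qed
next
  case (dual z l f)
  then obtain K0 where K0: "\<forall>K\<ge>K0. cubic i r K f = - fscale (of_int (r + 1)) (psi (Inl i) r f)" by blast
  obtain N where N: "window N f" using window_exists by blast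
  show ?case
  proof (intro exI[of _ "max K0 (N + \<bar>r\<bar> + \<bar>l\<bar>)"] allI impI)
    fix K assume K: "max K0 (N + \<bar>r\<bar> + \<bar>l\<bar>) \<le> K"
    have "cubic i r K (dual z l f) = fscale (koszul (Inl i) z) (dual z l (cubic i r K f))
       - (if z = Inl i \<and> r = l then fscale (of_int (r + 1)) f else 0)"
      by (rule cubic_dual[OF _ N]) (use K N in \<open>auto simp: window_def\<close>)
    then show "cubic i r K (dual z l f) = - fscale (of_int (r + 1)) (psi (Inl i) r (dual z l f))"
      using K0 K fock.scale_minus_left[of "of_int (r + 1)" f]
      by (auto simp: psi_dual[of "Inl i" r z l] dual_scale dual_minus mult.commute fock.scale_right_diff_distrib koszul_def)
  qed
qed

definition sugawara :: "'n::linorder \<Rightarrow> int \<Rightarrow> 'n fock \<Rightarrow> 'n fock" where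
  "sugawara i K f = fscale (1 / 2) (heis i 0 (heis i 0 f)) + (\<Sum>k\<in>{1..K}. heis i (- k) (heis i k f))"

text \<open>Combined with \<open>cubic_eq\<close>, the commutator is -(r + 1) + 1/2 = -(r + 1/2)
  times \<open>psi (Inl i) r\<close>: the mode measured from the midpoint between -1 and 0.\<close>

lemma sugawara_psi:
  assumes "K \<ge> 0"
  shows "sugawara i K (psi (Inl i) r f) = psi (Inl i) r (sugawara i K f) + cubic i r K f + fscale (1 / 2) (psi (Inl i) r f)"
proof -
  have "{0..K} = insert 0 {1..K}" using assms by auto
  then have 0: "cubic i r K f = (\<Sum>k\<in>{1..K}. heis i (- k) (psi (Inl i) (r + k) f))
      + (psi (Inl i) r (heis i 0 f) + (\<Sum>k\<in>{1..K}. psi (Inl i) (r - k) (heis i k f)))"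
    by (simp add: cubic_def)
  have 1: "fscale (1 / 2) (psi (Inl i) r (heis i 0 f)) + fscale (1 / 2) (psi (Inl i) r (heis i 0 f)) = psi (Inl i) r (heis i 0 f)"
    by (simp flip: fock.scale_left_distrib)
  have "sugawara i K (psi (Inl i) r f) = psi (Inl i) r (sugawara i K f)
     + (fscale (1 / 2) (psi (Inl i) r (heis i 0 f)) + fscale (1 / 2) (psi (Inl i) r (heis i 0 f)))
     + fscale (1 / 2) (psi (Inl i) r f)
     + (\<Sum>k\<in>{1..K}. heis i (- k) (psi (Inl i) (r + k) f)) + (\<Sum>k\<in>{1..K}. psi (Inl i) (r - k) (heis i k f))"
    by (simp add: sugawara_def heis_psi heis_add psi_add psi_scale psi_sum sum.distrib fock.scale_right_distrib ac_simps)
  then show ?thesis unfolding 0 1 by (simp add: ac_simps)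
qed

lemma sugawara_add: "sugawara i K (f + g) = sugawara i K f + sugawara i K g"
  by (simp add: sugawara_def heis_add sum.distrib fock.scale_right_distrib)

lemma sugawara_scale: "sugawara i K (fscale c f) = fscale c (sugawara i K f)"
  by (simp add: sugawara_def heis_scale fock.scale_right_distrib fock.scale_sum_right mult.commute)

lemma sugawara_zero [simp]: "sugawara i K 0 = 0"
  by (simp add: sugawara_def)

lemma sugawara_sum: "sugawara i K (sum h I) = (\<Sum>j\<in>I. sugawara i K (h j))"
  by (induction I rule: infinite_finite_induct) (auto simp: sugawara_add)

lemma sugawara_dual: "z \<noteq> Inl i \<Longrightarrow> sugawara i K (dual z l f) = dual z l (sugawara i K f)"
  by (simp add: sugawara_def heis_dual dual_add dual_scale dual_sum)

lemma heis_large: "window N f \<Longrightarrow> k \<ge> 2 * N \<Longrightarrow> heis i k f = 0"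
  unfolding heis_def using bilin_window[of N f "- N" k "N - k" "Inl i" "Inl i"] by simp

lemma sugawara_stable:
  "window N f \<Longrightarrow> 2 * N \<le> K \<Longrightarrow> sugawara i K f = sugawara i (2 * N) f"
  unfolding sugawara_def
  by (auto intro!: sum.mono_neutral_right simp: heis_large)

text \<open>A Vandermonde argument without determinants: subtracting \<open>e a\<close> times the
  sum with exponent d from the one with exponent d + 1 removes the summand a and multiplies every
  other one by the nonzero \<open>e m - e a\<close>.\<close>

lemma (in vector_space) subspace_separate:
  assumes U: "subspace U" and "finite M" "inj_on e M" "\<And>d :: nat. (\<Sum>m\<in>M. scale (e m ^ d) (g m)) \<in> U" "m \<in> M"
  shows "g m \<in> U"
  using assms(2-5)
proof (induction M arbitrary: g m rule: finite_induct)
  case (insert a M)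
  have h: "scale (e b - e a) (g b) \<in> U" if "b \<in> M" for b
  proof (rule insert.IH[OF _ _ that])
    show "inj_on e M" using insert.prems by auto
    fix d :: nat
    have "(\<Sum>m\<in>insert a M. scale (e m ^ Suc d) (g m)) - scale (e a) (\<Sum>m\<in>insert a M. scale (e m ^ d) (g m)) \<in> U"
      by (intro subspace_diff subspace_scale U insert.prems)
    also have "(\<Sum>m\<in>insert a M. scale (e m ^ Suc d) (g m)) - scale (e a) (\<Sum>m\<in>insert a M. scale (e m ^ d) (g m))
      = (\<Sum>m\<in>M. scale (e m ^ d) (scale (e m - e a) (g m)))"
      using insert.hyps by (simp add: scale_sum_right sum_subtractf scale_left_diff_distrib right_diff_distrib
          scale_right_distrib scale_right_diff_distrib mult.commute)
    finally show "(\<Sum>m\<in>M. scale (e m ^ d) (scale (e m - e a) (g m))) \<in> U" .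
  qed
  have b: "g b \<in> U" if "b \<in> M" for b
  proof -
    have "e b \<noteq> e a" using inj_onD[OF insert.prems(1), of b a] that insert.hyps by blast
    then have "g b = scale (inverse (e b - e a)) (scale (e b - e a) (g b))" by simp
    then show ?thesis using h[OF that] U subspace_scale by metis
  qed
  have "(\<Sum>m\<in>insert a M. scale (e m ^ 0) (g m)) - (\<Sum>m\<in>M. g m) \<in> U"
    by (intro subspace_diff subspace_sum U insert.prems b)
  then have "g a \<in> U" using insert.hyps by simp
  with b insert.prems show ?case by blast
qed simp

section \<open>Extracting single quadratic terms inside an invariant subspace\<close>

locale bilin_stable =
  fixes U :: "'n::{finite,linorder} fock set"
  assumes sub: "fock.subspace U" and stable: "f \<in> U \<Longrightarrow> bilin x y k f \<in> U"
begin

lemma sugawara_in: "f \<in> U \<Longrightarrow> sugawara i K f \<in> U"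
  unfolding sugawara_def heis_def
  by (intro fock.subspace_add fock.subspace_scale fock.subspace_sum sub stable)

text \<open>Exponent 0 is the action of an odd unit. Applying \<open>sugawara\<close> to the d-th
  sum multiplies each term by its eigenvalue, up to the part where the operator reaches f. That part
  is the d-th sum of another vector of U, which is why f varies in the induction.\<close>

lemma power_sums_in: "f \<in> U \<Longrightarrow> \<exists>N0. \<forall>N\<ge>N0.
    (\<Sum>m\<in>{- N..<N}. fscale ((- of_int (m + k) - 1 / 2) ^ d) (psi (Inl i) (m + k) (dual (Inr j) m f))) \<in> U"
proof (induction d arbitrary: f)
  case 0
  obtain N where N: "window N f" using window_exists by blast
  show ?case
  proof (intro exI[of _ "N + \<bar>k\<bar>"] allI impI)
    fix M assume M: "N + \<bar>k\<bar> \<le> M"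
    have "bilin (Inl i) (Inr j) k f = (\<Sum>m\<in>{- M..<M}. npair (Inl i) (m + k) (Inr j) m f)"
      by (rule bilin_window[OF N]) (use M in auto)
    also have "\<dots> = (\<Sum>m\<in>{- M..<M}. fscale ((- of_int (m + k) - 1 / 2) ^ 0) (psi (Inl i) (m + k) (dual (Inr j) m f)))"
      by (simp add: npair_def)
    finally show "(\<Sum>m\<in>{- M..<M}. fscale ((- of_int (m + k) - 1 / 2) ^ 0) (psi (Inl i) (m + k) (dual (Inr j) m f))) \<in> U"
      using stable[OF 0] by metis
  qed
next
  case (Suc d)
  let ?g = "\<lambda>f m. psi (Inl i) (m + k) (dual (Inr j) m f)"
  let ?c = "\<lambda>m. - of_int (m + k) - 1 / 2 :: complex"
  obtain N where N: "window N f" using window_exists by blast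
  \<comment> \<open>By \<open>sugawara_stable\<close> every larger cut-off yields the same vector,
    so K can be chosen later.\<close>
  define f' where "f' = sugawara i (2 * N) f"
  have f': "f' \<in> U" unfolding f'_def by (rule sugawara_in[OF Suc.prems])
  obtain N1 N2 where N1: "\<forall>N\<ge>N1. (\<Sum>m\<in>{- N..<N}. fscale (?c m ^ d) (?g f m)) \<in> U"
    and N2: "\<forall>N\<ge>N2. (\<Sum>m\<in>{- N..<N}. fscale (?c m ^ d) (?g f' m)) \<in> U"
    using Suc.IH[OF Suc.prems] Suc.IH[OF f'] by blast
  show ?case
  proof (intro exI[of _ "max N1 N2"] allI impI)
    fix M assume M: "max N1 N2 \<le> M"
    have "\<exists>K0. \<forall>m\<in>{- M..<M}. \<forall>K\<ge>K0. cubic i (m + k) K (dual (Inr j) m f) = - fscale (of_int (m + k + 1)) (?g f m)"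
    proof -
      define K0 where "K0 m = (SOME K0. \<forall>K\<ge>K0. cubic i (m + k) K (dual (Inr j) m f) = - fscale (of_int (m + k + 1)) (?g f m))" for m
      have K0: "\<forall>K\<ge>K0 m. cubic i (m + k) K (dual (Inr j) m f) = - fscale (of_int (m + k + 1)) (?g f m)" for m
        unfolding K0_def by (rule someI_ex[OF cubic_eq])
      have "K \<ge> K0 m" if "m \<in> {- M..<M}" "K \<ge> Max (K0 ` {- M..<M})" for m K
        using that by (metis Max_ge finite_atLeastLessThan_int finite_imageI imageI order.trans)
      then show ?thesis using K0 by blast
    qed
    then obtain K0 where K0: "\<And>m K. m \<in> {- M..<M} \<Longrightarrow> K \<ge> K0 \<Longrightarrow>
       cubic i (m + k) K (dual (Inr j) m f) = - fscale (of_int (m + k + 1)) (?g f m)" by blast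
    define K where "K = max 0 (max K0 (2 * N))"
    have "sugawara i K f = f'" unfolding f'_def K_def by (rule sugawara_stable[OF N]) simp
    have g: "sugawara i K (?g f m) = ?g f' m + fscale (?c m) (?g f m)" if "m \<in> {- M..<M}" for m
    proof -
      have "sugawara i K (?g f m) = ?g f' m - fscale (of_int (m + k + 1)) (?g f m) + fscale (1 / 2) (?g f m)"
        using K0[OF that, of K] \<open>sugawara i K f = f'\<close> by (simp add: sugawara_psi sugawara_dual K_def)
      also have "\<dots> = ?g f' m + fscale (- of_int (m + k + 1) + 1 / 2) (?g f m)"
        by (simp only: fock.scale_left_distrib fock.scale_minus_left) simp
      also have "(- of_int (m + k + 1) + 1 / 2 :: complex) = ?c m" by simp
      finally show ?thesis .
    qed
    have "sugawara i K (\<Sum>m\<in>{- M..<M}. fscale (?c m ^ d) (?g f m)) \<in> U"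
      by (rule sugawara_in) (use N1 M in simp)
    also have "sugawara i K (\<Sum>m\<in>{- M..<M}. fscale (?c m ^ d) (?g f m))
      = (\<Sum>m\<in>{- M..<M}. fscale (?c m ^ d) (?g f' m)) + (\<Sum>m\<in>{- M..<M}. fscale (?c m ^ Suc d) (?g f m))"
      unfolding sugawara_sum sum.distrib[symmetric]
      by (intro sum.cong refl) (simp add: sugawara_scale g fock.scale_right_distrib mult.commute del: of_int_add)
    finally have a: "(\<Sum>m\<in>{- M..<M}. fscale (?c m ^ d) (?g f' m)) + (\<Sum>m\<in>{- M..<M}. fscale (?c m ^ Suc d) (?g f m)) \<in> U" .
    have b: "(\<Sum>m\<in>{- M..<M}. fscale (?c m ^ d) (?g f' m)) \<in> U" using N2 M by simp
    show "(\<Sum>m\<in>{- M..<M}. fscale (?c m ^ Suc d) (?g f m)) \<in> U"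
      using fock.subspace_diff[OF sub a b] unfolding add_diff_cancel_left' .
  qed
qed

text \<open>Only finitely many m give a nonzero term, and the numbers -(m + k) - 1/2 are distinct,
  so \<open>subspace_separate\<close> applies.\<close>

lemma fermion_boson_in: "f \<in> U \<Longrightarrow> psi (Inl i) r (dual (Inr j) s f) \<in> U"
proof -
  assume f: "f \<in> U"
  define k where "k = r - s"
  let ?g = "\<lambda>m. psi (Inl i) (m + k) (dual (Inr j) m f)"
  obtain N where N: "window N f" using window_exists by blast
  define L where "L = max N (\<bar>s\<bar> + 1) + \<bar>k\<bar>"
  let ?M = "{- L..<L}"
  have z: "?g m = 0" if "m \<notin> ?M" for m
  proof (cases "m < - N")
    case True
    then show ?thesis using N by (simp add: window_def)
  next
    case False
    with that have "m + k \<ge> N" by (auto simp: L_def)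
    then show ?thesis using N by (subst psi_dual) (simp add: window_def)
  qed
  have "(\<Sum>m\<in>?M. fscale ((- of_int (m + k) - 1 / 2) ^ d) (?g m)) \<in> U" for d
  proof -
    obtain N0 where N0: "\<forall>N\<ge>N0. (\<Sum>m\<in>{- N..<N}. fscale ((- of_int (m + k) - 1 / 2) ^ d) (?g m)) \<in> U"
      using power_sums_in[OF f] by blast
    have "(\<Sum>m\<in>{- max N0 L..<max N0 L}. fscale ((- of_int (m + k) - 1 / 2) ^ d) (?g m))
      = (\<Sum>m\<in>?M. fscale ((- of_int (m + k) - 1 / 2) ^ d) (?g m))"
      by (rule sum.mono_neutral_right) (use z in auto)
    then show ?thesis using N0[rule_format, of "max N0 L"] by (simp only: max.cobounded1)
  qed
  then have "?g m \<in> U" if "m \<in> ?M" for m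
  proof (intro fock.subspace_separate[OF sub _ _ _ that])
    show "inj_on (\<lambda>m. - of_int (m + k) - 1 / 2 :: complex) ?M"
      by (rule inj_onI) (metis diff_add_cancel neg_equal_iff_equal of_int_eq_iff add_right_cancel)
  qed auto
  moreover have "s \<in> ?M" by (auto simp: L_def)
  ultimately have "?g s \<in> U" by blast
  then show ?thesis by (simp add: k_def)
qed

text \<open>
  Two commutators with the unit taking fermions to bosons produce this term together with one
  in which the dual mode is moved down by \<open>l\<close>; for large \<open>l\<close> the latter vanishes.
\<close>

lemma boson_fermion_in: "f \<in> U \<Longrightarrow> psi (Inr j) s (dual (Inl i) r f) \<in> U"
proof -
  assume f: "f \<in> U"
  let ?b = "bilin (Inr j) (Inl i)"
  obtain N where N: "window N f" using window_exists by blast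
  define l where "l = r + N + 1"
  have z: "dual (Inl i) (r - l) f = 0" using N by (simp add: l_def window_def)
  define C where "C g = psi (Inl i) (s - l) (dual (Inl i) r g) + psi (Inr j) (s - l) (dual (Inr j) r g)" for g
  have C: "C g = ?b 0 (psi (Inl i) (s - l) (dual (Inr j) r g)) + psi (Inl i) (s - l) (dual (Inr j) r (?b 0 g))" for g
    by (simp add: C_def bilin_psi bilin_dual koszul_def psi_diff psi_minus)
  have C_in: "C g \<in> U" if "g \<in> U" for g
    unfolding C by (intro fock.subspace_add sub stable fermion_boson_in that)
  have "?b l (C f) - C (?b l f) = psi (Inr j) s (dual (Inl i) r f) - psi (Inr j) (s - l) (dual (Inl i) (r - l) f)"
    by (simp add: C_def bilin_add bilin_psi bilin_dual koszul_def psi_diff psi_minus)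
  moreover have "?b l (C f) - C (?b l f) \<in> U"
    by (intro fock.subspace_diff sub stable C_in f)
  ultimately show ?thesis using z by simp
qed

lemma transfer_in:
  assumes f: "f \<in> U"
  shows "(snd a < 0) = (snd b < 0) \<Longrightarrow> fcr a (ban b f) \<in> U" "(snd a < 0) = (snd b < 0) \<Longrightarrow> fan a (bcr b f) \<in> U"
    "(snd a < 0) \<noteq> (snd b < 0) \<Longrightarrow> fcr a (bcr b f) \<in> U" "(snd a < 0) \<noteq> (snd b < 0) \<Longrightarrow> fan a (ban b f) \<in> U"
proof -
  have 1: "psi (Inl (fst a)) (snd a) (dual (Inr (fst b)) (snd b) f) \<in> U"
    "psi (Inr (fst b)) (snd b) (dual (Inl (fst a)) (snd a) f) \<in> U"
    by (rule fermion_boson_in[OF f] boson_fermion_in[OF f])+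
  note 2 = 1 1[THEN fock.subspace_neg[OF sub]]
  show "(snd a < 0) = (snd b < 0) \<Longrightarrow> fcr a (ban b f) \<in> U" "(snd a < 0) = (snd b < 0) \<Longrightarrow> fan a (bcr b f) \<in> U"
    "(snd a < 0) \<noteq> (snd b < 0) \<Longrightarrow> fcr a (bcr b f) \<in> U" "(snd a < 0) \<noteq> (snd b < 0) \<Longrightarrow> fan a (ban b f) \<in> U"
    using 2 by (cases "snd a < 0"; simp add: psi_def dual_def ferm_bos)+
qed

text \<open>Eigenvalue of \<open>psi\<close> after \<open>dual\<close> at one fermionic mode, before
  normal ordering; hence an empty mode m >= 0 gives 1. In \<open>boson_number\<close> the same
  convention gives minus the multiplicity minus 1 for m >= 0.\<close>

definition occupied :: "'n \<times> int \<Rightarrow> 'n state \<Rightarrow> complex" where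
  "occupied a = (\<lambda>(A, B). if (a |\<in>| A) = (snd a < 0) then 1 else 0)"

definition boson_number :: "'n \<times> int \<Rightarrow> 'n state \<Rightarrow> complex" where
  "boson_number b = (\<lambda>(A, B). if snd b < 0 then of_nat (count B b) else - of_nat (count B b) - 1)"

text \<open>If n and b denote the number operators of the two modes, transferring back and forth in
  the two possible orders gives n (b + 1) and (1 - n) b, with sum n + b.\<close>

lemma diag_in: "f \<in> U \<Longrightarrow> diag (\<lambda>S. occupied a S + boson_number b S) f \<in> U"
proof -
  assume f: "f \<in> U"
  obtain i r j s where ab: "a = (i, r)" "b = (j, s)" by (cases a; cases b)
  have "psi (Inl i) r (dual (Inr j) s (psi (Inr j) s (dual (Inl i) r f)))
     + psi (Inr j) s (dual (Inl i) r (psi (Inl i) r (dual (Inr j) s f))) \<in> U"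
    by (intro fock.subspace_add[OF sub] fermion_boson_in boson_fermion_in f)
  also have "psi (Inl i) r (dual (Inr j) s (psi (Inr j) s (dual (Inl i) r f)))
     + psi (Inr j) s (dual (Inl i) r (psi (Inl i) r (dual (Inr j) s f)))
     = diag (\<lambda>S. occupied a S + boson_number b S) f"
    by (rule fock_eqI)
      (auto simp: psi_def dual_def ab occupied_def boson_number_def lookup_add osc_lookup finsert_absorb
        fsign_remove algebra_simps count_eq_zero_iff)
  finally show ?thesis .
qed

lemma diag_separates:
  fixes S S' :: "'n state"
  assumes "\<And>a b. occupied a S + boson_number b S = occupied a S' + boson_number b S'"
  shows "S = S'"
proof -
  obtain A B A' B' where S: "S = (A, B)" "S' = (A', B')" by (cases S; cases S')
  \<comment> \<open>A fermionic mode empty in both states contributes equally to both sides. This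
    isolates the boson numbers, and the fermions follow from them.\<close>
  have "infinite (range (\<lambda>m :: nat. (undefined :: 'n, int m)))"
    by (rule range_inj_infinite) (auto simp: inj_def)
  then obtain a :: "'n \<times> int" where a: "a |\<notin>| A" "a |\<notin>| A'"
    using finite_subset[of _ "fset A \<union> fset A'"] by (metis Un_iff finite_UnI finite_fset subsetI)
  have b: "boson_number b S = boson_number b S'" for b
    using assms[of a b] a by (simp add: S occupied_def)
  have "count B b = count B' b" for b
    using b[of b] by (auto simp: S boson_number_def split: if_splits)
  moreover have "c |\<in>| A \<longleftrightarrow> c |\<in>| A'" for c
    using assms[of c a] b[of a] by (auto simp: S occupied_def split: if_splits)
  ultimately show ?thesis by (auto simp: S multiset_eq_iff fset_eq_iff)
qed

text \<open>Two states in the support are told apart by an operator from \<open>diag_in\<close>.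
  Subtracting its eigenvalue at S removes S and keeps S', so the support shrinks without becoming
  empty.\<close>

lemma single_in:
  assumes "f \<in> U" "f \<noteq> 0"
  shows "\<exists>S. single S 1 \<in> U"
  using assms
proof (induction "card (keys f)" arbitrary: f rule: less_induct)
  case less
  obtain S where S: "S \<in> keys f" using less.prems(2) by (metis equals0I keys_eq_empty)
  show ?case
  proof (cases "keys f = {S}")
    case True
    then have "f = fscale (lookup f S) (single S 1)"
      by (intro poly_mapping_eqI) (auto simp: lookup_single when_def in_keys_iff)
    moreover have "lookup f S \<noteq> 0" using S by (simp add: in_keys_iff)
    ultimately have "single S 1 = fscale (inverse (lookup f S)) f"
      by (metis fock.scale_scale fock.scale_one left_inverse)
    then show ?thesis using fock.subspace_scale[OF sub less.prems(1)] by metis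
  next
    case False
    then obtain S' where S': "S' \<in> keys f" "S' \<noteq> S" using S by auto
    then obtain a b where ab: "occupied a S' + boson_number b S' \<noteq> occupied a S + boson_number b S"
      using diag_separates by blast
    define g where "g = diag (\<lambda>S. occupied a S + boson_number b S) f - fscale (occupied a S + boson_number b S) f"
    have g: "lookup g T = (occupied a T + boson_number b T - (occupied a S + boson_number b S)) * lookup f T" for T
      by (simp add: g_def lookup_minus lookup_add algebra_simps)
    have "g \<in> U" unfolding g_def
      by (intro fock.subspace_diff[OF sub] fock.subspace_scale[OF sub] diag_in less.prems)
    moreover have "lookup g S' \<noteq> 0" using ab S' by (simp add: g in_keys_iff)
    then have "g \<noteq> 0" by auto
    moreover have "keys g \<subset> keys f"
    proof -
      have "keys g \<subseteq> keys f" by (auto simp: in_keys_iff g)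
      moreover have "S \<notin> keys g" by (simp add: in_keys_iff g)
      ultimately show ?thesis using S by blast
    qed
    then have "card (keys g) < card (keys f)" by (intro psubset_card_mono) auto
    ultimately show ?thesis using less.hyps by blast
  qed
qed

end

section \<open>Connecting the states of equal charge\<close>

definition total_charge :: "'n::linorder state \<Rightarrow> complex" where
  "total_charge = wsum (\<lambda>_ _. 1)"

text \<open>The charge is part of the relation so that a normal form is known to have the charge of
  the state it came from.\<close>

definition linked :: "'n::{finite,linorder} state \<Rightarrow> 'n state \<Rightarrow> bool" where
  "linked S S' \<longleftrightarrow> total_charge S = total_charge S'
     \<and> (\<forall>U. bilin_stable U \<longrightarrow> (single S 1 \<in> U \<longleftrightarrow> single S' 1 \<in> U))"

lemma linked_refl [simp]: "linked S S"
  and linked_sym: "linked S S' \<Longrightarrow> linked S' S"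
  and linked_trans [trans]: "linked S S' \<Longrightarrow> linked S' S'' \<Longrightarrow> linked S S''"
  by (auto simp: linked_def)

lemma linkedI:
  assumes "total_charge S = total_charge S'"
    and "\<And>U. bilin_stable U \<Longrightarrow> single S 1 \<in> U \<Longrightarrow> \<exists>c. c \<noteq> 0 \<and> fscale c (single S' 1) \<in> U"
    and "\<And>U. bilin_stable U \<Longrightarrow> single S' 1 \<in> U \<Longrightarrow> \<exists>c. c \<noteq> 0 \<and> fscale c (single S 1) \<in> U"
  shows "linked S S'"
proof -
  have *: "single T 1 \<in> U" if U: "bilin_stable U" and ex: "\<exists>c. c \<noteq> 0 \<and> fscale c (single T 1) \<in> U" for T :: "'a state" and U
  proof -
    obtain c where "c \<noteq> 0" "fscale c (single T 1) \<in> U" using ex by blast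
    have "fscale (inverse c) (fscale c (single T 1)) \<in> U"
      by (rule fock.subspace_scale[OF bilin_stable.sub[OF U]]) fact
    then show ?thesis using \<open>c \<noteq> 0\<close> by simp
  qed
  show ?thesis unfolding linked_def using assms(1) *[OF _ assms(2)] *[OF _ assms(3)] by blast
qed

text \<open>An odd transfer between modes on the same side of the vacuum cut trades a boson for a
  fermion; between opposite sides (\<open>linked_opposite\<close>) it creates or annihilates a
  pair.\<close>

lemma linked_same:
  assumes "a |\<notin>| A" "(snd a < 0) = (snd b < 0)"
  shows "linked (A, add_mset b B) (finsert a A, B)"
proof (rule linkedI)
  show "total_charge (A, add_mset b B) = total_charge (finsert a A, B)"
    using assms by (simp add: total_charge_def wsum_finsert wsum_add_mset osign_def)
  fix U :: "'a fock set" assume "bilin_stable U"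
  then interpret bilin_stable U .
  show "\<exists>c. c \<noteq> 0 \<and> fscale c (single (finsert a A, B) 1) \<in> U" if "single (A, add_mset b B) 1 \<in> U"
    using transfer_in(1)[OF that assms(2)] assms(1)
    by (intro exI[of _ "of_nat (Suc (count B b)) * fsign a A"])
      (simp add: ban_single fcr_single osc_scale del: of_nat_Suc)
  show "\<exists>c. c \<noteq> 0 \<and> fscale c (single (A, add_mset b B) 1) \<in> U" if "single (finsert a A, B) 1 \<in> U"
    using transfer_in(2)[OF that assms(2)] assms(1)
    by (intro exI[of _ "fsign a A"]) (simp add: bcr_single fan_single)
qed

lemma linked_opposite:
  assumes "a |\<notin>| A" "(snd a < 0) \<noteq> (snd b < 0)"
  shows "linked (A, B) (finsert a A, add_mset b B)"
proof (rule linkedI)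
  show "total_charge (A, B) = total_charge (finsert a A, add_mset b B)"
    using assms by (simp add: total_charge_def wsum_finsert wsum_add_mset osign_def)
  fix U :: "'a fock set" assume "bilin_stable U"
  then interpret bilin_stable U .
  show "\<exists>c. c \<noteq> 0 \<and> fscale c (single (finsert a A, add_mset b B) 1) \<in> U" if "single (A, B) 1 \<in> U"
    using transfer_in(3)[OF that assms(2)] assms(1)
    by (intro exI[of _ "fsign a A"]) (simp add: bcr_single fcr_single)
  show "\<exists>c. c \<noteq> 0 \<and> fscale c (single (A, B) 1) \<in> U" if "single (finsert a A, add_mset b B) 1 \<in> U"
    using transfer_in(4)[OF that assms(2)] assms(1)
    by (intro exI[of _ "of_nat (Suc (count B b)) * fsign a A"])
      (simp add: ban_single fan_single osc_scale del: of_nat_Suc)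
qed

text \<open>The normal form: fermions traded for bosons, and all bosons gathered in one mode on each
  side of the cut.\<close>

definition bosons :: "nat \<Rightarrow> nat \<Rightarrow> 'n::{finite,linorder} state" where
  "bosons p n = ({||}, replicate_mset p (undefined, - 1) + replicate_mset n (undefined, 0))"

lemma linked_no_fermions: "\<exists>B'. linked (A, B) ({||}, B')"
proof (induction A arbitrary: B)
  case (insert a A)
  then show ?case using linked_trans[OF linked_sym[OF linked_same[of a A a B]]] by blast
qed (use linked_refl in blast)

lemma linked_exchange:
  assumes "(snd b < 0) = (snd c < 0)"
  shows "linked ({||}, add_mset b B) ({||}, add_mset c B)"
  using linked_trans[OF linked_same[of b "{||}" b B] linked_sym[OF linked_same[of b "{||}" c B]]] assms by simp

lemma linked_normalise: "\<exists>p n. linked ({||}, B + C) ({||}, replicate_mset p (undefined, - 1) + replicate_mset n (undefined, 0) + C)"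
proof (induction B arbitrary: C)
  case empty
  show ?case by (intro exI[of _ 0]) simp
next
  case (add b B)
  define c :: "'a \<times> int" where "c = (if snd b < 0 then (undefined, - 1) else (undefined, 0))"
  have "linked ({||}, add_mset b B + C) ({||}, B + add_mset c C)"
    using linked_exchange[of b c "B + C"] by (simp add: c_def)
  moreover obtain p n where "linked ({||}, B + add_mset c C)
    ({||}, replicate_mset p (undefined, - 1) + replicate_mset n (undefined, 0) + add_mset c C)"
    using add by blast
  ultimately have 1: "linked ({||}, add_mset b B + C)
    ({||}, replicate_mset p (undefined, - 1) + replicate_mset n (undefined, 0) + add_mset c C)"
    by (rule linked_trans)
  show ?case
  proof (cases "snd b < 0")
    case True
    with 1 show ?thesis by (intro exI[of _ "Suc p"] exI[of _ n]) (simp add: c_def)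
  next
    case False
    with 1 show ?thesis by (intro exI[of _ p] exI[of _ "Suc n"]) (simp add: c_def)
  qed
qed

text \<open>The transfers at hand always involve one fermion, so two bosons are not annihilated
  directly: the particle first becomes a fermion, which then annihilates with the bosonic
  antiparticle.\<close>

lemma linked_cancel: "linked (bosons (p + k) (n + k)) (bosons p n)"
proof (induction k)
  case (Suc k)
  let ?B = "replicate_mset (p + k) (undefined :: 'a, - 1 :: int) + replicate_mset (n + k) (undefined, 0)"
  let ?a = "(undefined :: 'a, - 1 :: int)"
  have "linked ({||}, add_mset ?a (add_mset (undefined, 0) ?B)) (finsert ?a {||}, add_mset (undefined, 0) ?B)"
    by (rule linked_same) auto
  also have "linked \<dots> ({||}, ?B)"
    by (rule linked_sym, rule linked_opposite) auto
  also have "({||}, ?B) = bosons (p + k) (n + k)" by (simp add: bosons_def)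
  also note Suc
  also have "({||}, add_mset ?a (add_mset (undefined, 0) ?B)) = bosons (p + Suc k) (n + Suc k)"
    by (simp add: bosons_def add_mset_commute)
  finally show ?case .
qed simp

lemma charge_bosons: "total_charge (bosons p n) = of_nat p - of_nat n"
proof -
  have "(\<Sum>b\<in>#replicate_mset p (undefined :: 'a, - 1 :: int). osign (snd b)) = of_nat p"
    by (induction p) (auto simp: osign_def)
  moreover have "(\<Sum>b\<in>#replicate_mset n (undefined :: 'a, 0 :: int). osign (snd b)) = - of_nat n"
    by (induction n) (auto simp: osign_def)
  ultimately show ?thesis by (simp add: total_charge_def bosons_def wsum_def)
qed

lemma linked_bosons: "\<exists>p n. linked S (bosons p n) \<and> (p = 0 \<or> n = 0)"
proof -
  obtain A B where "S = (A, B)" by (cases S)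
  moreover obtain B' where "linked (A, B) ({||}, B')" using linked_no_fermions by blast
  moreover obtain p n where "linked ({||}, B') (bosons p n)"
    using linked_normalise[of B' "{#}"] by (auto simp: bosons_def)
  moreover have "linked (bosons p n) (bosons (p - n) (n - p) :: 'a state)"
    using linked_cancel[of "p - n" "min p n" "n - p"] by (simp add: min_def split: if_splits)
  ultimately show ?thesis by (meson diff_is_0_eq' linked_trans nat_le_linear)
qed

theorem linked_charge:
  assumes "total_charge S = total_charge S'"
  shows "linked S S'"
proof -
  obtain p n p' n' where h: "linked S (bosons p n)" "p = 0 \<or> n = 0" "linked S' (bosons p' n')" "p' = 0 \<or> n' = 0"
    using linked_bosons by metis
  have "(of_nat p - of_nat n :: complex) = of_nat p' - of_nat n'"
    using h(1,3) assms unfolding linked_def charge_bosons by simp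
  then have "(of_nat (p + n') :: complex) = of_nat (p' + n)" by (simp add: algebra_simps)
  then have "p + n' = p' + n" by (simp only: of_nat_eq_iff)
  then have "p = p'" "n = n'" using h(2,4) by auto
  then show ?thesis using h linked_trans linked_sym by metis
qed

definition charge_space :: "complex \<Rightarrow> 'n::linorder fock set" where
  "charge_space l = {f. diag total_charge f = fscale l f}"

lemma charge_space_iff: "f \<in> charge_space l \<longleftrightarrow> (\<forall>S\<in>keys f. total_charge S = l)"
  by (auto simp: charge_space_def poly_mapping_eq_iff fun_eq_iff in_keys_iff)

lemma charge_space_subspace: "fock.subspace (charge_space l)"
  by (rule fock.subspaceI) (auto simp: charge_space_def diag_add diag_scale fock.scale_right_distrib mult.commute)

lemma charge_space_bilin: "f \<in> charge_space l \<Longrightarrow> bilin x y k f \<in> charge_space l"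
  using diag_bilin[of "\<lambda>_ _. 1" x k y 0 f] by (simp add: charge_space_def total_charge_def bilin_scale)

lemma fock_sum_single: "f = (\<Sum>S\<in>keys f. fscale (lookup f S) (single S 1))"
proof (rule poly_mapping_eqI)
  fix T
  have "(\<Sum>S\<in>keys f. lookup f S * lookup (single S 1) T) = (\<Sum>S\<in>keys f. if S = T then lookup f T else 0)"
    by (intro sum.cong) (auto simp: lookup_single when_def)
  then show "lookup f T = lookup (\<Sum>S\<in>keys f. fscale (lookup f S) (single S 1)) T"
    by (simp add: lookup_sum in_keys_iff)
qed

theorem charge_space_irreducible:
  fixes U :: "'n::{finite,linorder} fock set"
  assumes "fock.subspace U" "\<And>x y k f. f \<in> U \<Longrightarrow> bilin x y k f \<in> U" "U \<subseteq> charge_space l"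
  shows "U = {0} \<or> U = charge_space l"
proof (cases "U = {0}")
  case False
  interpret bilin_stable U using assms by unfold_locales
  obtain f where "f \<in> U" "f \<noteq> 0" using False fock.subspace_0[OF sub] by blast
  then obtain S where S: "single S 1 \<in> U" using single_in by blast
  then have "total_charge S = l" using assms(3) by (auto simp: charge_space_iff)
  then have "single T 1 \<in> U" if "total_charge T = l" for T
    using linked_charge[of S T] S that bilin_stable_axioms by (auto simp: linked_def)
  then have "f \<in> U" if "f \<in> charge_space l" for f
    using that by (subst fock_sum_single) (intro fock.subspace_sum sub fock.subspace_scale, auto simp: charge_space_iff)
  then show ?thesis using assms(3) by blast
qed simp


section \<open>Modules over the affine superalgebra\<close>

lemma mat_unit_mult: "mat_unit x y ** mat_unit z w = (if y = z then mat_unit x w else 0)"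
proof -
  have "(\<Sum>k\<in>UNIV. (if a = x \<and> k = y then 1 else 0) * (if k = z \<and> b = w then 1 else (0::complex)))
     = (\<Sum>k\<in>UNIV. if k = y then (if a = x \<and> y = z \<and> b = w then 1 else 0) else 0)" for a b
    by (intro sum.cong) auto
  then show ?thesis by (auto simp: matrix_matrix_mult_def mat_unit_def vec_eq_iff)
qed

lemma mat_unit_nonzero: "mat_unit x y \<noteq> 0"
  by (auto simp: mat_unit_def vec_eq_iff)

lemma gl_part_mat_unit: "gl_part p (mat_unit x y) = (if (isl x \<noteq> isl y) = p then mat_unit x y else 0)"
  by (auto simp: gl_part_def mat_unit_def vec_eq_iff)

lemma mat_scale_simps: "mat_scale 1 A = A" "mat_scale c 0 = 0" "mat_scale 0 A = 0" "mat_scale (- 1) A = - A"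
  by (simp_all add: mat_scale_def vec_eq_iff)

lemma matrix_mult_zero: "A ** (0 :: 'n::finite gl) = 0"
  by (simp add: matrix_matrix_mult_def vec_eq_iff)

lemma gl_bracket_mat_unit:
  "gl_bracket (mat_unit x y) (mat_unit z w) =
     (if y = z then mat_unit x w else 0) - (if x = w then mat_scale (unit_sign x y z w) (mat_unit z y) else 0)"
proof -
  define p r where "p = (isl x \<noteq> isl y)" and "r = (isl z \<noteq> isl w)"
  have "gl_bracket (mat_unit x y) (mat_unit z w) = (\<Sum>p'\<in>UNIV. \<Sum>r'\<in>UNIV. if r' = r then if p' = p then
      mat_unit x y ** mat_unit z w - mat_scale (if p \<and> r then - 1 else 1) (mat_unit z w ** mat_unit x y) else 0 else 0)"
    unfolding gl_bracket_def gl_part_mat_unit p_def[symmetric] r_def[symmetric]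
    by (intro sum.cong refl) (auto simp: matrix_mult_zero mat_scale_simps)
  also have "\<dots> = mat_unit x y ** mat_unit z w - mat_scale (if p \<and> r then - 1 else 1) (mat_unit z w ** mat_unit x y)"
    by simp
  finally show ?thesis
    by (auto simp: mat_unit_mult unit_sign_def p_def r_def mat_scale_simps)
qed

lemma Str_mat_unit: "Str (mat_unit x y) = (if x = y then str_sign x else 0)"
  by (cases x; cases y) (auto simp: Str_def mat_unit_def str_sign_def intro!: sum.neutral)

lemma ghat_scale_loop: "ghat_scale a (loop A k) = loop (mat_scale a A) k"
  by (auto simp: ghat_scale_def loop_def mat_scale_simps)

lemma loop_add: "loop (A + B) k = loop A k + loop B k"
  by (simp add: loop_def single_add)

lemma loop_diff: "loop (A - B) k = loop A k - loop B k"
  by (simp add: loop_def single_diff zero_prod_def)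

lemma loop_zero: "loop 0 k = 0"
  by (simp add: loop_def zero_prod_def)

lemma map_mat_scale_zero [simp]: "Poly_Mapping.map (mat_scale c) 0 = 0"
  by (simp add: map_eq_zero_iff)

lemma loop_sum: "loop (sum f I) k = (\<Sum>i\<in>I. loop (f i) k)"
  by (induction I rule: infinite_finite_induct) (auto simp: loop_add loop_zero)

lemma mat_unit_decomposition: "A = (\<Sum>x\<in>UNIV. \<Sum>y\<in>UNIV. mat_scale (A $ x $ y) (mat_unit x y))"
proof -
  have "(\<Sum>x\<in>UNIV. \<Sum>y\<in>UNIV. A $ x $ y * (if a = x \<and> b = y then 1 else 0)) = A $ a $ b" for a b
  proof -
    have "(\<Sum>x\<in>UNIV. \<Sum>y\<in>UNIV. A $ x $ y * (if a = x \<and> b = y then 1 else 0))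
       = (\<Sum>x\<in>UNIV. if x = a then (\<Sum>y\<in>UNIV. if y = b then A $ a $ b else 0) else 0)"
    proof (intro sum.cong refl)
      fix x
      show "(\<Sum>y\<in>UNIV. A $ x $ y * (if a = x \<and> b = y then 1 else 0))
        = (if x = a then \<Sum>y\<in>UNIV. if y = b then A $ a $ b else 0 else 0)"
        by (cases "x = a") (auto intro!: sum.cong sum.neutral simp del: sum.delta sum.delta')
    qed
    then show ?thesis by simp
  qed
  then show ?thesis by (simp add: vec_eq_iff mat_scale_def mat_unit_def)
qed

definition C_elem :: "'n::finite ghat" where
  "C_elem = (0, 1, 0)"

lemma ghat_decomposition:
  "(X, c, u) = (\<Sum>k\<in>keys X. \<Sum>x\<in>UNIV. \<Sum>y\<in>UNIV. ghat_scale (lookup X k $ x $ y) (loop (mat_unit x y) k))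
     + (ghat_scale c C_elem + ghat_scale u d_elem)"
proof -
  have X: "X = (\<Sum>k\<in>keys X. single k (lookup X k))"
  proof (rule poly_mapping_eqI)
    fix l
    have "(\<Sum>k\<in>keys X. lookup (single k (lookup X k)) l) = (\<Sum>k\<in>keys X. if k = l then lookup X l else 0)"
      by (intro sum.cong) (auto simp: lookup_single when_def)
    then show "lookup X l = lookup (\<Sum>k\<in>keys X. single k (lookup X k)) l"
      by (simp add: lookup_sum in_keys_iff)
  qed
  have single_loop: "(\<Sum>k\<in>I. single k (f k), 0, 0) = (\<Sum>k\<in>I. loop (f k) k)" for f :: "int \<Rightarrow> 'a gl" and I
  proof (induction I rule: infinite_finite_induct)
    case (insert x F)
    have "(\<Sum>k\<in>insert x F. single k (f k), 0 :: complex, 0 :: complex)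
       = loop (f x) x + (\<Sum>k\<in>F. single k (f k), 0, 0)"
      using insert.hyps by (simp add: loop_def)
    then show ?case using insert.hyps by (simp add: insert.IH)
  qed (simp_all add: zero_prod_def)
  have "(X, 0, 0) = (\<Sum>k\<in>keys X. loop (lookup X k) k)"
    unfolding single_loop[symmetric] by (rule arg_cong[OF X])
  also have "\<dots> = (\<Sum>k\<in>keys X. \<Sum>x\<in>UNIV. \<Sum>y\<in>UNIV. ghat_scale (lookup X k $ x $ y) (loop (mat_unit x y) k))"
  proof (rule sum.cong[OF refl])
    fix k
    show "loop (lookup X k) k = (\<Sum>x\<in>UNIV. \<Sum>y\<in>UNIV. ghat_scale (lookup X k $ x $ y) (loop (mat_unit x y) k))"
      by (subst mat_unit_decomposition) (simp add: loop_sum ghat_scale_loop)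
  qed
  finally have 1: "(X, 0, 0) = \<dots>" .
  have 2: "ghat_scale c C_elem + ghat_scale u d_elem = (0, c, u)"
    by (simp add: ghat_scale_def C_elem_def d_elem_def)
  show ?thesis unfolding 2 1[symmetric] by simp
qed

lemma ghat_bracket_loop:
  assumes "A \<noteq> 0" "B \<noteq> 0"
  shows "ghat_bracket (loop A k) (loop B l) = loop (gl_bracket A B) (k + l)
    + ghat_scale (if k + l = 0 then of_int k * Str (A ** B) else 0) C_elem"
  using assms by (simp add: ghat_bracket_def loop_def ghat_scale_def C_elem_def mat_scale_simps)

lemma ghat_bracket_d_loop: "A \<noteq> 0 \<Longrightarrow> ghat_bracket d_elem (loop A k) = ghat_scale (of_int k) (loop A k)"
  by (simp add: ghat_scale_loop) (simp add: ghat_bracket_def loop_def d_elem_def mat_scale_simps)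

lemma ghat_bracket_C_loop: "A \<noteq> 0 \<Longrightarrow> ghat_bracket C_elem (loop A k) = 0"
  by (simp add: ghat_bracket_def loop_def C_elem_def mat_scale_simps zero_prod_def)

lemma ghat_bracket_C_d: "ghat_bracket C_elem d_elem = 0"
  by (simp add: ghat_bracket_def d_elem_def C_elem_def zero_prod_def)

lemma part_loop: "loop (mat_unit x y) k \<in> ghat_part (isl x \<noteq> isl y)"
  by (auto simp: ghat_part_def loop_def lookup_single when_def gl_part_mat_unit) (simp_all add: gl_part_def vec_eq_iff)

lemma part_C: "C_elem \<in> ghat_part False" and part_d: "d_elem \<in> ghat_part False"
  by (auto simp: ghat_part_def C_elem_def d_elem_def gl_part_def vec_eq_iff)

context ghat_module
begin

abbreviation "T x y k \<equiv> act (loop (mat_unit x y) k)"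
abbreviation "D \<equiv> act d_elem"
abbreviation "C \<equiv> act C_elem"

lemma act_zero_left [simp]: "act 0 v = 0"
  using act_add_left[of 0 0 v] by simp

lemma act_diff_left: "act (x - y) v = act x v - act y v"
  using act_add_left[of "x - y" y v] by (simp add: algebra_simps)

lemma act_zero_right [simp]: "act x 0 = 0"
  using act_add_right[of x 0 0] by simp

lemma act_sum_left: "act (sum f I) v = (\<Sum>i\<in>I. act (f i) v)"
  by (induction I rule: infinite_finite_induct) (auto simp: act_add_left)

lemma act_decomposition: "act (X, c, u) v =
   (\<Sum>k\<in>keys X. \<Sum>x\<in>UNIV. \<Sum>y\<in>UNIV. scale (lookup X k $ x $ y) (T x y k v)) + (scale c (C v) + scale u (D v))"
  by (subst ghat_decomposition) (simp add: act_add_left act_scale_left act_sum_left)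

lemma act_closed:
  assumes "subspace W" "\<And>x y k. T x y k v \<in> W" "D v \<in> W" "C v \<in> W"
  shows "act z v \<in> W"
proof (cases z)
  case (fields X c u)
  then show ?thesis using assms
    by (auto simp: act_decomposition intro!: subspace_add subspace_sum subspace_scale)
qed

lemma T_commutator: "T x y k (T z w l v) = scale (unit_sign x y z w) (T z w l (T x y k v))
       + (if y = z then T x w (k + l) v else 0)
       - (if x = w then scale (unit_sign x y z w) (T z y (k + l) v) else 0)
       + (if y = z \<and> x = w \<and> k + l = 0 then scale (of_int k * str_sign x) (C v) else 0)"
proof -
  have "T x y k (T z w l v) = scale (unit_sign x y z w) (T z w l (T x y k v))
      + act (ghat_bracket (loop (mat_unit x y) k) (loop (mat_unit z w) l)) v"
    unfolding act_bracket[OF part_loop part_loop, of x y k z w l v] unit_sign_def[symmetric] by (simp only: add_diff_eq add_diff_cancel_left')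
  also have "act (ghat_bracket (loop (mat_unit x y) k) (loop (mat_unit z w) l)) v
     = (if y = z then T x w (k + l) v else 0)
       - (if x = w then scale (unit_sign x y z w) (T z y (k + l) v) else 0)
       + (if y = z \<and> x = w \<and> k + l = 0 then scale (of_int k * str_sign x) (C v) else 0)"
  proof -
    have a: "act (loop (if b then A else 0) m) v = (if b then act (loop A m) v else 0)" for b A m
      by (simp add: loop_zero)
    have s: "Str (if y = z then mat_unit x w else 0) = (if y = z \<and> x = w then str_sign x else 0)"
      by (cases "y = z") (simp_all add: Str_mat_unit, simp add: Str_def)
    have c: "scale (if k + l = 0 then of_int k * (if y = z \<and> x = w then str_sign x else 0) else 0) (C v)
      = (if y = z \<and> x = w \<and> k + l = 0 then scale (of_int k * str_sign x) (C v) else 0)"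
      by (cases "k + l = 0"; cases "y = z \<and> x = w") (simp_all only: act_scale_left if_True if_False simp_thms mult_zero_right scale_zero_left)
    show ?thesis
      unfolding ghat_bracket_loop[OF mat_unit_nonzero mat_unit_nonzero] gl_bracket_mat_unit act_add_left
        loop_diff act_diff_left a mat_unit_mult s ghat_scale_loop[symmetric] act_scale_left c ..
  qed
  finally show ?thesis by (simp only: add_diff_eq flip: add.assoc)
qed

lemma D_commutator: "D (T x y k v) = T x y k (D v) + scale (of_int k) (T x y k v)"
  using act_bracket[OF part_d part_loop, of x y k v]
  by (simp add: ghat_bracket_d_loop mat_unit_nonzero act_scale_left algebra_simps)

lemma C_commutator: "C (T x y k v) = T x y k (C v)" "C (D v) = D (C v)"
  using act_bracket[OF part_C part_loop, of x y k v] act_bracket[OF part_C part_d, of v]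
  by (simp_all add: ghat_bracket_C_loop mat_unit_nonzero ghat_bracket_C_d)

text \<open>C is even and central, so its fixed vectors form a graded submodule, which is nonzero
  because of v.\<close>

lemma C_trivial:
  assumes "irreducible_module" "v \<noteq> 0" "C v = v"
  shows "C u = u"
proof -
  define W where "W = {u. C u = u}"
  have sW: "subspace W"
    by (rule subspaceI) (auto simp: W_def act_add_right act_scale_right)
  have "submodule W" unfolding submodule_def
  proof (intro conjI ballI allI)
    fix w assume w: "w \<in> W"
    obtain w0 w1 where h: "w0 \<in> V False" "w1 \<in> V True" "w = w0 + w1" using V_decomp by blast
    have c: "C w0 \<in> V False" "C w1 \<in> V True"
      using act_parity[OF part_C h(1)] act_parity[OF part_C h(2)] by simp_all
    have "C w0 + C w1 = w0 + w1" using w h(3) by (simp add: W_def act_add_right)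
    then have e: "C w0 - w0 = w1 - C w1" by (simp add: algebra_simps)
    have "C w0 - w0 \<in> V False" using c h subspace_V subspace_diff by blast
    moreover have "w1 - C w1 \<in> V True" using c h subspace_V subspace_diff by blast
    ultimately have "C w0 - w0 \<in> V False \<inter> V True" using e by (metis IntI)
    then have z: "C w0 - w0 = 0" unfolding V_disjoint by simp
    then have "w0 \<in> W" "w1 \<in> W" using e by (simp_all add: W_def)
    then show "\<exists>w0\<in>W \<inter> V False. \<exists>w1\<in>W \<inter> V True. w = w0 + w1" using h by blast
  next
    fix x w assume "w \<in> W"
    show "act x w \<in> W"
      by (rule act_closed[OF sW]) (use \<open>w \<in> W\<close> in \<open>simp_all add: W_def C_commutator\<close>)
  qed (rule sW)
  then have "W = {0} \<or> W = UNIV" using assms(1) by (simp add: irreducible_module_def)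
  moreover have "v \<in> W" using assms by (simp add: W_def)
  ultimately show ?thesis using assms(2) by (auto simp: W_def)
qed

lemma unit_action_level_one:
  assumes "\<And>v. C v = v"
  shows "unit_action scale T D"
proof
  fix x y :: "'n + 'n" and k z w l and a :: 'v
  show "T x y k (T z w l a) = scale (unit_sign x y z w) (T z w l (T x y k a))
       + (if y = z then T x w (k + l) a else 0)
       - (if x = w then scale (unit_sign x y z w) (T z y (k + l) a) else 0)
       + (if y = z \<and> x = w \<and> k + l = 0 then scale (of_int k * str_sign x) a else 0)"
    using T_commutator[of x y k z w l a] unfolding assms .
qed (rule act_add_right act_scale_right D_commutator)+

end


section \<open>The character of the irreducible module\<close>

definition fermion_parity :: "'n state \<Rightarrow> complex" where
  "fermion_parity = (\<lambda>(A, B). (- 1) ^ fcard A)"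

lemma fermion_parity_nonzero [simp]: "fermion_parity S \<noteq> 0"
  by (cases S) (simp add: fermion_parity_def)

lemma parity_fcr: "diag fermion_parity (fcr a f) = - fcr a (diag fermion_parity f)"
  unfolding fcr_def
proof (subst diag_pull_mult[where r = "- 1"])
  fix S :: "'a state"
  obtain A B where S: "S = (A, B)" by (cases S)
  assume "(case S of (A, B) \<Rightarrow> if a |\<in>| A then fsign a A else 0) \<noteq> 0"
  then have "a |\<in>| A" by (simp add: S split: if_splits)
  then have "fcard A = Suc (fcard (A |-| {|a|}))" using fcard_Suc_fminus1[of a A] by simp
  then show "fermion_parity S = - 1 * fermion_parity (case S of (A, B) \<Rightarrow> (A |-| {|a|}, B))"
    by (simp add: S fermion_parity_def)
qed simp

lemma parity_fan: "diag fermion_parity (fan a f) = - fan a (diag fermion_parity f)"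
  unfolding fan_def
  by (subst diag_pull_mult[where r = "- 1"])
    (auto simp: fermion_parity_def fcard_finsert_if split: if_splits)

lemma parity_bcr: "diag fermion_parity (bcr b f) = bcr b (diag fermion_parity f)"
  unfolding bcr_def by (subst diag_pull_mult[where r = 1]) (auto simp: fermion_parity_def)

lemma parity_ban: "diag fermion_parity (ban b f) = ban b (diag fermion_parity f)"
  unfolding ban_def by (subst diag_pull_mult[where r = 1]) (auto simp: fermion_parity_def)

lemma parity_psi: "diag fermion_parity (psi x m f) = fscale (if isl x then - 1 else 1) (psi x m (diag fermion_parity f))"
  by (cases x; cases "m < 0") (simp_all add: psi_def parity_fcr parity_fan parity_bcr parity_ban diag_minus)

lemma parity_dual: "diag fermion_parity (dual x m f) = fscale (if isl x then - 1 else 1) (dual x m (diag fermion_parity f))"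
  by (cases x; cases "m < 0") (simp_all add: dual_def parity_fcr parity_fan parity_bcr parity_ban diag_minus)

lemma parity_npair: "diag fermion_parity (npair x m y n f)
    = fscale (if isl x \<noteq> isl y then - 1 else 1) (npair x m y n (diag fermion_parity f))"
  by (auto simp: npair_def parity_psi parity_dual diag_diff diag_scale psi_scale psi_minus fock.scale_right_diff_distrib)

lemma parity_bilin: "diag fermion_parity (bilin x y k f)
    = fscale (if isl x \<noteq> isl y then - 1 else 1) (bilin x y k (diag fermion_parity f))"
proof -
  obtain L where w: "window L f" "window L (diag fermion_parity f)" by (rule common_window)
  have e: "bilin x y k g = (\<Sum>m\<in>{- L..<L - k}. npair x (m + k) y m g)" if "window L g" for g
    by (rule bilin_window[OF that]) auto
  show ?thesis unfolding e[OF w(1)] e[OF w(2)]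
    by (simp only: diag_sum parity_npair fock.scale_sum_right)
qed

definition parity_space :: "complex \<Rightarrow> 'n::linorder fock set" where
  "parity_space e = {f. diag fermion_parity f = fscale e f}"

lemma parity_space_subspace: "fock.subspace (parity_space e)"
  by (rule fock.subspaceI) (auto simp: parity_space_def diag_add diag_scale fock.scale_right_distrib mult.commute)

lemma diag_eigen: "diag c f = fscale r f \<longleftrightarrow> (\<forall>S\<in>keys f. c S = r)"
  by (auto simp: poly_mapping_eq_iff fun_eq_iff in_keys_iff)

definition state_wt :: "int \<Rightarrow> 'n::{finite,linorder} state \<Rightarrow> 'n wt_hd" where
  "state_wt s S = (\<chi> x. wsum (\<lambda>z m. if z = x then 1 else 0) S, wsum (\<lambda>x m. of_int (m + s)) S)"

definition states :: "int \<Rightarrow> complex \<Rightarrow> 'n::{finite,linorder} wt_hd \<Rightarrow> 'n state set" where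
  "states s l \<eta> = {S. total_charge S = l \<and> state_wt s S = \<eta>}"

lemma weight_states:
  "f \<in> charge_space l \<and> (\<forall>x. bilin x x 0 f = fscale (fst \<eta> $ x) f) \<and> energy s f = fscale (snd \<eta>) f
     \<longleftrightarrow> keys f \<subseteq> states s l \<eta>"
  unfolding bilin_diag energy_def diag_eigen charge_space_iff states_def state_wt_def
  by (auto simp: prod_eq_iff vec_eq_iff subset_iff)

lemma span_singles: "fock.span ((\<lambda>S. single S (1 :: complex)) ` X) = {f. keys f \<subseteq> X}"
proof
  show "fock.span ((\<lambda>S. single S (1 :: complex)) ` X) \<subseteq> {f. keys f \<subseteq> X}"
  proof (rule fock.span_minimal)
    show "fock.subspace {f. keys f \<subseteq> X}"
      by (rule fock.subspaceI) (auto simp: in_keys_iff lookup_add subset_iff, metis add.right_neutral)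
  qed auto
  show "{f. keys f \<subseteq> X} \<subseteq> fock.span ((\<lambda>S. single S (1 :: complex)) ` X)"
  proof
    fix f :: "'a \<Rightarrow>\<^sub>0 complex" assume "f \<in> {f. keys f \<subseteq> X}"
    then show "f \<in> fock.span ((\<lambda>S. single S (1 :: complex)) ` X)"
      by (subst fock_sum_single) (intro fock.span_sum fock.span_scale fock.span_base, auto)
  qed
qed

lemma independent_singles: "finite X \<Longrightarrow> fock.independent ((\<lambda>S. single S (1 :: complex)) ` X)"
proof (rule fock.independent_if_scalars_zero)
  fix c :: "('a \<Rightarrow>\<^sub>0 complex) \<Rightarrow> complex" and f
  assume X: "finite X" and z: "(\<Sum>f\<in>(\<lambda>S. single S (1 :: complex)) ` X. fscale (c f) f) = 0" and f: "f \<in> (\<lambda>S. single S (1 :: complex)) ` X"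
  obtain S where S: "S \<in> X" "f = single S 1" using f by auto
  have inj: "inj_on (\<lambda>S. single S (1 :: complex)) X"
    by (rule inj_onI) (metis lookup_single_eq lookup_single_not_eq zero_neq_one)
  have "0 = lookup (\<Sum>f\<in>(\<lambda>S. single S (1 :: complex)) ` X. fscale (c f) f) S" by (simp add: z)
  also have "\<dots> = (\<Sum>T\<in>X. c (single T 1) * lookup (single T 1) S)"
    by (simp add: sum.reindex[OF inj] lookup_sum)
  also have "\<dots> = (\<Sum>T\<in>X. if T = S then c f else 0)"
    by (intro sum.cong) (auto simp: lookup_single when_def S)
  also have "\<dots> = c f" using S X by simp
  finally show "c f = 0" by simp
qed auto

context ghat_module
begin

text \<open>L is identified with the charge component of \<open>S0\<close>. Basis states there are
  weight vectors, so the states of a given weight form a basis of its weight space.\<close>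

theorem fock_character:
  assumes L: "is_L ns_borel (a, 1, 0)"
    and w: "unit_action.hw_vector fscale bilin (energy s) (\<lambda>x. a $ x) (single S0 1)"
    and fin: "\<And>\<eta> :: 'n wt_hd. finite (states s (total_charge S0) \<eta>)"
  shows "has_character (\<lambda>\<eta>. card (states s (total_charge S0) \<eta>))"
proof -
  have irr: "irreducible_module" using L by (simp add: is_L_def)
  obtain v where v: "highest_weight_vector ns_borel (a, 1, 0) v"
    using L by (auto simp: is_L_def highest_weight_module_def)
  then obtain p where p: "v \<in> V p" "v \<noteq> 0" by (auto simp: highest_weight_vector_def)
  have act_v: "act x v = scale (wt_eval (a, 1, 0) x) v" if "x \<in> ghat_borel ns_borel" for x
    using v that by (auto simp: highest_weight_vector_def)
  have "C v = v"
    using act_v[of C_elem] by (simp add: ghat_borel_def C_elem_def ns_borel_def wt_eval_def)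
  then have C: "C u = u" for u by (rule C_trivial[OF irr \<open>v \<noteq> 0\<close>])
  interpret A: unit_action scale T D by (rule unit_action_level_one[OF C])
  have hw: "A.hw_vector (\<lambda>x. a $ x) v"
    unfolding A.hw_vector_def
  proof (intro conjI allI impI)
    show "v \<noteq> 0" by fact
    show "D v = 0"
      using act_v[of d_elem] by (simp add: ghat_borel_def d_elem_def ns_borel_def wt_eval_def)
    show "T x x 0 v = scale (a $ x) v" for x
    proof -
      have "loop (mat_unit x x) 0 \<in> ghat_borel ns_borel"
        by (auto simp: ghat_borel_def loop_def ns_borel_def mat_unit_def lookup_single when_def)
      moreover have "wt_eval (a, 1, 0) (loop (mat_unit x x) 0) = (\<Sum>y\<in>UNIV. if y = x then a $ x else 0)"
        unfolding wt_eval_def loop_def mat_unit_def by (auto simp del: sum.delta sum.delta' intro!: sum.cong)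
      ultimately show ?thesis using act_v by simp
    qed
    show "T x y k v = 0" if "raising x y k" for x y k
    proof -
      have ne: "x \<noteq> y" if "ns_less x y" for x y :: "'n + 'n" using that by (cases x; cases y) auto
      have "loop (mat_unit x y) k \<in> ghat_borel ns_borel"
        using that by (auto simp: raising_def ghat_borel_def loop_def ns_borel_def mat_unit_def lookup_single when_def)
      moreover have "wt_eval (a, 1, 0) (loop (mat_unit x y) k) = 0"
        using that by (auto simp: raising_def wt_eval_def loop_def mat_unit_def lookup_single when_def dest: ne intro!: sum.neutral)
      ultimately show ?thesis using act_v by simp
    qed
  qed
  \<comment> \<open>The parity p of the highest weight vector of L is arbitrary. The factor
    \<open>fermion_parity S0\<close> places the highest weight vector of the Fock space in the
    component with index p.\<close>
  define e where "e r = (if r = p then 1 else - 1) * fermion_parity S0" for r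
  interpret two_actions scale T D fscale bilin "energy s" V "\<lambda>r. parity_space (e r)"
    "charge_space (total_charge S0)" "\<lambda>x. a $ x" v "single S0 1" p
  proof
    show "subspace (V r)" for r by (rule subspace_V)
    show "fock.subspace (parity_space (e r))" for r by (rule parity_space_subspace)
    show "parity_space (e False) \<inter> parity_space (e True) = {0}"
    proof -
      have "f = 0" if "diag fermion_parity f = fscale (e False) f" "diag fermion_parity f = fscale (e True) f" for f
      proof -
        have "e False \<noteq> e True" by (auto simp: e_def)
        then show ?thesis using that by (auto simp: fock.scale_right_imp_eq fock.scale_cancel_right)
      qed
      then show ?thesis by (auto simp: parity_space_def)
    qed
    show "T x y k u \<in> V ((isl x \<noteq> isl y) \<noteq> r)" if "u \<in> V r" for u r x y k
      by (rule act_parity[OF part_loop that])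
    show "bilin x y k f \<in> parity_space (e ((isl x \<noteq> isl y) \<noteq> r))" if "f \<in> parity_space (e r)" for f r x y k
      using that by (auto simp: parity_space_def parity_bilin bilin_scale e_def)
    show "A.hw_vector (\<lambda>x. a $ x) v" by (rule hw)
    show "unit_action.hw_vector fscale bilin (energy s) (\<lambda>x. a $ x) (single S0 1)" by (rule w)
    show "v \<in> V p" by fact
    show "single S0 1 \<in> parity_space (e p)"
      by (simp add: parity_space_def diag_eigen e_def)
    show "W = {0} \<or> W = UNIV" if "subspace W"
      "\<And>a. a \<in> W \<Longrightarrow> \<exists>a0\<in>W \<inter> V False. \<exists>a1\<in>W \<inter> V True. a = a0 + a1"
      "\<And>x y k a. a \<in> W \<Longrightarrow> T x y k a \<in> W" "\<And>a. a \<in> W \<Longrightarrow> D a \<in> W" for W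
    proof -
      have "act x u \<in> W" if "u \<in> W" for x u
        by (rule act_closed[OF \<open>subspace W\<close>]) (simp_all add: C that \<open>\<And>x y k a. a \<in> W \<Longrightarrow> T x y k a \<in> W\<close> \<open>\<And>a. a \<in> W \<Longrightarrow> D a \<in> W\<close>)
      then have "submodule W" unfolding submodule_def using that(1,2) by blast
      then show ?thesis using irr by (simp add: irreducible_module_def)
    qed
    show "fock.subspace (charge_space (total_charge S0))" by (rule charge_space_subspace)
    show "bilin x y k f \<in> charge_space (total_charge S0)" if "f \<in> charge_space (total_charge S0)" for f x y k
      by (rule charge_space_bilin[OF that])
    show "single S0 1 \<in> charge_space (total_charge S0)" by (simp add: charge_space_iff)
    show "W = {0} \<or> W = charge_space (total_charge S0)"
      if "fock.subspace W" "W \<subseteq> charge_space (total_charge S0)" "\<And>x y k b. b \<in> W \<Longrightarrow> bilin x y k b \<in> W"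
      for W :: "'n fock set"
      by (rule charge_space_irreducible) (use that in auto)
  qed
  obtain \<phi> :: "'v \<Rightarrow> 'n fock" where \<phi>: "Vector_Spaces.linear scale fscale \<phi>" "inj \<phi>"
    "range \<phi> = charge_space (total_charge S0)" "\<And>x y k u. \<phi> (T x y k u) = bilin x y k (\<phi> u)"
    "\<And>u. \<phi> (D u) = energy s (\<phi> u)"
    using isomorphism by blast
  interpret \<phi>: Vector_Spaces.linear scale fscale \<phi> by (rule \<phi>(1))
  show ?thesis unfolding has_character_def
  proof
    fix \<eta> :: "'n wt_hd"
    let ?S = "states s (total_charge S0) \<eta>"
    let ?B = "(\<lambda>S. single S 1) ` ?S :: 'n fock set"
    define b where "b = \<phi> -` ?B"
    have "?B \<subseteq> range \<phi>" unfolding \<phi>(3) by (auto simp: charge_space_iff states_def)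
    then have im: "\<phi> ` b = ?B" by (auto simp: b_def)
    have inj: "inj_on \<phi> X" for X using \<phi>(2) by (rule inj_on_subset) auto
    have injs: "inj_on (\<lambda>S. single S (1 :: complex)) ?S"
      by (rule inj_onI) (metis lookup_single_eq lookup_single_not_eq zero_neq_one)
    have fb: "finite b" unfolding b_def by (intro finite_vimageI finite_imageI fin \<phi>(2))
    have "card b = card ?B" using card_image[OF inj, of b] im by simp
    also have "\<dots> = card ?S" by (rule card_image[OF injs])
    finally have card: "card b = card ?S" .
    have ind: "independent b"
    proof
      assume "dependent b"
      then obtain u where u: "u \<in> b" "u \<in> span (b - {u})" unfolding dependent_def by blast
      have "\<phi> u \<in> fock.span (\<phi> ` (b - {u}))" unfolding \<phi>.span_image using u(2) by (rule imageI)
      also have "\<phi> ` (b - {u}) = ?B - {\<phi> u}" using image_set_diff[OF \<phi>(2), of b "{u}"] im by simp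
      finally have "fock.dependent ?B" unfolding fock.dependent_def using u(1) im by blast
      then show False using independent_singles[OF fin] by blast
    qed
    have "u \<in> span b \<longleftrightarrow> u \<in> weight_space \<eta>" for u
    proof -
      have "u \<in> span b \<longleftrightarrow> \<phi> u \<in> \<phi> ` span b" using \<phi>(2) by (simp add: inj_image_mem_iff)
      also have "\<dots> \<longleftrightarrow> keys (\<phi> u) \<subseteq> ?S" by (simp add: \<phi>.span_image[symmetric] im span_singles)
      also have "\<dots> \<longleftrightarrow> (\<forall>x. \<phi> (T x x 0 u) = \<phi> (scale (fst \<eta> $ x) u)) \<and> \<phi> (D u) = \<phi> (scale (snd \<eta>) u)"
        unfolding weight_states[symmetric] \<phi>(4,5) \<phi>.scale using \<phi>(3) by blast
      also have "\<dots> \<longleftrightarrow> u \<in> weight_space \<eta>" by (simp add: inj_eq[OF \<phi>(2)] weight_space_def)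
      finally show ?thesis .
    qed
    then have "span b = weight_space \<eta>" by blast
    then show "\<exists>b. finite b \<and> independent b \<and> span b = weight_space \<eta> \<and> card b = card ?S"
      using fb ind card by blast
  qed
qed

end

section \<open>Highest weight vectors of the charge components\<close>

lemma npair_P_zero: "psi x m f = 0 \<Longrightarrow> m \<ge> 0 \<Longrightarrow> npair x m y k f = 0"
  by (auto simp: npair_def psi_dual koszul_def str_sign_def)

lemma npair_Q_zero: "dual y k f = 0 \<Longrightarrow> k < 0 \<Longrightarrow> npair x m y k f = 0"
  by (auto simp: npair_def)

lemma bilin_zeroI: "(\<And>m. npair x (m + k) y m f = 0) \<Longrightarrow> bilin x y k f = 0"
  using bilin_eq[of "{}" x k y f] by simp

lemma diag_single: "diag c (single S 1) = fscale (c S) (single S 1)"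
  by (rule poly_mapping_eqI) (auto simp: lookup_single when_def)

lemma hw_vectorI:
  assumes "\<And>x y k. raising x y k \<Longrightarrow> bilin x y k (single S 1) = 0"
    and "\<And>x. wsum (\<lambda>z m. if z = x then 1 else 0) S = a $ x" "wsum (\<lambda>x m. of_int (m + s)) S = 0"
  shows "unit_action.hw_vector fscale bilin (energy s) (\<lambda>x. a $ x) (single S 1)"
  unfolding fock.hw_vector_def
proof (intro conjI allI impI)
  show "single S (1 :: complex) \<noteq> 0" by (metis lookup_single_eq lookup_zero zero_neq_one)
qed (use assms in \<open>simp_all add: bilin_diag energy_def diag_single\<close>)

text \<open>The first basis vector f_1 is a boson, so it can carry the whole charge in mode -1, the
  top particle mode; the shift 1 in \<open>energy\<close> gives this mode degree 0.\<close>

definition top_state :: "nat \<Rightarrow> 'n::{finite,linorder} state" where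
  "top_state l = ({||}, replicate_mset l (Min UNIV, - 1))"

text \<open>Antiparticles carry opposite weights, so the last basis vectors are extremal: e_n comes
  first but is a fermion and can be used only once, the rest goes to f_n. The charge is -(l + 1),
  and mode 0 has degree 0 without a shift.\<close>

definition bottom_state :: "nat \<Rightarrow> 'n::{finite,linorder} state" where
  "bottom_state l = ({|(Max UNIV, 0)|}, replicate_mset l (Max UNIV, 0))"

lemma wsum_replicate: "wsum c (A, replicate_mset l b) = wsum c (A, {#}) + of_nat l * (osign (snd b) * c (Inr (fst b)) (snd b))"
  by (induction l) (auto simp: wsum_add_mset algebra_simps)

lemma wsum_empty [simp]: "wsum c ({||}, {#}) = 0"
  by (simp add: wsum_def)

lemma wsum_top_state: "wsum c (top_state l) = of_nat l * c (Inr (Min UNIV)) (- 1)"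
  by (simp add: top_state_def wsum_replicate osign_def)

lemma wsum_bottom_state: "wsum c (bottom_state l) = - c (Inl (Max UNIV)) 0 - of_nat l * c (Inr (Max UNIV)) 0"
  by (simp add: bottom_state_def wsum_replicate wsum_finsert osign_def)

lemma top_state_hw:
  "unit_action.hw_vector fscale bilin (energy 1) (\<lambda>x. (real l *\<^sub>R axis (Inr (Min UNIV)) 1) $ x) (single (top_state l) 1)"
proof (rule hw_vectorI)
  fix x y :: "'a + 'a" and k
  assume r: "raising x y k"
  let ?w = "single (top_state l) 1 :: 'a fock"
  have psi: "psi x m ?w = 0" if "m \<ge> 0" for x :: "'a + 'a" and m
    using that by (auto simp: psi_def top_state_def fan_single_notin ban_single split: sum.split)
  have dual: "dual y m ?w = 0" if "m < 0" "m \<noteq> - 1 \<or> y \<noteq> Inr (Min UNIV)" for y :: "'a + 'a" and m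
    using that by (auto simp: dual_def top_state_def fan_single_notin ban_single split: sum.split)
  show "bilin x y k ?w = 0"
  proof (rule bilin_zeroI)
    fix m
    \<comment> \<open>A nonzero term would need m = -1, y = f_1 and m + k < 0, hence k = 0 and an x
      that precedes f_1.\<close>
    have "\<not> ns_less x (Inr (Min UNIV))"
      by (cases x) (auto simp: not_less)
    then have "m + k \<ge> 0 \<or> m < 0 \<and> (m \<noteq> - 1 \<or> y \<noteq> Inr (Min UNIV))"
      using r unfolding raising_def by (cases "m \<ge> 0") auto
    then show "npair x (m + k) y m ?w = 0"
    proof
      assume "m + k \<ge> 0"
      then show ?thesis by (intro npair_P_zero psi)
    next
      assume "m < 0 \<and> (m \<noteq> - 1 \<or> y \<noteq> Inr (Min UNIV))"
      then show ?thesis by (intro npair_Q_zero dual) simp_all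
    qed
  qed
qed (auto simp: wsum_top_state axis_def simp flip: of_real_def)

lemma bottom_state_hw:
  "unit_action.hw_vector fscale bilin (energy 0)
    (\<lambda>x. (- real l *\<^sub>R axis (Inr (Max UNIV)) 1 - axis (Inl (Max UNIV)) 1) $ x) (single (bottom_state l) 1)"
proof (rule hw_vectorI)
  fix x y :: "'a + 'a" and k
  assume r: "raising x y k"
  let ?w = "single (bottom_state l) 1 :: 'a fock"
  have psi: "psi x m ?w = 0" if "m > 0 \<or> m = 0 \<and> x \<noteq> Inl (Max UNIV) \<and> x \<noteq> Inr (Max UNIV)" for x :: "'a + 'a" and m
    using that by (cases x) (auto simp: psi_def bottom_state_def ban_single intro!: fan_single_notin)
  have dual: "dual y m ?w = 0" if "m < 0 \<or> m = 0 \<and> y = Inl (Max UNIV)" for y :: "'a + 'a" and m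
    using that by (auto simp: dual_def bottom_state_def fan_single_notin fcr_single_in ban_single split: sum.split)
  show "bilin x y k ?w = 0"
  proof (rule bilin_zeroI)
    fix m
    consider "m < 0" | "m + k > 0" "m \<ge> 0" | "m = 0" "k = 0" "ns_less x y"
      using r unfolding raising_def by (cases "m < 0"; cases "m = 0") auto
    then show "npair x (m + k) y m ?w = 0"
    proof cases
      case 1
      then show ?thesis by (intro npair_Q_zero dual) auto
    next
      case 2
      then show ?thesis by (intro npair_P_zero psi) auto
    next
      case 3
      have le: "i \<le> Max UNIV" for i :: 'a by simp
      \<comment> \<open>Nothing follows e_n, and only e_n follows f_n. In that last case the mode of
        e_n is already filled and \<open>dual\<close> gives 0.\<close>
      have "x \<noteq> Inl (Max UNIV) \<and> x \<noteq> Inr (Max UNIV) \<or> y = Inl (Max UNIV)"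
        using 3(3) le by (cases y) (auto simp: not_less[symmetric] antisym)
      then show ?thesis
      proof
        assume "x \<noteq> Inl (Max UNIV) \<and> x \<noteq> Inr (Max UNIV)"
        then show ?thesis using 3 by (intro npair_P_zero psi) auto
      next
        assume "y = Inl (Max UNIV)"
        moreover have "x \<noteq> y" using 3(3) by (cases x; cases y) auto
        ultimately show ?thesis using 3 dual[of 0 y] by (simp add: npair_def)
      qed
    qed
  qed
qed (auto simp: wsum_bottom_state axis_def simp flip: of_real_def)


section \<open>Counting functions of one-row hook Schur functions\<close>

text \<open>\<open>f\<close> is the generating function of the set \<open>X\<close> weighted by \<open>w\<close>; finite fibres exclude the junk values of \<open>card\<close> and \<open>sum\<close>.\<close>

definition counts :: "('e \<Rightarrow> nat) \<Rightarrow> 'x set \<Rightarrow> ('x \<Rightarrow> 'e) \<Rightarrow> bool" where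
  "counts f X w \<longleftrightarrow> (\<forall>e. finite {x \<in> X. w x = e} \<and> f e = card {x \<in> X. w x = e})"

lemma counts_pos: "counts f X w \<Longrightarrow> 0 < f e \<longleftrightarrow> (\<exists>x\<in>X. w x = e)"
  by (auto simp: counts_def card_gt_0_iff)

lemma card_fibres: "finite Z \<Longrightarrow> card Z = (\<Sum>y\<in>h ` Z. card {z \<in> Z. h z = y})"
  using sum.image_gen[of Z "\<lambda>_. 1 :: nat" h] by simp

text \<open>Pairs are grouped by the exponents of their two entries; the exponent pairs that occur
  are exactly the index set in \<open>fmul\<close>.\<close>

lemma counts_fmul:
  assumes f: "counts f X w" and g: "counts g Y u"
    and fin: "\<And>e. finite {p \<in> X \<times> Y. w (fst p) + u (snd p) = e}"
  shows "counts (fmul f g) (X \<times> Y) (\<lambda>p. w (fst p) + u (snd p))"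
  unfolding counts_def
proof (intro allI conjI fin)
  fix e
  let ?Z = "{p \<in> X \<times> Y. w (fst p) + u (snd p) = e}"
  let ?h = "\<lambda>p. (w (fst p), u (snd p))"
  have "card ?Z = (\<Sum>y\<in>?h ` ?Z. card {z \<in> ?Z. ?h z = y})" by (rule card_fibres[OF fin])
  also have "\<dots> = (\<Sum>(a, b)\<in>?h ` ?Z. f a * g b)"
  proof (rule sum.cong[OF refl])
    fix y assume "y \<in> ?h ` ?Z"
    then obtain a b where y: "y = (a, b)" "a + b = e" by auto
    have "{z \<in> ?Z. ?h z = y} = {x \<in> X. w x = a} \<times> {x \<in> Y. u x = b}"
      using y by auto
    then show "card {z \<in> ?Z. ?h z = y} = (case y of (a, b) \<Rightarrow> f a * g b)"
      using f g by (simp add: y counts_def card_cartesian_product)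
  qed
  also have "?h ` ?Z = {(a, b). a + b = e \<and> f a \<noteq> 0 \<and> g b \<noteq> 0}"
    by (auto simp: counts_pos[OF f] counts_pos[OF g] image_iff) metis
  finally show "fmul f g e = card ?Z" by (simp add: fmul_def)
qed

lemma counts_fsum:
  assumes f: "\<And>i. i \<in> I \<Longrightarrow> counts (f i) (X i) (w i)"
    and fin: "\<And>e. finite {p \<in> Sigma I X. w (fst p) (snd p) = e}"
  shows "counts (fsum f I) (Sigma I X) (\<lambda>p. w (fst p) (snd p))"
  unfolding counts_def
proof (intro allI conjI fin)
  fix e
  let ?Z = "{p \<in> Sigma I X. w (fst p) (snd p) = e}"
  have "card ?Z = (\<Sum>i\<in>fst ` ?Z. card {z \<in> ?Z. fst z = i})" by (rule card_fibres[OF fin])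
  also have "\<dots> = (\<Sum>i\<in>fst ` ?Z. f i e)"
  proof (rule sum.cong[OF refl])
    fix i assume i: "i \<in> fst ` ?Z"
    have "{z \<in> ?Z. fst z = i} = Pair i ` {x \<in> X i. w i x = e}"
      using i by auto
    moreover have "f i e = card {x \<in> X i. w i x = e}" using f[of i] i by (auto simp: counts_def)
    ultimately show "card {z \<in> ?Z. fst z = i} = f i e" by (simp add: card_image inj_on_def)
  qed
  also have "fst ` ?Z = {i. i \<in> I \<and> f i e \<noteq> 0}"
    by (auto simp: image_iff dest: counts_pos[OF f] iff: counts_pos[OF f]) blast
  finally show "fsum f I e = card ?Z" by (simp add: Defs.fsum_def)
qed

lemma bij_betw_fibre:
  assumes "bij_betw h Y X" "\<And>y. y \<in> Y \<Longrightarrow> w (h y) = u y"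
  shows "bij_betw h {y \<in> Y. u y = e} {x \<in> X. w x = e}"
  unfolding bij_betw_def
proof
  show "inj_on h {y \<in> Y. u y = e}"
    by (rule inj_on_subset[OF bij_betw_imp_inj_on[OF assms(1)]]) auto
  show "h ` {y \<in> Y. u y = e} = {x \<in> X. w x = e}"
    unfolding bij_betw_imp_surj_on[OF assms(1), symmetric] using assms(2) by auto
qed

lemma counts_bij:
  assumes "counts f X w" "bij_betw h Y X" "\<And>y. y \<in> Y \<Longrightarrow> w (h y) = u y"
  shows "counts f Y u"
  unfolding counts_def
proof (intro allI conjI)
  fix e
  note b = bij_betw_fibre[where w = w and u = u and e = e, OF assms(2,3)]
  show "finite {y \<in> Y. u y = e}" using assms(1) bij_betw_finite[OF b] by (simp add: counts_def)
  show "f e = card {y \<in> Y. u y = e}" using assms(1) bij_betw_same_card[OF b] by (simp add: counts_def)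
qed

lemma counts_fexp: "counts (fexp a) {()} (\<lambda>_. a)"
  by (auto simp: counts_def fexp_def)

lemma fsum_reindex: "inj_on h I \<Longrightarrow> fsum f (h ` I) = fsum (\<lambda>i. f (h i)) I"
proof
  fix e
  assume h: "inj_on h I"
  have "{j. j \<in> h ` I \<and> f j e \<noteq> 0} = h ` {i. i \<in> I \<and> f (h i) e \<noteq> 0}" by auto
  moreover have "inj_on h {i. i \<in> I \<and> f (h i) e \<noteq> 0}" using h by (auto simp: inj_on_def)
  ultimately show "fsum f (h ` I) e = fsum (\<lambda>i. f (h i)) I e"
    by (simp only: Defs.fsum_def sum.reindex comp_def)
qed

section \<open>One-row and one-column tableaux\<close>

lemma row_diagram: "skew_diagram (row_part a) (\<lambda>_. 0) = {0} \<times> {..<a}"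
  by (auto simp: skew_diagram_def row_part_def split: if_splits)

lemma row_ssyt: "ssyt (row_part a) (\<lambda>_. 0)
    = {T \<in> {0} \<times> {..<a} \<rightarrow>\<^sub>E UNIV. \<forall>j j'. j < j' \<and> j' < a \<longrightarrow> T (0, j) \<le> T (0, j')}"
  unfolding ssyt_def row_diagram by auto

text \<open>A row increases weakly, so sorting recovers it from its multiset of entries: complete
  symmetric functions, the bosonic count.\<close>

lemma row_bij: "bij_betw (\<lambda>T. image_mset T (mset_set ({0} \<times> {..<a}))) (ssyt (row_part a) (\<lambda>_. 0)) {M. size M = a}"
proof -
  let ?L = "\<lambda>T. map (\<lambda>j. T (0 :: nat, j)) [0..<a]"
  have "mset_set ({0 :: nat} \<times> {..<a}) = image_mset (Pair 0) (mset_set {..<a})"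
  proof -
    have "{0 :: nat} \<times> {..<a} = Pair 0 ` {..<a}" by auto
    then show ?thesis by (simp add: image_mset_mset_set inj_on_def)
  qed
  then have L: "image_mset T (mset_set ({0} \<times> {..<a})) = mset (?L T)" for T :: "nat \<times> nat \<Rightarrow> nat"
    by (simp add: image_mset.compositionality comp_def mset_set_upto_eq_mset_upto lessThan_atLeast0)
  have S: "sorted (?L T)" if "T \<in> ssyt (row_part a) (\<lambda>_. 0)" for T
    using that unfolding row_ssyt sorted_iff_nth_mono_less by auto
  show ?thesis unfolding bij_betw_def
  proof (intro conjI inj_onI set_eqI iffI)
    fix T T' assume T: "T \<in> ssyt (row_part a) (\<lambda>_. 0)" "T' \<in> ssyt (row_part a) (\<lambda>_. 0)"
      "image_mset T (mset_set ({0} \<times> {..<a})) = image_mset T' (mset_set ({0} \<times> {..<a}))"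
    then have "?L T = ?L T'" using S unfolding L by (metis sorted_list_of_multiset_mset sorted_sort_id)
    then have "T (0, j) = T' (0, j)" if "j < a" for j using that by auto
    then show "T = T'"
      using T(1,2) unfolding row_ssyt by (intro PiE_ext[of T "{0} \<times> {..<a}" "\<lambda>_. UNIV" T']) auto
  next
    fix M assume "M \<in> (\<lambda>T. image_mset T (mset_set ({0} \<times> {..<a}))) ` ssyt (row_part a) (\<lambda>_. 0)"
    then show "M \<in> {M. size M = a}" by auto
  next
    fix M :: "nat multiset" assume "M \<in> {M. size M = a}"
    then have a: "size M = a" by simp
    let ?l = "sorted_list_of_multiset M"
    define T where "T = restrict (\<lambda>c. ?l ! snd c) ({0 :: nat} \<times> {..<a})"
    have l: "length ?l = a" "sorted ?l" "mset ?l = M"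
      using a by (simp_all flip: size_mset)
    have "?L T = ?l" by (rule nth_equalityI) (auto simp: T_def l)
    then have "image_mset T (mset_set ({0} \<times> {..<a})) = M" unfolding L by (simp add: l)
    moreover have "T \<in> ssyt (row_part a) (\<lambda>_. 0)"
      unfolding row_ssyt T_def using l by (auto simp: sorted_iff_nth_mono_less)
    ultimately show "M \<in> (\<lambda>T. image_mset T (mset_set ({0} \<times> {..<a}))) ` ssyt (row_part a) (\<lambda>_. 0)"
      by (metis imageI)
  qed
qed

lemma counts_row:
  assumes "\<And>e. finite {M. size M = a \<and> (\<Sum>i\<in>#M. w i) = e}"
  shows "counts (schur (row_part a) w) {M. size M = a} (\<lambda>M. \<Sum>i\<in>#M. w i)"
proof -
  let ?D = "{0 :: nat} \<times> {..<a}"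
  have "bij_betw (\<lambda>T. image_mset T (mset_set ?D)) {T \<in> ssyt (row_part a) (\<lambda>_. 0). (\<Sum>c\<in>?D. w (T c)) = e}
    {M \<in> {M. size M = a}. (\<Sum>i\<in>#M. w i) = e}" for e
    by (rule bij_betw_fibre[OF row_bij]) (simp add: sum_unfold_sum_mset image_mset.compositionality comp_def)
  then have "card {T \<in> ssyt (row_part a) (\<lambda>_. 0). (\<Sum>c\<in>?D. w (T c)) = e}
    = card {M \<in> {M. size M = a}. (\<Sum>i\<in>#M. w i) = e}" for e by (rule bij_betw_same_card)
  then show ?thesis
    using assms by (simp add: counts_def schur_def skew_schur_def row_diagram)
qed

lemma conj_row: "conj_part (row_part k) i = (if i < k then 1 else 0)"
proof -
  have "{j. i < row_part k j} = (if i < k then {0} else {})" by (auto simp: row_part_def)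
  then show ?thesis by (simp add: conj_part_def)
qed

lemma column_diagram: "skew_diagram (conj_part (row_part k)) (conj_part (row_part a)) = {a..<k} \<times> {0}"
  by (auto simp: skew_diagram_def conj_row split: if_splits)

lemma column_ssyt: "ssyt (conj_part (row_part k)) (conj_part (row_part a))
    = {T \<in> {a..<k} \<times> {0} \<rightarrow>\<^sub>E UNIV. \<forall>i i'. a \<le> i \<and> i < i' \<and> i' < k \<longrightarrow> T (i, 0) < T (i', 0)}"
  unfolding ssyt_def column_diagram by auto

lemma column_inj:
  assumes "T \<in> ssyt (conj_part (row_part k)) (conj_part (row_part a))"
  shows "inj_on T ({a..<k} \<times> {0})"
proof (rule inj_onI)
  fix c c' assume c: "c \<in> {a..<k} \<times> {0}" "c' \<in> {a..<k} \<times> {0}" "T c = T c'"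
  have "T (i, 0) < T (i', 0)" if "a \<le> i" "i < i'" "i' < k" for i i'
    using assms that unfolding column_ssyt by blast
  then have "\<not> fst c < fst c'" "\<not> fst c' < fst c" using c by (auto, (metis less_irrefl)+)
  then show "c = c'" using c by auto
qed

text \<open>A column increases strictly, so it is recovered from its set of entries: elementary
  symmetric functions, the fermionic count.\<close>

lemma column_bij: "bij_betw (\<lambda>T. T ` ({a..<k} \<times> {0})) (ssyt (conj_part (row_part k)) (conj_part (row_part a)))
   {A. finite A \<and> card A = k - a}"
proof -
  let ?S = "ssyt (conj_part (row_part k)) (conj_part (row_part a))"
  let ?L = "\<lambda>T. map (\<lambda>i. T (i, 0 :: nat)) [a..<k]"
  have L: "T ` ({a..<k} \<times> {0}) = set (?L T)" for T :: "nat \<times> nat \<Rightarrow> nat" by auto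
  have S: "sorted_wrt (<) (?L T)" if "T \<in> ?S" for T
    using that unfolding column_ssyt sorted_wrt_iff_nth_less by auto
  show ?thesis unfolding bij_betw_def
  proof (intro conjI inj_onI set_eqI iffI)
    fix T T' assume T: "T \<in> ?S" "T' \<in> ?S" "T ` ({a..<k} \<times> {0}) = T' ` ({a..<k} \<times> {0})"
    then have "?L T = ?L T'" using S unfolding L by (intro strict_sorted_equal) auto
    then have "T (i, 0) = T' (i, 0)" if "i \<in> {a..<k}" for i using that by auto
    then show "T = T'"
      using T(1,2) unfolding column_ssyt by (intro PiE_ext[of T "{a..<k} \<times> {0}" "\<lambda>_. UNIV" T']) auto
  next
    fix A assume "A \<in> (\<lambda>T. T ` ({a..<k} \<times> {0})) ` ?S"
    then obtain T where T: "T \<in> ?S" "A = T ` ({a..<k} \<times> {0})" by auto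
    then show "A \<in> {A. finite A \<and> card A = k - a}" by (simp add: card_image[OF column_inj])
  next
    fix A :: "nat set" assume "A \<in> {A. finite A \<and> card A = k - a}"
    then have A: "finite A" "card A = k - a" by auto
    let ?l = "sorted_list_of_set A"
    define T where "T = restrict (\<lambda>c. ?l ! (fst c - a)) ({a..<k} \<times> {0 :: nat})"
    have l: "length ?l = k - a" "sorted_wrt (<) ?l" "set ?l = A"
      using A by simp_all
    have "?L T = ?l" by (rule nth_equalityI) (auto simp: T_def A)
    then have "T ` ({a..<k} \<times> {0}) = A" unfolding L by (simp add: l)
    moreover have "T \<in> ?S"
      unfolding column_ssyt T_def using l by (auto simp: sorted_wrt_iff_nth_less)
    ultimately show "A \<in> (\<lambda>T. T ` ({a..<k} \<times> {0})) ` ?S" by (metis imageI)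
  qed
qed

lemma counts_column:
  assumes "\<And>e. finite {A. finite A \<and> card A = k - a \<and> (\<Sum>i\<in>A. w i) = e}"
  shows "counts (skew_schur (conj_part (row_part k)) (conj_part (row_part a)) w)
    {A. finite A \<and> card A = k - a} (\<lambda>A. \<Sum>i\<in>A. w i)"
proof -
  let ?D = "{a..<k} \<times> {0 :: nat}"
  let ?S = "ssyt (conj_part (row_part k)) (conj_part (row_part a))"
  have w: "(\<Sum>i\<in>T ` ?D. w i) = (\<Sum>c\<in>?D. w (T c))" if "T \<in> ?S" for T
    by (simp add: sum.reindex[OF column_inj[OF that]])
  have "bij_betw (\<lambda>T. T ` ?D) {T \<in> ?S. (\<Sum>c\<in>?D. w (T c)) = e}
    {A \<in> {A. finite A \<and> card A = k - a}. (\<Sum>i\<in>A. w i) = e}" for e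
    by (rule bij_betw_fibre[where w = "\<lambda>A. \<Sum>i\<in>A. w i" and u = "\<lambda>T. \<Sum>c\<in>?D. w (T c)", OF column_bij w])
  then have "card {T \<in> ?S. (\<Sum>c\<in>?D. w (T c)) = e} = card {A \<in> {A. finite A \<and> card A = k - a}. (\<Sum>i\<in>A. w i) = e}" for e
    by (rule bij_betw_same_card)
  then show ?thesis
    using assms by (simp add: counts_def skew_schur_def column_diagram)
qed

lemma partitions_below_row: "{\<mu>. partition \<mu> \<and> \<mu> \<le> row_part k} = row_part ` {..k}"
proof (intro set_eqI iffI)
  fix \<mu> assume "\<mu> \<in> {\<mu>. partition \<mu> \<and> \<mu> \<le> row_part k}"
  then have m: "\<mu> i \<le> row_part k i" for i by (auto simp: le_fun_def)
  have "\<mu> = row_part (\<mu> 0)"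
  proof
    fix i show "\<mu> i = row_part (\<mu> 0) i" using m[of i] by (auto simp: row_part_def)
  qed
  moreover have "\<mu> 0 \<le> k" using m[of 0] by (simp add: row_part_def)
  ultimately show "\<mu> \<in> row_part ` {..k}" by blast
next
  fix \<mu> assume "\<mu> \<in> row_part ` {..k}"
  then obtain a where a: "\<mu> = row_part a" "a \<le> k" by auto
  have "finite {i. row_part a i \<noteq> 0}" by (rule finite_subset[of _ "{0}"]) (auto simp: row_part_def)
  then show "\<mu> \<in> {\<mu>. partition \<mu> \<and> \<mu> \<le> row_part k}"
    using a by (auto simp: partition_def row_part_def antimono_def le_fun_def)
qed

lemma inj_row_part: "inj row_part"
  by (rule injI) (metis row_part_def)

definition pair_wt :: "(nat \<Rightarrow> 'e) \<Rightarrow> (nat \<Rightarrow> 'e) \<Rightarrow> nat multiset \<times> nat set \<Rightarrow> 'e::ab_group_add" where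
  "pair_wt x y = (\<lambda>(M, A). (\<Sum>i\<in>#M. x i) + (\<Sum>i\<in>A. y i))"

definition pairs :: "nat \<Rightarrow> (nat multiset \<times> nat set) set" where
  "pairs k = {(M, A). finite A \<and> size M + card A = k}"

text \<open>For one row the hook Schur function is the sum over a of h_a in x times e_(k-a) in y.
  The size of the multiset recovers a, so all summands merge into one set of pairs.\<close>

lemma counts_HS:
  assumes fin: "\<And>e. finite {p. finite (snd p) \<and> pair_wt x y p = e}"
  shows "counts (HS k x y) (pairs k) (pair_wt x y)"
proof -
  let ?X = "\<lambda>a. {M :: nat multiset. size M = a}" and ?Y = "\<lambda>a. {A :: nat set. finite A \<and> card A = k - a}"
  have fin_X: "finite {M. size M = a \<and> (\<Sum>i\<in>#M. x i) = e}" for a e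
  proof (rule finite_subset[OF subsetI finite_imageI[OF fin[of e], of fst]])
    fix M assume "M \<in> {M. size M = a \<and> (\<Sum>i\<in>#M. x i) = e}"
    then show "M \<in> fst ` {p. finite (snd p) \<and> pair_wt x y p = e}"
      by (intro image_eqI[of _ _ "(M, {})"]) (auto simp: pair_wt_def)
  qed
  have fin_Y: "finite {A. finite A \<and> card A = k - a \<and> (\<Sum>i\<in>A. y i) = e}" for a e
  proof (rule finite_subset[OF subsetI finite_imageI[OF fin[of e], of snd]])
    fix A assume "A \<in> {A. finite A \<and> card A = k - a \<and> (\<Sum>i\<in>A. y i) = e}"
    then show "A \<in> snd ` {p. finite (snd p) \<and> pair_wt x y p = e}"
      by (intro image_eqI[of _ _ "({#}, A)"]) (auto simp: pair_wt_def)
  qed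
  have fin_XY: "finite {p \<in> ?X a \<times> ?Y a. (\<Sum>i\<in>#fst p. x i) + (\<Sum>i\<in>snd p. y i) = e}" for a e
    by (rule finite_subset[OF _ fin[of e]]) (auto simp: pair_wt_def)
  have 1: "counts (fmul (schur (row_part a) x) (skew_schur (conj_part (row_part k)) (conj_part (row_part a)) y))
     (?X a \<times> ?Y a) (\<lambda>p. (\<Sum>i\<in>#fst p. x i) + (\<Sum>i\<in>snd p. y i))" for a
    by (rule counts_fmul[OF counts_row[OF fin_X] counts_column[OF fin_Y] fin_XY])
  let ?W = "\<lambda>(a :: nat) p. (\<Sum>i\<in>#fst p. x i) + (\<Sum>i\<in>snd p. y i)"
  have 2: "finite {p \<in> Sigma {..k} (\<lambda>a. ?X a \<times> ?Y a). ?W (fst p) (snd p) = e}" for e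
    by (rule finite_subset[OF _ finite_cartesian_product[of "{..k}", OF _ fin[of e]]]) (auto simp: pair_wt_def)
  have "counts (fsum (\<lambda>a. fmul (schur (row_part a) x) (skew_schur (conj_part (row_part k)) (conj_part (row_part a)) y)) {..k})
     (Sigma {..k} (\<lambda>a. ?X a \<times> ?Y a)) (\<lambda>p. ?W (fst p) (snd p))"
    by (rule counts_fsum[OF 1 2])
  also have "fsum (\<lambda>a. fmul (schur (row_part a) x) (skew_schur (conj_part (row_part k)) (conj_part (row_part a)) y)) {..k} = HS k x y"
    unfolding HS_def hook_schur_def partitions_below_row
    by (rule fsum_reindex[symmetric, OF inj_on_subset[OF inj_row_part]]) auto
  finally show ?thesis
  proof (rule counts_bij)
    show "bij_betw (\<lambda>p. (size (fst p), p)) (pairs k) (Sigma {..k} (\<lambda>a. ?X a \<times> ?Y a))"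
      by (rule bij_betwI[of _ _ _ snd]) (auto simp: pairs_def)
  qed (auto simp: pair_wt_def split: prod.split)
qed


section \<open>States and pairs of one-row hook Schur functions\<close>

text \<open>Twice the degree in q of the variable with number \<open>i\<close>.\<close>

definition twice_deg :: "nat \<Rightarrow> nat \<Rightarrow> nat" where
  "twice_deg n i = 2 * (i div n) + 1"

definition pair_deg :: "nat \<Rightarrow> nat multiset \<times> nat set \<Rightarrow> nat" where
  "pair_deg n = (\<lambda>(M, A). (\<Sum>i\<in>#M. twice_deg n i) + (\<Sum>i\<in>A. twice_deg n i))"

text \<open>\<open>twice_deg\<close> is at least 1, which bounds the number of elements, and at
  least i div n, which bounds each element.\<close>

lemma finite_bounded_msets:
  assumes "n > 0"
  shows "finite {M. (\<Sum>i\<in>#M. twice_deg n i) \<le> N}"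
proof (rule finite_subset)
  show "{M. (\<Sum>i\<in>#M. twice_deg n i) \<le> N} \<subseteq> mset ` {xs. set xs \<subseteq> {..<n + n * N} \<and> length xs \<le> N}"
  proof
    fix M assume "M \<in> {M. (\<Sum>i\<in>#M. twice_deg n i) \<le> N}"
    then have M: "(\<Sum>i\<in>#M. twice_deg n i) \<le> N" by simp
    obtain xs where xs: "mset xs = M" using ex_mset by blast
    have "size M \<le> (\<Sum>i\<in>#M. twice_deg n i)" by (induction M) (auto simp: twice_deg_def)
    then have "length xs \<le> N" using M xs by (metis order.trans size_mset)
    moreover have "i < n + n * N" if "i \<in># M" for i
    proof -
      obtain M' where "M = add_mset i M'" using \<open>i \<in># M\<close> by (metis multi_member_split)
      then have "i div n \<le> N" using M by (simp add: twice_deg_def)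
      then have "n + n * (i div n) \<le> n + n * N" by simp
      then show ?thesis using dividend_less_times_div[OF assms, of i] by linarith
    qed
    ultimately show "M \<in> mset ` {xs. set xs \<subseteq> {..<n + n * N} \<and> length xs \<le> N}"
      using xs by (intro image_eqI[of _ _ xs]) auto
  qed
  show "finite (mset ` {xs. set xs \<subseteq> {..<n + n * N} \<and> length xs \<le> N})"
    by (intro finite_imageI finite_lists_length_le) auto
qed

lemma finite_bounded_pairs:
  assumes "n > 0"
  shows "finite {p. finite (snd p) \<and> pair_deg n p \<le> N}"
proof (rule finite_subset)
  let ?M = "{M. (\<Sum>i\<in>#M. twice_deg n i) \<le> N}"
  show "{p. finite (snd p) \<and> pair_deg n p \<le> N} \<subseteq> ?M \<times> set_mset ` ?M"
  proof clarsimp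
    fix M :: "nat multiset" and A :: "nat set" assume "finite A" "pair_deg n (M, A) \<le> N"
    then show "(\<Sum>i\<in>#M. twice_deg n i) \<le> N \<and> A \<in> set_mset ` ?M"
      by (intro conjI image_eqI[of _ _ "mset_set A"]) (auto simp: pair_deg_def sum_unfold_sum_mset)
  qed
  show "finite (?M \<times> set_mset ` ?M)" using finite_bounded_msets[OF assms] by auto
qed

lemma q_pow_eq: "q_pow r = (0, - of_real r)"
  by (simp add: q_pow_def q_wt_def restrict_hd_def delta_imag_def scaleR_conv_of_real)

lemma with_q_eq: "with_q v i = (v (var_index i) :: 'n::{finite,linorder} wt_hd) + (0, - of_nat (twice_deg CARD('n) i) / 2)"
  by (simp add: with_q_def q_pow_eq twice_deg_def field_simps)

lemma yz_wt_eq: "y_wt j = (axis (Inl j) 1, 0)" "z_wt j = (axis (Inr j) 1, 0)"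
  by (simp_all add: y_wt_def z_wt_def eps_wt_def del_wt_def restrict_hd_def)

lemmas variable_defs = zq_def yq_def zinvq_def yinvq_def with_q_eq yz_wt_eq

lemma fst_sum_mset: "fst (\<Sum>i\<in>#M. f i) = (\<Sum>i\<in>#M. fst (f i))"
  and snd_sum_mset: "snd (\<Sum>i\<in>#M. f i) = (\<Sum>i\<in>#M. snd (f i))"
  by (induction M) auto

lemma sum_mset_component: "(\<Sum>i\<in>#M. f i) $ x = (\<Sum>i\<in>#M. f i $ x)"
  by (induction M) auto

lemma snd_pair_wt:
  assumes "\<And>i. snd (x i) = - of_nat (twice_deg n i) / (2 :: complex)" "\<And>i. snd (y i) = - of_nat (twice_deg n i) / 2"
  shows "snd (pair_wt x y p) = - of_nat (pair_deg n p) / 2"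
proof -
  obtain M A where p: "p = (M, A)" by (cases p)
  have "(\<Sum>i\<in>#M. - of_nat (twice_deg n i) / 2 :: complex) = - of_nat (\<Sum>i\<in>#M. twice_deg n i) / 2"
    by (induction M) (auto simp: field_simps)
  moreover have "(\<Sum>i\<in>A. - of_nat (twice_deg n i) / 2 :: complex) = - of_nat (\<Sum>i\<in>A. twice_deg n i) / 2"
    by (simp add: sum_negf sum_divide_distrib)
  ultimately show ?thesis
    by (simp add: p pair_wt_def pair_deg_def snd_sum_mset snd_sum assms add_divide_distrib)
qed

abbreviation pos_wt :: "nat multiset \<times> nat set \<Rightarrow> 'n::{finite,linorder} wt_hd" where
  "pos_wt \<equiv> pair_wt zq yq"

abbreviation neg_wt :: "nat multiset \<times> nat set \<Rightarrow> 'n::{finite,linorder} wt_hd" where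
  "neg_wt \<equiv> pair_wt zinvq yinvq"

lemma snd_pos_wt: "snd (pos_wt p :: 'n::{finite,linorder} wt_hd) = - of_nat (pair_deg CARD('n) p) / 2"
  and snd_neg_wt: "snd (neg_wt p :: 'n::{finite,linorder} wt_hd) = - of_nat (pair_deg CARD('n) p) / 2"
  by (rule snd_pair_wt; simp add: variable_defs)+

definition quads :: "((nat multiset \<times> nat set) \<times> (nat multiset \<times> nat set)) set" where
  "quads = {(p, p'). finite (snd p) \<and> finite (snd p')}"

definition pair_size :: "nat multiset \<times> nat set \<Rightarrow> nat" where
  "pair_size p = size (fst p) + card (snd p)"

lemma pairs_iff: "p \<in> pairs k \<longleftrightarrow> finite (snd p) \<and> pair_size p = k"
  by (cases p) (auto simp: pairs_def pair_size_def)

text \<open>Both pairs lower the d-component, so e fixes the sum of their degrees and thereby bounds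
  each of them, whatever their sizes.\<close>

lemma finite_quads: "finite {z \<in> quads. pos_wt (fst z) + neg_wt (snd z) = (e :: 'n::{finite,linorder} wt_hd)}"
  (is "finite ?Z")
proof (cases "?Z = {}")
  case False
  then obtain z0 where z0: "z0 \<in> ?Z" by blast
  define N where "N = pair_deg CARD('n) (fst z0) + pair_deg CARD('n) (snd z0)"
  have deg: "- of_nat (pair_deg CARD('n) (fst z) + pair_deg CARD('n) (snd z)) / 2 = snd e" if "z \<in> ?Z" for z
  proof -
    have "snd (pos_wt (fst z) + neg_wt (snd z) :: 'n wt_hd) = snd e" using that by simp
    then have "snd e = - of_nat (pair_deg CARD('n) (fst z)) / 2 - of_nat (pair_deg CARD('n) (snd z)) / 2"
      by (simp add: snd_pos_wt snd_neg_wt)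
    then show ?thesis by (simp add: field_simps)
  qed
  have "pair_deg CARD('n) (fst z) + pair_deg CARD('n) (snd z) = N" if "z \<in> ?Z" for z
  proof -
    have "(of_nat (pair_deg CARD('n) (fst z) + pair_deg CARD('n) (snd z)) :: complex) = of_nat N"
      using deg[OF that] deg[OF z0] unfolding N_def by (metis divide_cancel_right neg_equal_iff_equal zero_neq_numeral)
    then show ?thesis by (simp only: of_nat_eq_iff)
  qed
  then have "?Z \<subseteq> {p. finite (snd p) \<and> pair_deg CARD('n) p \<le> N} \<times> {p. finite (snd p) \<and> pair_deg CARD('n) p \<le> N}"
    by (force simp: quads_def)
  then show ?thesis
    by (rule finite_subset) (intro finite_cartesian_product finite_bounded_pairs zero_less_card_finite)
next
  case True
  then show ?thesis by (simp only: finite.emptyI)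
qed

lemma finite_pos: "finite {p. finite (snd p) \<and> pos_wt p = (e :: 'n::{finite,linorder} wt_hd)}"
proof (rule finite_subset[OF subsetI finite_imageI[OF finite_quads[of e], of fst]])
  fix p assume "p \<in> {p. finite (snd p) \<and> pos_wt p = (e :: 'n wt_hd)}"
  then show "p \<in> fst ` {z \<in> quads. pos_wt (fst z) + neg_wt (snd z) = (e :: 'n wt_hd)}"
    by (intro image_eqI[of _ _ "(p, ({#}, {}))"]) (auto simp: quads_def pair_wt_def)
qed

lemma finite_neg: "finite {p. finite (snd p) \<and> neg_wt p = (e :: 'n::{finite,linorder} wt_hd)}"
proof (rule finite_subset[OF subsetI finite_imageI[OF finite_quads[of e], of snd]])
  fix p assume "p \<in> {p. finite (snd p) \<and> neg_wt p = (e :: 'n wt_hd)}"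
  then show "p \<in> snd ` {z \<in> quads. pos_wt (fst z) + neg_wt (snd z) = (e :: 'n wt_hd)}"
    by (intro image_eqI[of _ _ "(({#}, {}), p)"]) (auto simp: quads_def pair_wt_def)
qed

definition quads_of_charge :: "int \<Rightarrow> ((nat multiset \<times> nat set) \<times> (nat multiset \<times> nat set)) set" where
  "quads_of_charge l = {z \<in> quads. int (pair_size (fst z)) - int (pair_size (snd z)) = l}"

abbreviation hook_sum :: "int \<Rightarrow> 'n::{finite,linorder} wt_hd \<Rightarrow> nat" where
  "hook_sum l \<equiv> fsum (\<lambda>(m, k). fmul (HS m zq yq) (HS k zinvq yinvq)) {(m, k). int m - int k = l}"

text \<open>The sizes of the two pairs recover m and k, so the infinite sum over m - k = l is
  indexed by a single set.\<close>

lemma counts_character: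
  "counts (fmul (fexp c) (hook_sum l))
    (quads_of_charge l) (\<lambda>z. c + (pos_wt (fst z) + neg_wt (snd z)) :: 'n::{finite,linorder} wt_hd)"
proof -
  let ?I = "{(m, k). int m - int k = l}"
  let ?f = "\<lambda>i. fmul (HS (fst i) zq yq) (HS (snd i) zinvq yinvq) :: 'n wt_hd \<Rightarrow> nat"
  let ?w = "\<lambda>z. pos_wt (fst z) + neg_wt (snd z) :: 'n wt_hd"
  have sub: "pairs m \<times> pairs k \<subseteq> quads" for m k by (auto simp: pairs_iff quads_def)
  have 1: "counts (?f i) (pairs (fst i) \<times> pairs (snd i)) ?w" for i
  proof (rule counts_fmul[OF counts_HS[OF finite_pos] counts_HS[OF finite_neg]])
    fix e
    show "finite {p \<in> pairs (fst i) \<times> pairs (snd i). ?w p = e}"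
      by (rule finite_subset[OF _ finite_quads[of e]]) (use sub in auto)
  qed
  have 2: "finite {p \<in> Sigma ?I (\<lambda>i. pairs (fst i) \<times> pairs (snd i)). ?w (snd p) = e}" for e
  proof (rule finite_subset[OF subsetI finite_imageI[OF finite_quads[of e], of "\<lambda>z. ((pair_size (fst z), pair_size (snd z)), z)"]])
    fix p assume "p \<in> {p \<in> Sigma ?I (\<lambda>i. pairs (fst i) \<times> pairs (snd i)). ?w (snd p) = e}"
    then show "p \<in> (\<lambda>z. ((pair_size (fst z), pair_size (snd z)), z)) ` {z \<in> quads. ?w z = e}"
      by (intro image_eqI[of _ _ "snd p"]) (auto simp: pairs_iff quads_def)
  qed
  have "counts (fsum ?f ?I) (Sigma ?I (\<lambda>i. pairs (fst i) \<times> pairs (snd i))) (\<lambda>p. ?w (snd p))"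
    by (rule counts_fsum[where w = "\<lambda>_. ?w", OF 1 2])
  then have 3: "counts (fsum ?f ?I) (quads_of_charge l) ?w"
  proof (rule counts_bij)
    show "bij_betw (\<lambda>z. ((pair_size (fst z), pair_size (snd z)), z)) (quads_of_charge l)
      (Sigma ?I (\<lambda>i. pairs (fst i) \<times> pairs (snd i)))"
      by (rule bij_betwI[of _ _ _ snd]) (auto simp: quads_of_charge_def quads_def pairs_iff)
  qed simp
  have 4: "finite {p \<in> {()} \<times> quads_of_charge l. c + ?w (snd p) = e}" for e
    by (rule finite_subset[OF _ finite_cartesian_product[of "{()}", OF _ finite_quads[of "e - c"]]])
      (auto simp: quads_of_charge_def algebra_simps)
  have "counts (fmul (fexp c) (fsum ?f ?I)) ({()} \<times> quads_of_charge l) (\<lambda>p. c + ?w (snd p))"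
    by (rule counts_fmul[where w = "\<lambda>_. c", OF counts_fexp 3 4])
  then have "counts (fmul (fexp c) (fsum ?f ?I)) (quads_of_charge l) (\<lambda>z. c + ?w z)"
    by (rule counts_bij[where h = "Pair ()"]) (auto intro: bij_betwI[of _ _ _ snd])
  then show ?thesis by (simp only: case_prod_beta')
qed

section \<open>The dictionary between states and pairs of tableau data\<close>

definition particle :: "nat \<Rightarrow> 'n::{finite,linorder} \<times> int" where
  "particle i = (var_index i, - int (i div CARD('n)) - 1)"

text \<open>Modes -(i div n) - 1 and i div n lie at the same distance i div n + 1/2 from the
  midpoint -1/2. This distance is the exponent of q in variable number i.\<close>

definition antiparticle :: "nat \<Rightarrow> 'n::{finite,linorder} \<times> int" where
  "antiparticle i = (var_index i, int (i div CARD('n)))"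

lemma var_index_bij: "bij_betw (\<lambda>i. (var_index i :: 'n::{finite,linorder}, i div CARD('n))) UNIV UNIV"
proof -
  let ?L = "sorted_list_of_set (UNIV :: 'n set)"
  have L: "length ?L = CARD('n)" "distinct ?L" "set ?L = UNIV" by simp_all
  have nz: "CARD('n) > 0" by simp
  show ?thesis unfolding bij_betw_def
  proof (intro conjI injI set_eqI iffI)
    fix i j assume h: "(var_index i :: 'n, i div CARD('n)) = (var_index j, j div CARD('n))"
    then have "?L ! (i mod CARD('n)) = ?L ! (j mod CARD('n))" by (simp add: var_index_def)
    then have "i mod CARD('n) = j mod CARD('n)"
      using L nz by (metis mod_less_divisor nth_eq_iff_index_eq)
    then show "i = j" using h by (metis div_mult_mod_eq prod.inject)
  next
    fix a :: "'n \<times> nat"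
    obtain b d where a: "a = (b, d)" by (cases a)
    obtain p where p: "p < CARD('n)" "?L ! p = b" using L by (metis UNIV_I in_set_conv_nth)
    have "a = (var_index (d * CARD('n) + p), (d * CARD('n) + p) div CARD('n))"
      using p nz by (simp add: a var_index_def)
    then show "a \<in> range (\<lambda>i. (var_index i :: 'n, i div CARD('n)))" by (rule range_eqI)
  qed auto
qed

lemma inj_particle: "inj (particle :: nat \<Rightarrow> 'n::{finite,linorder} \<times> int)"
  and inj_antiparticle: "inj (antiparticle :: nat \<Rightarrow> 'n \<times> int)"
  by (rule injI, rule injD[OF bij_betw_imp_inj_on[OF var_index_bij[where 'n = 'n]]],
      simp add: particle_def antiparticle_def)+

lemma range_particle: "range particle = {a :: 'n::{finite,linorder} \<times> int. snd a < 0}"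
proof (intro set_eqI iffI)
  fix a :: "'n \<times> int" assume "a \<in> {a. snd a < 0}"
  moreover obtain i where "(fst a, nat (- snd a - 1)) = (var_index i, i div CARD('n))"
    by (rule surjE[OF bij_betw_imp_surj_on[OF var_index_bij[where 'n = 'n]]])
  ultimately have "a = particle i" by (cases a) (auto simp: particle_def)
  then show "a \<in> range particle" by blast
qed (auto simp: particle_def)

lemma range_antiparticle: "range antiparticle = {a :: 'n::{finite,linorder} \<times> int. \<not> snd a < 0}"
proof (intro set_eqI iffI)
  fix a :: "'n \<times> int" assume "a \<in> {a. \<not> snd a < 0}"
  moreover obtain i where "(fst a, nat (snd a)) = (var_index i, i div CARD('n))"
    by (rule surjE[OF bij_betw_imp_surj_on[OF var_index_bij[where 'n = 'n]]])
  ultimately have "a = antiparticle i" by (cases a) (auto simp: antiparticle_def)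
  then show "a \<in> range antiparticle" by blast
qed (auto simp: antiparticle_def)

lemma snd_particle [simp]: "snd (particle i) < 0" "\<not> snd (antiparticle i) < 0"
  by (simp_all add: particle_def antiparticle_def)

definition decode :: "(nat multiset \<times> nat set) \<times> (nat multiset \<times> nat set) \<Rightarrow> 'n::{finite,linorder} state" where
  "decode = (\<lambda>((M, A), (M', A')). (Abs_fset (particle ` A \<union> antiparticle ` A'),
     image_mset particle M + image_mset antiparticle M'))"

definition encode :: "'n::{finite,linorder} state \<Rightarrow> (nat multiset \<times> nat set) \<times> (nat multiset \<times> nat set)" where
  "encode = (\<lambda>(F, B).
     ((image_mset (inv particle) {#b \<in># B. snd b < 0#}, inv particle ` {a \<in> fset F. snd a < 0}),
      (image_mset (inv antiparticle) {#b \<in># B. \<not> snd b < 0#}, inv antiparticle ` {a \<in> fset F. \<not> snd a < 0})))"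

lemma fset_Abs: "finite X \<Longrightarrow> fset (Abs_fset X) = X"
  by (simp add: Abs_fset_inverse)

lemma encode_decode: "z \<in> quads \<Longrightarrow> encode (decode z :: 'n::{finite,linorder} state) = z"
proof -
  assume "z \<in> quads"
  then obtain M A M' A' where z: "z = ((M, A), (M', A'))" "finite A" "finite A'"
    by (auto simp: quads_def)
  have p: "inv particle (particle i :: 'n \<times> int) = i" "inv antiparticle (antiparticle i :: 'n \<times> int) = i" for i
    by (simp_all add: inj_particle inj_antiparticle)
  have "{a \<in> particle ` A \<union> antiparticle ` A'. snd (a :: 'n \<times> int) < 0} = particle ` A"
    "{a \<in> particle ` A \<union> antiparticle ` A'. \<not> snd (a :: 'n \<times> int) < 0} = antiparticle ` A'"
    by auto
  moreover have "{#b \<in># image_mset particle M + image_mset antiparticle M'. snd (b :: 'n \<times> int) < 0#} = image_mset particle M"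
    "{#b \<in># image_mset particle M + image_mset antiparticle M'. \<not> snd (b :: 'n \<times> int) < 0#} = image_mset antiparticle M'"
    by (simp_all add: filter_mset_image_mset)
  ultimately show ?thesis
    using z by (simp add: decode_def encode_def fset_Abs image_image p image_mset.compositionality comp_def)
qed

lemma decode_encode: "decode (encode S) = (S :: 'n::{finite,linorder} state)"
proof -
  obtain F B where S: "S = (F, B)" by (cases S)
  have p: "particle (inv particle a) = a" if "snd a < 0" for a :: "'n \<times> int"
    using that by (intro f_inv_into_f) (auto simp: range_particle)
  have q: "antiparticle (inv antiparticle a) = a" if "\<not> snd a < 0" for a :: "'n \<times> int"
    using that by (intro f_inv_into_f) (auto simp: range_antiparticle)
  have "particle ` inv particle ` {a \<in> fset F. snd a < 0} = {a \<in> fset F. snd a < 0}"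
    "antiparticle ` inv antiparticle ` {a \<in> fset F. \<not> snd a < 0} = {a \<in> fset F. \<not> snd a < 0}"
    by (auto simp: image_image p q image_iff)
  then have "particle ` inv particle ` {a \<in> fset F. snd a < 0} \<union> antiparticle ` inv antiparticle ` {a \<in> fset F. \<not> snd a < 0} = fset F"
    by auto
  moreover have "image_mset particle (image_mset (inv particle) {#b \<in># B. snd b < 0#}) = {#b \<in># B. snd b < 0#}"
    "image_mset antiparticle (image_mset (inv antiparticle) {#b \<in># B. \<not> snd b < 0#}) = {#b \<in># B. \<not> snd b < 0#}"
    using image_mset_cong[of "{#b \<in># B. snd b < 0#}" "particle \<circ> inv particle" id]
      image_mset_cong[of "{#b \<in># B. \<not> snd b < 0#}" "antiparticle \<circ> inv antiparticle" id]
    by (simp_all add: image_mset.compositionality p q comp_def)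
  ultimately show ?thesis
    by (simp add: S decode_def encode_def fset_inverse flip: multiset_partition)
qed

lemma encode_quads: "encode S \<in> quads"
  by (auto simp: encode_def quads_def split: prod.split)

lemma wsum_decode:
  assumes "finite A" "finite A'"
  shows "wsum c (decode ((M, A), (M', A')) :: 'n::{finite,linorder} state) =
     (\<Sum>i\<in>A. c (Inl (var_index i)) (- int (i div CARD('n)) - 1)) + (\<Sum>i\<in>#M. c (Inr (var_index i)) (- int (i div CARD('n)) - 1))
     - ((\<Sum>i\<in>A'. c (Inl (var_index i)) (int (i div CARD('n)))) + (\<Sum>i\<in>#M'. c (Inr (var_index i)) (int (i div CARD('n)))))"
proof -
  let ?h = "\<lambda>a. osign (snd a) * c (Inl (fst a)) (snd a)"
  have "(\<Sum>a\<in>particle ` A \<union> antiparticle ` A'. ?h a) = (\<Sum>a\<in>particle ` A. ?h a) + (\<Sum>a\<in>antiparticle ` A'. ?h a)"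
    using assms by (intro sum.union_disjoint) (auto, metis snd_particle)
  also have "(\<Sum>a\<in>particle ` A. ?h a) = (\<Sum>i\<in>A. c (Inl (var_index i)) (- int (i div CARD('n)) - 1))"
    by (subst sum.reindex[OF inj_on_subset[OF inj_particle]]) (auto simp: particle_def osign_def)
  also have "(\<Sum>a\<in>antiparticle ` A'. ?h a) = - (\<Sum>i\<in>A'. c (Inl (var_index i)) (int (i div CARD('n))))"
    by (subst sum.reindex[OF inj_on_subset[OF inj_antiparticle]]) (auto simp: antiparticle_def osign_def sum_negf)
  finally have 1: "(\<Sum>a\<in>particle ` A \<union> antiparticle ` A'. ?h a)
    = (\<Sum>i\<in>A. c (Inl (var_index i)) (- int (i div CARD('n)) - 1))
      + - (\<Sum>i\<in>A'. c (Inl (var_index i)) (int (i div CARD('n))))" .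
  have 2: "(\<Sum>b\<in>#image_mset particle M. osign (snd b) * c (Inr (fst b)) (snd b))
     = (\<Sum>i\<in>#M. c (Inr (var_index i)) (- int (i div CARD('n)) - 1))"
    by (induction M) (auto simp: particle_def osign_def)
  have 3: "(\<Sum>b\<in>#image_mset antiparticle M'. osign (snd b) * c (Inr (fst b)) (snd b))
     = - (\<Sum>i\<in>#M'. c (Inr (var_index i)) (int (i div CARD('n))))"
    by (induction M') (auto simp: antiparticle_def osign_def)
  show ?thesis
    using assms 1 2 3 by (simp add: wsum_def decode_def fset_Abs)
qed

lemma total_charge_decode:
  assumes "z \<in> quads"
  shows "total_charge (decode z :: 'n::{finite,linorder} state) = of_int (int (pair_size (fst z)) - int (pair_size (snd z)))"
proof -
  obtain M A M' A' where z: "z = ((M, A), (M', A'))" "finite A" "finite A'"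
    using assms by (auto simp: quads_def)
  have "(\<Sum>i\<in>#M. 1 :: complex) = of_nat (size M)" for M :: "nat multiset" by (induction M) auto
  then show ?thesis using z by (simp add: total_charge_def wsum_decode pair_size_def)
qed

lemma decode_bij: "bij_betw decode (quads_of_charge l) {S :: 'n::{finite,linorder} state. total_charge S = of_int l}"
proof (rule bij_betwI[of _ _ _ encode])
  show "decode \<in> quads_of_charge l \<rightarrow> {S :: 'n state. total_charge S = of_int l}"
    by (auto simp: quads_of_charge_def total_charge_decode)
  show "encode \<in> {S :: 'n state. total_charge S = of_int l} \<rightarrow> quads_of_charge l"
  proof
    fix S :: "'n state" assume S: "S \<in> {S. total_charge S = of_int l}"
    have "total_charge S = of_int (int (pair_size (fst (encode S))) - int (pair_size (snd (encode S))))"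
      using total_charge_decode[OF encode_quads[of S], where 'n = 'n] by (simp add: decode_encode)
    with S have "(of_int (int (pair_size (fst (encode S))) - int (pair_size (snd (encode S)))) :: complex) = of_int l"
      by simp
    then have "int (pair_size (fst (encode S))) - int (pair_size (snd (encode S))) = l"
      by (simp only: of_int_eq_iff)
    then show "encode S \<in> quads_of_charge l" by (simp add: quads_of_charge_def encode_quads)
  qed
qed (auto simp: decode_encode quads_of_charge_def encode_decode)

text \<open>A particle contributes its mode plus s, an antiparticle the negative of this. Measured
  from -1/2, each contribution is minus the q-degree, plus s - 1/2 for a particle or minus it for an
  antiparticle. These corrections total (s - 1/2) l, and q has d-component -1.\<close>

lemma state_wt_decode:
  assumes "z \<in> quads_of_charge l"
  shows "state_wt s (decode z :: 'n::{finite,linorder} state)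
     = q_pow ((1 / 2 - real_of_int s) * real_of_int l) + (pos_wt (fst z) + neg_wt (snd z))"
proof -
  obtain M A M' A' where z: "z = ((M, A), (M', A'))" "finite A" "finite A'"
    using assms by (auto simp: quads_def quads_of_charge_def)
  have l: "(of_nat (size M) + of_nat (card A) - (of_nat (size M') + of_nat (card A')) :: complex) = of_int l"
    using assms by (auto simp: z quads_of_charge_def pair_size_def)
  let ?g = "\<lambda>i. - of_nat (twice_deg CARD('n) i) / 2 :: complex"
  have t: "of_int (- int (i div CARD('n)) - 1 + s) = ?g i + (of_int s - 1 / 2)"
    "of_int (int (i div CARD('n)) + s) = - ?g i + (of_int s - 1 / 2)" for i
    by (simp_all add: twice_deg_def field_simps)
  have c: "(\<Sum>i\<in>#M. f i + r) = (\<Sum>i\<in>#M. f i) + r * of_nat (size M)"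
    "(\<Sum>i\<in>#M. - f i) = - (\<Sum>i\<in>#M. f i)" for f :: "nat \<Rightarrow> complex" and r M
    by (induction M) (auto simp: algebra_simps)
  have alg: "(a + S * ca) + (b + S * cb) - ((- a' + S * ca') + (- b' + S * cb'))
      = S * (cb + ca - (cb' + ca')) + (b + a + (b' + a'))" for a b a' b' S ca cb ca' cb' :: complex
    by (simp add: algebra_simps)
  have c': "(\<Sum>i\<in>A. f i + r) = (\<Sum>i\<in>A. f i) + r * of_nat (card A)" for f :: "nat \<Rightarrow> complex" and r A
    by (simp add: sum.distrib mult.commute)
  have "snd (state_wt s (decode z :: 'n state)) = (of_int s - 1 / 2) * of_int l
     + ((\<Sum>i\<in>#M. - of_nat (twice_deg CARD('n) i) / 2) + (\<Sum>i\<in>A. - of_nat (twice_deg CARD('n) i) / 2)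
     + ((\<Sum>i\<in>#M'. - of_nat (twice_deg CARD('n) i) / 2) + (\<Sum>i\<in>A'. - of_nat (twice_deg CARD('n) i) / 2)))"
    unfolding state_wt_def z(1) snd_conv wsum_decode[OF z(2,3)] t c c' sum_negf l[symmetric]
    by (rule alg)
  also have "\<dots> = snd (q_pow ((1 / 2 - real_of_int s) * real_of_int l) + (pos_wt (fst z) + neg_wt (snd z)) :: 'n wt_hd)"
    by (simp add: z(1) pair_wt_def snd_sum_mset snd_sum variable_defs q_pow_eq algebra_simps)
  finally have 1: "snd (state_wt s (decode z :: 'n state)) = \<dots>" .
  have "fst (state_wt s (decode z :: 'n state)) $ x
    = fst (q_pow ((1 / 2 - real_of_int s) * real_of_int l) + (pos_wt (fst z) + neg_wt (snd z)) :: 'n wt_hd) $ x" for x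
  proof -
    have ax: "axis y (1 :: complex) $ x = (if y = x then 1 else 0)" for y
      by (auto simp: axis_def)
    have n: "(\<Sum>i\<in>#M. - f i) = - (\<Sum>i\<in>#M. f i)" for M :: "nat multiset" and f :: "nat \<Rightarrow> complex"
      by (induction M) auto
    show ?thesis
      unfolding state_wt_def z(1) wsum_decode[OF z(2,3)]
      by (simp add: wsum_decode[OF z(2,3)] pair_wt_def fst_sum_mset fst_sum sum_mset_component sum_component variable_defs q_pow_eq
          ax n sum_negf algebra_simps)
  qed
  then have "fst (state_wt s (decode z :: 'n state))
    = fst (q_pow ((1 / 2 - real_of_int s) * real_of_int l) + (pos_wt (fst z) + neg_wt (snd z)) :: 'n wt_hd)"
    by (simp add: vec_eq_iff)
  with 1 show ?thesis by (rule prod_eqI[rotated])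
qed

theorem counts_states:
  "counts (fmul (fexp (q_pow ((1 / 2 - real_of_int s) * real_of_int l))) (hook_sum l))
    {S :: 'n::{finite,linorder} state. total_charge S = of_int l} (state_wt s)"
proof (rule counts_bij[OF counts_character])
  show "bij_betw (inv_into (quads_of_charge l) decode) {S :: 'n state. total_charge S = of_int l} (quads_of_charge l)"
    by (rule bij_betw_inv_into[OF decode_bij])
  fix S :: "'n state" assume S: "S \<in> {S. total_charge S = of_int l}"
  define z where "z = inv_into (quads_of_charge l) (decode :: _ \<Rightarrow> 'n state) S"
  have z: "z \<in> quads_of_charge l" "decode z = S"
    using S bij_betw_imp_surj_on[OF decode_bij[of l, where 'n = 'n]] unfolding z_def
    by (metis inv_into_into, metis f_inv_into_f)
  show "q_pow ((1 / 2 - real_of_int s) * real_of_int l) + (pos_wt (fst (inv_into (quads_of_charge l) decode S))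
    + neg_wt (snd (inv_into (quads_of_charge l) decode S))) = state_wt s S"
    using state_wt_decode[OF z(1), of s, where 'n = 'n] z(2) by (simp add: z_def)
qed

corollary states_finite: "finite (states s (of_int l) (\<eta> :: 'n::{finite,linorder} wt_hd))"
  and card_states: "card (states s (of_int l) (\<eta> :: 'n::{finite,linorder} wt_hd))
    = fmul (fexp (q_pow ((1 / 2 - real_of_int s) * real_of_int l))) (hook_sum l) \<eta>"
proof -
  have "finite {S \<in> {S. total_charge S = of_int l}. state_wt s S = \<eta>}
    \<and> fmul (fexp (q_pow ((1 / 2 - real_of_int s) * real_of_int l))) (hook_sum l) \<eta>
      = card {S \<in> {S. total_charge S = of_int l}. state_wt s S = \<eta>}"
    using counts_states[of s l, where 'n = 'n] unfolding counts_def by blast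
  moreover have "states s (of_int l) \<eta> = {S \<in> {S. total_charge S = of_int l}. state_wt s S = \<eta>}"
    by (auto simp: states_def)
  ultimately show "finite (states s (of_int l) \<eta>)" "card (states s (of_int l) \<eta>)
    = fmul (fexp (q_pow ((1 / 2 - real_of_int s) * real_of_int l))) (hook_sum l) \<eta>"
    by metis+
qed

theorem theorem5p1:
  fixes scale :: "complex \<Rightarrow> 'v::ab_group_add \<Rightarrow> 'v"
    and V :: "bool \<Rightarrow> 'v set"
    and act :: "'n::{finite,linorder} ghat \<Rightarrow> 'v \<Rightarrow> 'v"
    and l :: int
  assumes "ghat_module scale V act"
  shows "(0 \<le> l \<and>
      ghat_module.is_L scale V act ns_borel
        (real_of_int l *\<^sub>R del_wt (Min UNIV) + Lambda0) \<longrightarrow>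
      ghat_module.has_character scale act
        (fmul (fexp (q_pow (- real_of_int l / 2)))
          (fsum (\<lambda>(m, k). fmul (HS m zq yq) (HS k zinvq yinvq)) {(m, k). int m - int k = l})))
    \<and> (l < 0 \<and>
      ghat_module.is_L scale V act ns_borel
        (real_of_int (l + 1) *\<^sub>R del_wt (Max UNIV) - eps_wt (Max UNIV) + Lambda0) \<longrightarrow>
      ghat_module.has_character scale act
        (fmul (fexp (q_pow (real_of_int l / 2)))
          (fsum (\<lambda>(m, k). fmul (HS m zq yq) (HS k zinvq yinvq)) {(m, k). int m - int k = l})))"
proof -
  interpret ghat_module scale V act by fact
  show ?thesis
  proof (intro conjI impI; elim conjE)
    assume l: "0 \<le> l" and L: "is_L ns_borel (real_of_int l *\<^sub>R del_wt (Min UNIV) + Lambda0)"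
    define k where "k = nat l"
    have k: "real_of_int l = real k" using l by (simp add: k_def)
    have w: "real_of_int l *\<^sub>R del_wt (Min UNIV) + Lambda0 = (real k *\<^sub>R axis (Inr (Min UNIV :: 'n)) 1, 1, 0)"
      unfolding k by (simp add: del_wt_def Lambda0_def)
    have c: "total_charge (top_state k :: 'n state) = of_int l"
      using l by (simp add: total_charge_def wsum_top_state k_def)
    \<comment> \<open>The shift s = 1 turns the exponent (1/2 - s) l into -l/2.\<close>
    have "has_character (\<lambda>\<eta>. card (states 1 (of_int l) \<eta>))"
      using fock_character[OF L[unfolded w] top_state_hw] unfolding c by (simp only: states_finite)
    then show "has_character (fmul (fexp (q_pow (- real_of_int l / 2)))
          (fsum (\<lambda>(m, k). fmul (HS m zq yq) (HS k zinvq yinvq)) {(m, k). int m - int k = l}))"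
      unfolding card_states by simp
  next
    assume l: "l < 0" and L: "is_L ns_borel (real_of_int (l + 1) *\<^sub>R del_wt (Max UNIV) - eps_wt (Max UNIV) + Lambda0)"
    \<comment> \<open>Besides its k bosons \<open>bottom_state k\<close> contains one fermion, so
      its charge -k - 1 has to equal l.\<close>
    define k where "k = nat (- l - 1)"
    have k: "real_of_int (l + 1) = - real k" using l by (simp add: k_def)
    have w: "real_of_int (l + 1) *\<^sub>R del_wt (Max UNIV) - eps_wt (Max UNIV) + Lambda0
       = (- real k *\<^sub>R axis (Inr (Max UNIV :: 'n)) 1 - axis (Inl (Max UNIV)) 1, 1, 0)"
      unfolding k by (simp add: del_wt_def eps_wt_def Lambda0_def)
    have "(of_nat k :: complex) = of_int (- l - 1)" using l by (simp add: k_def)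
    then have c: "total_charge (bottom_state k :: 'n state) = of_int l"
      by (simp add: total_charge_def wsum_bottom_state)
    \<comment> \<open>Here s = 0, and the exponent is l/2.\<close>
    have "has_character (\<lambda>\<eta>. card (states 0 (of_int l) \<eta>))"
      using fock_character[OF L[unfolded w] bottom_state_hw] unfolding c by (simp only: states_finite)
    then show "has_character (fmul (fexp (q_pow (real_of_int l / 2)))
          (fsum (\<lambda>(m, k). fmul (HS m zq yq) (HS k zinvq yinvq)) {(m, k). int m - int k = l}))"
      unfolding card_states by simp
  qed
qed

end
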